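(* Let $L$, $M$ and $N$ be closed subspaces of a Banach space $Z$. (i) The pair $(M,N)$ is not tauberian if and only if there exist a compact operator $K\colon Z\to Z$ and a non-reflexive closed subspace $E$ of $Z$ with $E\subset M$ such that $(I-K)(E)\subset N$. (ii) The pair $(L,M)$ is not cotauberian if and only if there exist a compact operator $K\colon Z\to Z$ and a closed subspace $F$ of $Z$ containing $M$ such that $Z/F$ is non-reflexive and $(I-K)^{-1}(F)\supset L$.
   Context: $I$ is the identity on $Z$ and $(I-K)^{-1}(F)$ is the preimage of $F$ under $I-K$. For a closed subspace $M$ of a Banach space $Z$, $J_M\colon M\to Z$ is the inclusion and $Q_M\colon Z\to Z/M$ the quotient map. A Banach space $X$ is identified with its canonical image in $X^{**}$. A bounded operator $S\colon X\to Y$ between Banach spaces is tauberian if $S^{**}(X^{**}\setminus X)\subset Y^{**}\setminus Y$, and cotauberian if its conjugate $S^*\colon Y^*\to X^*$ is tauberian. A pair $(A,B)$ of closed subspaces of $Z$ is tauberian (respectively cotauberian) if the operator $Q_BJ_A\colon A\to Z/B$ is tauberian (respectively cotauberian). *)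

theory Defs
  imports "HOL-Analysis.Analysis"
begin

text \<open>
  Scalars: the class below has exactly the instances (up to isometric isomorphism) \<open>real\<close>
  and \<open>complex\<close>, so that real and complex Banach spaces are treated together.
\<close>

class real_or_complex = real_normed_field +
  assumes real_or_complex:
    "(\<forall>z. \<exists>a. z = a *\<^sub>R 1) \<or>
     (\<exists>i. i * i = - 1 \<and>
       (\<forall>z. \<exists>a b. z = a *\<^sub>R 1 + b *\<^sub>R i \<and> norm z = sqrt (a\<^sup>2 + b\<^sup>2)))"

instance real :: real_or_complex
  by standard auto

instance complex :: real_or_complex
proof
  have "\<exists>a b. z = a *\<^sub>R 1 + b *\<^sub>R \<i> \<and> norm z = sqrt (a\<^sup>2 + b\<^sup>2)" for z :: complex
    by (intro exI[of _ "Re z"] exI[of _ "Im z"]) (simp add: complex_eq_iff cmod_def)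
  then show "(\<forall>z::complex. \<exists>a. z = a *\<^sub>R 1) \<or>
     (\<exists>i::complex. i * i = - 1 \<and>
       (\<forall>z. \<exists>a b. z = a *\<^sub>R 1 + b *\<^sub>R i \<and> norm z = sqrt (a\<^sup>2 + b\<^sup>2)))"
    by (intro disjI2 exI[of _ \<i>]) simp
qed

text \<open>
  A Banach space over \<open>'k\<close>: completeness and the norm come from the class \<open>banach\<close>, and
  \<open>scl\<close> is a \<open>'k\<close>-scalar multiplication that extends the underlying real one. For
  \<open>'k = real\<close> this forces \<open>scl = scaleR\<close>.
\<close>

locale banach_space_over = vector_space scl
  for scl :: "'k::real_or_complex \<Rightarrow> 'z::banach \<Rightarrow> 'z" +
  assumes norm_scl: "norm (scl c x) = norm c * norm x"
    and scl_of_real: "scl (of_real r) x = r *\<^sub>R x"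

lemma banach_space_over_scaleR: "banach_space_over (scaleR :: real \<Rightarrow> 'z::banach \<Rightarrow> 'z)"
  by unfold_locales (simp_all add: scaleR_add_right scaleR_add_left)

definition closed_subspace :: "('k::real_or_complex \<Rightarrow> 'z::banach \<Rightarrow> 'z) \<Rightarrow> 'z set \<Rightarrow> bool" where
  "closed_subspace scl A \<longleftrightarrow> module.subspace scl A \<and> closed A"

text \<open>Linearity and relative compactness of the image of the unit ball give boundedness.\<close>

definition compact_operator ::
  "('k::real_or_complex \<Rightarrow> 'z::banach \<Rightarrow> 'z) \<Rightarrow> ('z \<Rightarrow> 'z) \<Rightarrow> bool" where
  "compact_operator scl K \<longleftrightarrow>
     Vector_Spaces.linear scl scl K \<and> compact (closure (K ` cball 0 1))"

text \<open>
  Normed spaces with an explicit carrier. Subspaces and quotients depend on a term and so are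
  not types; elements of a quotient are cosets.
\<close>

record ('k, 'a) nspace =
  carr :: "'a set"
  add :: "'a \<Rightarrow> 'a \<Rightarrow> 'a"
  smul :: "'k \<Rightarrow> 'a \<Rightarrow> 'a"
  nrm :: "'a \<Rightarrow> real"

definition sub_space ::
  "('k::real_or_complex \<Rightarrow> 'z::banach \<Rightarrow> 'z) \<Rightarrow> 'z set \<Rightarrow> ('k, 'z) nspace" where
  "sub_space scl A = \<lparr>carr = A, add = (+), smul = scl, nrm = norm\<rparr>"

definition quot_map :: "'z::banach set \<Rightarrow> 'z \<Rightarrow> 'z set" where
  "quot_map B x = {x + b | b. b \<in> B}"

text \<open>The summand \<open>b\<close> in \<open>smul\<close> is there for the scalar 0, where the product must be
  the zero coset \<open>B\<close> and not \<open>{0}\<close>.\<close>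

definition quot_space ::
  "('k::real_or_complex \<Rightarrow> 'z::banach \<Rightarrow> 'z) \<Rightarrow> 'z set \<Rightarrow> ('k, 'z set) nspace" where
  "quot_space scl B =
     \<lparr>carr = range (quot_map B),
      add = (\<lambda>C D. {c + d | c d. c \<in> C \<and> d \<in> D}),
      smul = (\<lambda>k C. {scl k c + b | c b. c \<in> C \<and> b \<in> B}),
      nrm = (\<lambda>C. INF c\<in>C. norm c)\<rparr>"

text \<open>
  The dual space. Functionals are functions on the whole type, so they are made
  \<open>undefined\<close> outside the carrier in order that equality is equality on the carrier.
\<close>

definition dual :: "('k::real_or_complex, 'a) nspace \<Rightarrow> ('k, 'a \<Rightarrow> 'k) nspace" where
  "dual X =
     \<lparr>carr = {f \<in> extensional (carr X).
         (\<forall>x\<in>carr X. \<forall>y\<in>carr X. f (add X x y) = f x + f y) \<and>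
         (\<forall>c. \<forall>x\<in>carr X. f (smul X c x) = c * f x) \<and>
         (\<exists>C. \<forall>x\<in>carr X. norm (f x) \<le> C * nrm X x)},
      add = (\<lambda>f g. \<lambda>x\<in>carr X. f x + g x),
      smul = (\<lambda>c f. \<lambda>x\<in>carr X. c * f x),
      nrm = (\<lambda>f. SUP x\<in>{x \<in> carr X. nrm X x \<le> 1}. norm (f x))\<rparr>"

abbreviation bidual ::
  "('k::real_or_complex, 'a) nspace \<Rightarrow> ('k, ('a \<Rightarrow> 'k) \<Rightarrow> 'k) nspace" where
  "bidual X \<equiv> dual (dual X)"

definition canonical_image :: "('k::real_or_complex, 'a) nspace \<Rightarrow> (('a \<Rightarrow> 'k) \<Rightarrow> 'k) set" where
  "canonical_image X = (\<lambda>x. \<lambda>f\<in>carr (dual X). f x) ` carr X"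

definition reflexive :: "('k::real_or_complex, 'a) nspace \<Rightarrow> bool" where
  "reflexive X \<longleftrightarrow> canonical_image X = carr (bidual X)"

text \<open>The conjugate \<open>S\<^sup>*: Y\<^sup>* \<rightarrow> X\<^sup>*\<close> of a bounded operator \<open>S: X \<rightarrow> Y\<close>.\<close>

definition conj_op ::
  "('k::real_or_complex, 'a) nspace \<Rightarrow> ('k, 'b) nspace \<Rightarrow> ('a \<Rightarrow> 'b) \<Rightarrow> ('b \<Rightarrow> 'k) \<Rightarrow> ('a \<Rightarrow> 'k)" where
  "conj_op X Y S = (\<lambda>g\<in>carr (dual Y). \<lambda>x\<in>carr X. g (S x))"

text \<open>These two notions are meant for bounded operators \<open>S\<close> between Banach spaces.\<close>

definition tauberian ::
  "('k::real_or_complex, 'a) nspace \<Rightarrow> ('k, 'b) nspace \<Rightarrow> ('a \<Rightarrow> 'b) \<Rightarrow> bool" where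
  "tauberian X Y S \<longleftrightarrow>
     conj_op (dual Y) (dual X) (conj_op X Y S) ` (carr (bidual X) - canonical_image X)
       \<subseteq> carr (bidual Y) - canonical_image Y"

definition cotauberian ::
  "('k::real_or_complex, 'a) nspace \<Rightarrow> ('k, 'b) nspace \<Rightarrow> ('a \<Rightarrow> 'b) \<Rightarrow> bool" where
  "cotauberian X Y S \<longleftrightarrow> tauberian (dual Y) (dual X) (conj_op X Y S)"

text \<open>The operator \<open>Q\<^sub>B J\<^sub>A: A \<rightarrow> Z/B\<close> is \<open>quot_map B\<close> with domain \<open>A\<close>.\<close>

definition tauberian_pair ::
  "('k::real_or_complex \<Rightarrow> 'z::banach \<Rightarrow> 'z) \<Rightarrow> 'z set \<Rightarrow> 'z set \<Rightarrow> bool" where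
  "tauberian_pair scl A B \<longleftrightarrow> tauberian (sub_space scl A) (quot_space scl B) (quot_map B)"

definition cotauberian_pair ::
  "('k::real_or_complex \<Rightarrow> 'z::banach \<Rightarrow> 'z) \<Rightarrow> 'z set \<Rightarrow> 'z set \<Rightarrow> bool" where
  "cotauberian_pair scl A B \<longleftrightarrow> cotauberian (sub_space scl A) (quot_space scl B) (quot_map B)"

end

theory Submission imports Defs begin

text \<open>
  Write \<open>X\<close> for the domain and \<open>S\<close> for the operator. If \<open>S\<close> is not tauberian, pick \<open>z \<in> X\<^sup>*\<^sup>* - X\<close> with
  \<open>S\<^sup>*\<^sup>* z = y\<close> in the range space. Since \<open>z\<close> has positive distance from \<open>X\<close>, Helly's theorem yields
  bounded \<open>f\<^sub>i\<close> in \<open>X\<^sup>*\<close> and \<open>x\<^sub>j\<close> in \<open>X\<close>, chosen alternately, with \<open>f\<^sub>i x\<^sub>j = 1\<close> for \<open>i \<le> j\<close>, \<open>f\<^sub>i x\<^sub>j = 0\<close>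
  for \<open>i > j\<close>, and \<open>S x\<^sub>j\<close> as close to \<open>y\<close> as desired. By a double limit argument no reflexive space
  contains such a system.

  For pairs \<open>(M, N)\<close> the differences \<open>u\<^sub>n = x\<^sub>n\<^sub>+\<^sub>1 - x\<^sub>n\<close> are biorthogonal to the \<open>f\<^sub>n\<^sub>+\<^sub>1\<close> and lie within
  a summable distance of \<open>N\<close>: take \<open>w\<^sub>n\<close> small with \<open>u\<^sub>n - w\<^sub>n \<in> N\<close>, \<open>K = \<Sum> f\<^sub>n\<^sub>+\<^sub>1 \<otimes> w\<^sub>n\<close> and
  \<open>E = {x \<in> M. x - K x \<in> N}\<close>. For the dual part, \<open>z\<close> may be taken to vanish on \<open>Z/M\<close>, which allows the
  functionals \<open>u\<^sub>n\<close> obtained on \<open>Z/M\<close> to be made biorthogonal to vectors \<open>h\<^sub>n\<close> of \<open>Z\<close> whose norms are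
  bounded before \<open>u\<^sub>n\<close> is chosen. Let \<open>w\<^sub>n\<close> be a small extension of \<open>u\<^sub>n\<close> from \<open>L\<close> to \<open>Z\<close>,
  \<open>K = \<Sum> w\<^sub>n \<otimes> h\<^sub>n\<close>, and \<open>F\<close> the common kernel of the \<open>u\<^sub>n\<close>.

  Conversely, the second conjugate of a compact operator maps into the range space, so a point of
  \<open>E\<^sup>*\<^sup>* - E\<close>, respectively a functional on \<open>(Z/F)\<^sup>*\<^sup>*\<close> that vanishes on \<open>Z/F\<close>, refutes the tauberian
  condition.
\<close>

section \<open>The Hahn-Banach theorem over both scalar fields\<close>

text \<open>The record has no zero vector, so \<open>smul X 0 y\<close> stands for it and
  \<open>add_zero\<close> makes every such element neutral. These axioms are shared by subspaces,
  quotients, iterated duals and products, so each general theorem below is proved once for all of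
  them.\<close>

locale seminormed =
  fixes X :: "('k::real_or_complex, 'a) nspace"
  assumes carr_nonempty: "carr X \<noteq> {}"
    and add_closed [simp]: "\<lbrakk>x \<in> carr X; y \<in> carr X\<rbrakk> \<Longrightarrow> add X x y \<in> carr X"
    and smul_closed [simp]: "x \<in> carr X \<Longrightarrow> smul X c x \<in> carr X"
    and add_assoc: "\<lbrakk>x \<in> carr X; y \<in> carr X; w \<in> carr X\<rbrakk> \<Longrightarrow>
      add X (add X x y) w = add X x (add X y w)"
    and add_commute: "\<lbrakk>x \<in> carr X; y \<in> carr X\<rbrakk> \<Longrightarrow> add X x y = add X y x"
    and add_zero: "\<lbrakk>x \<in> carr X; y \<in> carr X\<rbrakk> \<Longrightarrow> add X x (smul X 0 y) = x"
    and smul_one: "x \<in> carr X \<Longrightarrow> smul X 1 x = x"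
    and smul_smul: "x \<in> carr X \<Longrightarrow> smul X c (smul X d x) = smul X (c * d) x"
    and smul_add_left: "x \<in> carr X \<Longrightarrow> smul X (c + d) x = add X (smul X c x) (smul X d x)"
    and smul_add_right: "\<lbrakk>x \<in> carr X; y \<in> carr X\<rbrakk> \<Longrightarrow>
      smul X c (add X x y) = add X (smul X c x) (smul X c y)"
    and nrm_add: "\<lbrakk>x \<in> carr X; y \<in> carr X\<rbrakk> \<Longrightarrow> nrm X (add X x y) \<le> nrm X x + nrm X y"
    and nrm_smul: "x \<in> carr X \<Longrightarrow> nrm X (smul X c x) = norm c * nrm X x"
begin

lemma add_left_commute:
  "\<lbrakk>x \<in> carr X; y \<in> carr X; w \<in> carr X\<rbrakk> \<Longrightarrow> add X x (add X y w) = add X y (add X x w)"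
  by (metis add_assoc add_commute)

lemmas add_ac = add_assoc add_commute add_left_commute

lemma smul_zero_eq: "\<lbrakk>x \<in> carr X; y \<in> carr X\<rbrakk> \<Longrightarrow> smul X 0 x = smul X 0 y"
  by (metis add_zero add_commute smul_closed)

lemma nrm_nonneg: assumes "x \<in> carr X" shows "nrm X x \<ge> 0"
proof -
  have "0 = nrm X (smul X (1 + - 1) x)"
    using nrm_smul[OF assms, of 0] by simp
  also have "\<dots> \<le> nrm X (smul X 1 x) + nrm X (smul X (- 1) x)"
    using nrm_add assms by (simp only: smul_add_left smul_closed)
  also have "\<dots> = 2 * nrm X x"
    using assms by (simp add: nrm_smul)
  finally show ?thesis by simp
qed

end

text \<open>
  Functionals on subspaces are represented by their graphs. The bound by a seminorm makes such a
  relation single-valued.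
\<close>

definition real_relation ::
  "('k::real_or_complex, 'a) nspace \<Rightarrow> real \<Rightarrow> ('a \<times> real) set \<Rightarrow> bool" where
  "real_relation X C G \<longleftrightarrow>
     (\<forall>(v, c)\<in>G. v \<in> carr X \<and> c \<le> C * nrm X v) \<and>
     (\<forall>(v, c)\<in>G. \<forall>(w, d)\<in>G. (add X v w, c + d) \<in> G) \<and>
     (\<forall>(v, c)\<in>G. \<forall>r. (smul X (of_real r) v, r * c) \<in> G)"

context seminormed
begin

text \<open>The value \<open>t\<close> at \<open>x\<close> has to lie above every
  \<open>c' - C * nrm X (d' - x)\<close> and below every \<open>C * nrm X (d + x) - c\<close>.
  Subadditivity makes each lower bound at most each upper bound, so the supremum of the lower ones
  will do.\<close>

lemma real_relation_one_step:
  assumes G: "real_relation X C G" and ne: "G \<noteq> {}" and x: "x \<in> carr X" and C: "C \<ge> 0"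
  shows "\<exists>t H. G \<subseteq> H \<and> (x, t) \<in> H \<and> real_relation X C H"
proof -
  let ?s = "\<lambda>v. C * nrm X v"
  have Gc: "v \<in> carr X" "c \<le> ?s v" if "(v, c) \<in> G" for v c
    using G that unfolding real_relation_def by blast+
  have Ga: "(add X v w, c + d) \<in> G" if "(v, c) \<in> G" "(w, d) \<in> G" for v c w d
    using G that unfolding real_relation_def by blast
  have Gs: "(smul X (of_real r) v, r * c) \<in> G" if "(v, c) \<in> G" for v c r
    using G that unfolding real_relation_def by blast
  let ?mx = "smul X (- 1) x"
  have cancel: "add X (add X d x) (add X d' ?mx) = add X d d'"
    if "d \<in> carr X" "d' \<in> carr X" for d d'
  proof -
    have "add X x ?mx = smul X 0 x"
      using smul_add_left[OF x, of 1 "- 1"] x by (simp add: smul_one)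
    moreover have "add X (add X d x) (add X d' ?mx) = add X (add X d d') (add X x ?mx)"
      using that x by (simp add: add_ac)
    ultimately show ?thesis using that x by (simp add: add_zero)
  qed
  have key: "c' - ?s (add X d' ?mx) \<le> ?s (add X d x) - c" if "(d, c) \<in> G" "(d', c') \<in> G" for d c d' c'
  proof -
    note m = Gc(1)[OF that(1)] Gc(1)[OF that(2)]
    have "c + c' \<le> ?s (add X d d')" using Gc Ga that by blast
    also have "\<dots> = ?s (add X (add X d x) (add X d' ?mx))" using cancel m by simp
    also have "\<dots> \<le> C * (nrm X (add X d x) + nrm X (add X d' ?mx))"
      using C m x by (intro mult_left_mono nrm_add) auto
    finally show ?thesis by (simp add: algebra_simps)
  qed
  define U where "U = (\<lambda>(d', c'). c' - ?s (add X d' ?mx)) ` G"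
  define t where "t = Sup U"
  obtain d0 c0 where 0: "(d0, c0) \<in> G" using ne by auto
  have Une: "U \<noteq> {}" using ne by (auto simp: U_def)
  have bdd: "bdd_above U"
    using key[OF 0] by (intro bdd_aboveI[of _ "?s (add X d0 x) - c0"]) (auto simp: U_def)
  have t1: "c' - t \<le> ?s (add X d' ?mx)" if "(d', c') \<in> G" for d' c'
  proof -
    have "c' - ?s (add X d' ?mx) \<in> U" using that by (force simp: U_def)
    from cSup_upper[OF this bdd] show ?thesis by (simp add: t_def)
  qed
  have t2: "c + t \<le> ?s (add X d x)" if "(d, c) \<in> G" for d c
  proof -
    have "Sup U \<le> ?s (add X d x) - c"
      by (rule cSup_least[OF Une]) (use key[OF that] in \<open>auto simp: U_def\<close>)
    then show ?thesis by (simp add: t_def)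
  qed
  define H where "H = {(add X d (smul X (of_real r) x), c + r * t) | d c r. (d, c) \<in> G}"
  have Hi: "(add X d (smul X (of_real r) x), c + r * t) \<in> H" if "(d, c) \<in> G" for d c r
    using that by (auto simp: H_def)
  \<comment> \<open>Dividing by the absolute value of \<open>r\<close> reduces to the coefficients 1
    and -1 of \<open>x\<close>, which are the inequalities \<open>t2\<close> and
    \<open>t1\<close>.\<close>
  have bound: "c + r * t \<le> ?s (add X d (smul X (of_real r) x))" if dc: "(d, c) \<in> G" for d c r
  proof -
    note d = Gc(1)[OF dc]
    consider "r = 0" | "r > 0" | "r < 0" by linarith
    then show ?thesis
    proof cases
      case 1 then show ?thesis using Gc dc d x by (simp add: add_zero)
    next
      case 2
      have "c / r + t \<le> ?s (add X (smul X (of_real (1 / r)) d) x)"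
        using t2[OF Gs[OF dc, of "1 / r"]] by simp
      then have "r * (c / r + t) \<le> r * ?s (add X (smul X (of_real (1 / r)) d) x)"
        using 2 by (intro mult_left_mono) auto
      also have "\<dots> = C * nrm X (smul X (of_real r) (add X (smul X (of_real (1 / r)) d) x))"
        using 2 d x by (simp add: nrm_smul)
      also have "smul X (of_real r) (add X (smul X (of_real (1 / r)) d) x)
          = add X d (smul X (of_real r) x)"
        using d x 2 by (simp add: smul_add_right smul_smul smul_one flip: of_real_mult)
      finally show ?thesis using 2 by (simp add: algebra_simps)
    next
      case 3
      have "c / (- r) - t \<le> ?s (add X (smul X (of_real (1 / (- r))) d) ?mx)"
        using t1[OF Gs[OF dc, of "1 / (- r)"]] by simp
      then have "(- r) * (c / (- r) - t) \<le> (- r) * ?s (add X (smul X (of_real (1 / (- r))) d) ?mx)"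
        using 3 by (intro mult_left_mono) auto
      also have "\<dots> = C * nrm X (smul X (of_real (- r)) (add X (smul X (of_real (1 / (- r))) d) ?mx))"
        using 3 d x by (simp add: nrm_smul del: of_real_minus)
      also have "smul X (of_real (- r)) (add X (smul X (of_real (1 / (- r))) d) ?mx)
          = add X d (smul X (of_real r) x)"
        using d x 3 by (simp add: smul_add_right smul_smul smul_one flip: of_real_mult)
      finally show ?thesis using 3 by (simp add: algebra_simps)
    qed
  qed
  have sub: "G \<subseteq> H"
  proof clarify
    fix d c assume "(d, c) \<in> G"
    from Hi[OF this, of 0] Gc(1)[OF this] x show "(d, c) \<in> H" by (simp add: add_zero)
  qed
  have "(x, t) \<in> H"
  proof -
    have "(smul X 0 d0, 0) \<in> G" using Gs[OF 0, of 0] by simp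
    from Hi[OF this, of 1] show ?thesis
      using x Gc(1)[OF 0] by (simp add: smul_one add_commute[of "smul X 0 d0"] add_zero)
  qed
  moreover have "real_relation X C H"
    unfolding real_relation_def
  proof (intro conjI ballI allI; clarify?)
    fix v c assume "(v, c) \<in> H"
    then obtain d e r where "(d, e) \<in> G" "v = add X d (smul X (of_real r) x)" "c = e + r * t"
      unfolding H_def by blast
    then show "v \<in> carr X \<and> c \<le> C * nrm X v" using bound Gc(1) x by simp
  next
    fix v c w e assume "(v, c) \<in> H" "(w, e) \<in> H"
    then obtain d c1 r d' c2 q where *: "(d, c1) \<in> G" "(d', c2) \<in> G"
      "v = add X d (smul X (of_real r) x)" "c = c1 + r * t"
      "w = add X d' (smul X (of_real q) x)" "e = c2 + q * t" unfolding H_def by blast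
    have "add X v w = add X (add X d d') (smul X (of_real (r + q)) x)"
      using *(3,5) Gc(1)[OF *(1)] Gc(1)[OF *(2)] x by (simp add: smul_add_left add_ac)
    moreover have "c + e = (c1 + c2) + (r + q) * t" using * by (simp add: algebra_simps)
    ultimately show "(add X v w, c + e) \<in> H" using Hi[OF Ga[OF *(1,2)]] by metis
  next
    fix v c q assume "(v, c) \<in> H"
    then obtain d c1 r where *: "(d, c1) \<in> G"
      "v = add X d (smul X (of_real r) x)" "c = c1 + r * t" unfolding H_def by blast
    have "smul X (of_real q) v = add X (smul X (of_real q) d) (smul X (of_real (q * r)) x)"
      using *(2) Gc(1)[OF *(1)] x by (simp add: smul_add_right smul_smul)
    moreover have "q * c = q * c1 + (q * r) * t" using * by (simp add: algebra_simps)
    ultimately show "(smul X (of_real q) v, q * c) \<in> H" using Hi[OF Gs[OF *(1)]] by metis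
  qed
  ultimately show ?thesis using sub by blast
qed

text \<open>Zorn's lemma is applied to the graphs that contain \<open>G\<close>, ordered by
  inclusion. The one-step extension shows that a maximal graph has a value at every point.\<close>

lemma real_hahn_banach:
  assumes G: "real_relation X C G" and ne: "G \<noteq> {}" and C: "C \<ge> 0"
  shows "\<exists>u::'a \<Rightarrow> real. (\<forall>x\<in>carr X. u x \<le> C * nrm X x) \<and> (\<forall>x\<in>carr X. \<forall>y\<in>carr X. u (add X x y) = u x + u y)
    \<and> (\<forall>r. \<forall>x\<in>carr X. u (smul X (of_real r) x) = r * u x) \<and> (\<forall>(v, c)\<in>G. u v = c)"
proof -
  let ?A = "{H. G \<subseteq> H \<and> real_relation X C H}"
  have "\<Union>\<C> \<in> ?A" if "\<C> \<noteq> {}" and ch: "subset.chain ?A \<C>" for \<C>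
  proof -
    have r: "real_relation X C H" "G \<subseteq> H" if "H \<in> \<C>" for H
      using ch that unfolding subset.chain_def by auto
    have "real_relation X C (\<Union>\<C>)"
      unfolding real_relation_def
    proof (intro conjI ballI allI; clarify?)
      fix v c H assume "(v, c) \<in> H" "H \<in> \<C>"
      then show "v \<in> carr X \<and> c \<le> C * nrm X v" using r unfolding real_relation_def by blast
    next
      fix v c w d H H' assume a: "(v, c) \<in> H" "H \<in> \<C>" "(w, d) \<in> H'" "H' \<in> \<C>"
      then have "H \<subseteq> H' \<or> H' \<subseteq> H" using ch unfolding subset.chain_def by blast
      then have "\<exists>I\<in>\<C>. (v, c) \<in> I \<and> (w, d) \<in> I" using a by blast
      then show "(add X v w, c + d) \<in> \<Union>\<C>" using r unfolding real_relation_def by blast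
    next
      fix v c q H assume "(v, c) \<in> H" "H \<in> \<C>"
      then show "(smul X (of_real q) v, q * c) \<in> \<Union>\<C>" using r unfolding real_relation_def by blast
    qed
    then show ?thesis using r \<open>\<C> \<noteq> {}\<close> by blast
  qed
  moreover have "?A \<noteq> {}" using G by blast
  ultimately have "\<exists>H\<in>?A. \<forall>I\<in>?A. H \<subseteq> I \<longrightarrow> I = H"
    by (intro subset_Zorn_nonempty)
  then obtain H where H: "H \<in> ?A" and max: "\<forall>I\<in>?A. H \<subseteq> I \<longrightarrow> I = H"
    by (rule bexE)
  have HH: "real_relation X C H" "G \<subseteq> H" using H by auto
  have Hb: "c \<le> C * nrm X v" if "(v, c) \<in> H" for v c
    using HH that unfolding real_relation_def by blast
  have Hc: "v \<in> carr X" if "(v, c) \<in> H" for v c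
    using HH that unfolding real_relation_def by blast
  have Ha: "(add X v w, c + d) \<in> H" if "(v, c) \<in> H" "(w, d) \<in> H" for v c w d
    using HH that unfolding real_relation_def by blast
  have Hs: "(smul X (of_real r) v, r * c) \<in> H" if "(v, c) \<in> H" for v c r
    using HH that unfolding real_relation_def by blast
  have ex: "\<exists>c. (x, c) \<in> H" if "x \<in> carr X" for x
  proof -
    obtain t I where I: "H \<subseteq> I" "(x, t) \<in> I" "real_relation X C I"
      using real_relation_one_step[OF HH(1) _ \<open>x \<in> carr X\<close> C] ne HH(2) by blast
    with bspec[OF max, of I] order_trans[OF HH(2) I(1)] show ?thesis by auto
  qed
  \<comment> \<open>Subtracting two members over the same \<open>x\<close> puts \<open>c - d\<close>
    over a vector of seminorm zero, where the bound gives \<open>c - d \<le> 0\<close>. Exchanging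
    \<open>c\<close> and \<open>d\<close> gives uniqueness of the value.\<close>
  have le: "c \<le> d" if "(x, c) \<in> H" "(x, d) \<in> H" for x c d
  proof -
    have x: "x \<in> carr X" using Hc that by blast
    have "(add X x (smul X (- 1) x), c - d) \<in> H"
      using Ha[OF that(1) Hs[OF that(2), of "- 1"]] by simp
    moreover have "add X x (smul X (- 1) x) = smul X 0 x"
      using smul_add_left[OF x, of 1 "- 1"] x by (simp add: smul_one)
    ultimately have "c - d \<le> C * nrm X (smul X 0 x)" using Hb by metis
    then show ?thesis using x by (simp add: nrm_smul)
  qed
  define u where "u x = (THE c. (x, c) \<in> H)" for x
  have u: "u x = c" if "(x, c) \<in> H" for x c
    unfolding u_def using le that by (intro the_equality) (auto intro: antisym)
  have u': "(x, u x) \<in> H" if "x \<in> carr X" for x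
    using ex[OF that] u by force
  show ?thesis
  proof (intro exI[of _ u] conjI ballI allI)
    fix x assume x: "x \<in> carr X"
    show "u x \<le> C * nrm X x" using Hb u'[OF x] by blast
    show "u (add X x y) = u x + u y" if "y \<in> carr X" for y
      using u[OF Ha[OF u'[OF x] u'[OF that]]] .
    show "u (smul X (of_real r) x) = r * u x" for r
      using u[OF Hs[OF u'[OF x]]] .
  qed (use u HH(2) in blast)
qed

end

section \<open>Real parts of scalars and functionals over \<open>'k\<close>\<close>

text \<open>The class axiom gives the norm formula only for some coordinates of each scalar.
  Uniqueness of coordinates, obtained by squaring \<open>of_real a = - (of_real b * i)\<close>,
  transfers it to all \<open>a\<close> and \<open>b\<close>.\<close>

lemma real_or_complex_cases:
  obtains (real) "\<And>z::'k::real_or_complex. \<exists>a. z = of_real a"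
  | (complex) i where "i * i = (- 1 :: 'k)" and "\<And>z. \<exists>a b. z = of_real a + of_real b * i"
      and "\<And>a b. norm (of_real a + of_real b * i) = sqrt (a\<^sup>2 + b\<^sup>2)"
proof -
  consider "\<forall>z::'k. \<exists>a. z = a *\<^sub>R 1"
    | "\<exists>i::'k. i * i = - 1 \<and>
       (\<forall>z. \<exists>a b. z = a *\<^sub>R 1 + b *\<^sub>R i \<and> norm z = sqrt (a\<^sup>2 + b\<^sup>2))"
    using real_or_complex by blast
  then show thesis
  proof cases
    case 1
    then show thesis using real by (simp add: of_real_def)
  next
    case 2
    then obtain i :: 'k where i: "i * i = - 1"
      and rep: "\<And>z. \<exists>a b. z = a *\<^sub>R 1 + b *\<^sub>R i \<and> norm z = sqrt (a\<^sup>2 + b\<^sup>2)" by blast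
    have uniq: "a = 0 \<and> b = 0" if "of_real a + of_real b * i = 0" for a b
    proof -
      have "(of_real a :: 'k) = - (of_real b * i)" using that by (simp add: eq_neg_iff_add_eq_0)
      then have "(of_real a :: 'k) * of_real a = - (of_real b * i) * - (of_real b * i)" by simp
      also have "\<dots> = of_real b * of_real b * (i * i)" by (simp add: mult_ac)
      finally have "(of_real (a * a) :: 'k) = of_real (- (b * b))" by (simp add: i)
      then have "a * a = - (b * b)" by (simp only: of_real_eq_iff)
      then have "a\<^sup>2 + b\<^sup>2 = 0" by (simp add: power2_eq_square)
      then show ?thesis by (simp add: sum_power2_eq_zero_iff)
    qed
    have "norm (of_real a + of_real b * i) = sqrt (a\<^sup>2 + b\<^sup>2)" for a b
    proof -
      obtain a' b' where *: "of_real a + of_real b * i = of_real a' + of_real b' * i"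
        and n: "norm (of_real a + of_real b * i) = sqrt (a'\<^sup>2 + b'\<^sup>2)"
        using rep[of "of_real a + of_real b * i"] by (auto simp: of_real_def)
      have "of_real (a - a') + of_real (b - b') * i = 0"
        using * by (simp add: algebra_simps)
      then show ?thesis using uniq n by fastforce
    qed
    then show thesis using complex[OF i] rep by (metis of_real_def scaleR_conv_of_real)
  qed
qed

text \<open>A choice lets one name serve both scalar fields. The norm bound is what excludes other
  real-linear maps that fix the reals, see \<open>re_i\<close> in the proof of
  \<open>complexify\<close>.\<close>

definition re_part :: "'k::real_or_complex \<Rightarrow> real" where
  "re_part = (SOME \<rho>. (\<forall>r. \<rho> (of_real r) = r) \<and> (\<forall>z w. \<rho> (z + w) = \<rho> z + \<rho> w) \<and>
     (\<forall>r z. \<rho> (of_real r * z) = r * \<rho> z) \<and> (\<forall>z. \<rho> z \<le> norm z))"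

lemma re_part:
  "re_part (of_real r :: 'k::real_or_complex) = r"
  "re_part (z + w) = re_part z + re_part (w::'k)"
  "re_part (of_real r * z) = r * re_part z"
  "re_part z \<le> norm z"
proof -
  have "\<exists>\<rho>::'k\<Rightarrow>real. (\<forall>r. \<rho> (of_real r) = r) \<and> (\<forall>z w. \<rho> (z + w) = \<rho> z + \<rho> w) \<and>
     (\<forall>r z. \<rho> (of_real r * z) = r * \<rho> z) \<and> (\<forall>z. \<rho> z \<le> norm z)"
  proof (cases rule: real_or_complex_cases[where 'k='k])
    case real
    then obtain \<rho> :: "'k \<Rightarrow> real" where \<rho>: "\<And>z. z = of_real (\<rho> z)" by metis
    have e: "\<rho> (of_real r) = r" for r using \<rho>[of "of_real r"] by simp
    show ?thesis
    proof (intro exI[of _ \<rho>] conjI allI e)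
      show "\<rho> (z + w) = \<rho> z + \<rho> w" for z w
        by (metis \<rho> e of_real_add)
      show "\<rho> (of_real r * z) = r * \<rho> z" for r z
        by (metis \<rho> e of_real_mult)
      show "\<rho> z \<le> norm z" for z by (metis \<rho> norm_of_real abs_ge_self)
    qed
  next
    case (complex i)
    from complex(2) obtain \<rho> \<sigma> :: "'k \<Rightarrow> real" where
      \<rho>: "\<And>z. z = of_real (\<rho> z) + of_real (\<sigma> z) * i" by metis
    have e: "\<rho> (of_real a + of_real b * i) = a" for a b
    proof -
      let ?z = "of_real a + of_real b * i"
      have "of_real (\<rho> ?z - a) + of_real (\<sigma> ?z - b) * i = 0"
        using \<rho>[of ?z] by (simp add: algebra_simps)
      then have "sqrt ((\<rho> ?z - a)\<^sup>2 + (\<sigma> ?z - b)\<^sup>2) = 0" using complex(3) by (metis norm_zero)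
      then show ?thesis by (simp add: sum_power2_eq_zero_iff)
    qed
    show ?thesis
    proof (intro exI[of _ \<rho>] conjI allI)
      show "\<rho> (of_real r) = r" for r using e[of r 0] by simp
      show "\<rho> (z + w) = \<rho> z + \<rho> w" for z w
      proof -
        have "z + w = of_real (\<rho> z + \<rho> w) + of_real (\<sigma> z + \<sigma> w) * i"
          using \<rho>[of z] \<rho>[of w] by (simp add: algebra_simps)
        then show ?thesis using e by metis
      qed
      show "\<rho> (of_real r * z) = r * \<rho> z" for r z
      proof -
        have "of_real r * z = of_real (r * \<rho> z) + of_real (r * \<sigma> z) * i"
          by (subst \<rho>[of z]) (simp add: algebra_simps)
        then show ?thesis using e by metis
      qed
      show "\<rho> z \<le> norm z" for z
      proof -
        have "norm z = sqrt ((\<rho> z)\<^sup>2 + (\<sigma> z)\<^sup>2)" using complex(3) \<rho> by metis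
        then show ?thesis by (metis real_sqrt_sum_squares_ge1)
      qed
    qed
  qed
  from someI_ex[OF this] have "(\<forall>r. re_part (of_real r :: 'k) = r) \<and>
     (\<forall>z w::'k. re_part (z + w) = re_part z + re_part w) \<and>
     (\<forall>r (z::'k). re_part (of_real r * z) = r * re_part z) \<and> (\<forall>z::'k. re_part z \<le> norm z)"
    unfolding re_part_def .
  then show "re_part (of_real r :: 'k) = r" "re_part (z + w) = re_part z + re_part (w::'k)"
    "re_part (of_real r * z) = r * re_part z" "re_part z \<le> norm z"
    by auto
qed

lemma re_part_minus: "re_part (- z) = - re_part z"
  using re_part(3)[of "- 1" z] by simp

text \<open>If \<open>z \<noteq> w\<close>, the factor \<open>c = inverse (z - w)\<close> would
  produce two real parts that differ by 1.\<close>

lemma re_part_eqI: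
  assumes "\<And>c::'k. re_part (c * z) = re_part (c * w)"
  shows "z = (w :: 'k::real_or_complex)"
proof (rule ccontr)
  assume "z \<noteq> w"
  have "re_part (c * (z - w)) = 0" for c
    using assms[of c] re_part(2)[of "c * z" "- (c * w)"] by (simp add: algebra_simps re_part_minus)
  from this[of "inverse (z - w)"] \<open>z \<noteq> w\<close> show False
    using re_part(1)[of 1, where 'k='k] by simp
qed

text \<open>A \<open>k\<close>-linear functional is recovered from its real part \<open>u\<close> as \<open>u x - i u (i x)\<close>.\<close>

lemma (in seminormed) complexify:
  assumes add: "\<And>x y. x \<in> carr X \<Longrightarrow> y \<in> carr X \<Longrightarrow> u (add X x y) = u x + u y"
    and smul: "\<And>r x. x \<in> carr X \<Longrightarrow> u (smul X (of_real r) x) = r * u x"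
  obtains f :: "'a \<Rightarrow> 'k" where
    "\<And>x y. x \<in> carr X \<Longrightarrow> y \<in> carr X \<Longrightarrow> f (add X x y) = f x + f y"
    "\<And>c x. x \<in> carr X \<Longrightarrow> f (smul X c x) = c * f x"
    "\<And>x. x \<in> carr X \<Longrightarrow> re_part (f x) = u x"
proof (cases rule: real_or_complex_cases[where 'k='k])
  case real
  show thesis
  proof (rule that[of "\<lambda>x. of_real (u x)"])
    show "of_real (u (smul X c x)) = c * (of_real (u x) :: 'k)" if "x \<in> carr X" for c x
      using real[of c] smul[OF that] by auto
  qed (auto simp: add re_part)
next
  case (complex i)
  \<comment> \<open>The norm bound at \<open>1 + s i\<close> reads
    \<open>1 + s\<^sup>2 \<le> sqrt (1 + s\<^sup>2)\<close>, which forces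
    \<open>s = 0\<close>.\<close>
  have re_i: "re_part i = 0"
  proof -
    define s where "s = re_part i"
    have "1 + s * s = re_part (of_real 1 + of_real s * i)"
      by (simp only: re_part s_def)
    also have "\<dots> \<le> sqrt (1\<^sup>2 + s\<^sup>2)"
      using re_part(4) complex(3) by metis
    finally have "1 + s\<^sup>2 \<le> sqrt (1 + s\<^sup>2)" by (simp add: power2_eq_square)
    moreover have "1 + s\<^sup>2 = sqrt (1 + s\<^sup>2) * sqrt (1 + s\<^sup>2)" by simp
    moreover have "sqrt (1 + s\<^sup>2) > 0" by (simp add: add_pos_nonneg)
    ultimately have "sqrt (1 + s\<^sup>2) \<le> 1"
      using mult_left_le_imp_le[of "sqrt (1 + s\<^sup>2)" "sqrt (1 + s\<^sup>2)" 1] by simp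
    then have "s = 0" by simp
    then show ?thesis by (simp add: s_def)
  qed
  define f where "f x = of_real (u x) - i * of_real (u (smul X i x))" for x
  show thesis
  proof (rule that[of f])
    show "f (add X x y) = f x + f y" if "x \<in> carr X" "y \<in> carr X" for x y
      using that by (simp add: f_def add smul_add_right algebra_simps)
    show "re_part (f x) = u x" if "x \<in> carr X" for x
    proof -
      have "f x = of_real (u x) + of_real (- u (smul X i x)) * i" by (simp add: f_def)
      then show ?thesis by (simp only: re_part re_i)
    qed
    show "f (smul X c x) = c * f x" if x: "x \<in> carr X" for c x
    proof -
      obtain a b where c: "c = of_real a + of_real b * i" using complex(2) by blast
      have 1: "u (smul X c x) = a * u x + b * u (smul X i x)"
        using x smul[of "smul X i x" b] by (simp add: c smul_add_left add smul smul_smul)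
      have "i * c = of_real (- b) + of_real a * i"
        using complex(1) by (simp add: c distrib_left mult.left_commute[of i] add.commute)
      then have "smul X i (smul X c x) = add X (smul X (of_real (- b)) x) (smul X (of_real a * i) x)"
        using x by (simp add: smul_smul smul_add_left del: of_real_minus)
      then have 2: "u (smul X i (smul X c x)) = - b * u x + a * u (smul X i x)"
        using x smul[of "smul X i x" a] smul[of x "- b"]
        by (simp add: add smul_smul del: of_real_minus)
      have ii: "i * (i * w) = - w" for w using complex(1) by (metis mult.assoc mult_minus1)
      show ?thesis unfolding f_def 1 2 by (simp add: c ii algebra_simps)
    qed
  qed
qed

text \<open>The real parts of the graph are extended by the real theorem and then complexified.
  Prescribing values by a graph avoids well-definedness proofs in the applications:
  \<open>bound\<close> already makes \<open>G\<close> single-valued.\<close>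

lemma (in seminormed) hahn_banach:
  assumes G: "G \<subseteq> carr X \<times> UNIV" "G \<noteq> {}" and C: "C \<ge> 0"
    and Gadd: "\<And>v c w d. (v, c) \<in> G \<Longrightarrow> (w, d) \<in> G \<Longrightarrow> (add X v w, c + d) \<in> G"
    and Gsmul: "\<And>v c k. (v, c) \<in> G \<Longrightarrow> (smul X k v, k * c) \<in> G"
    and bound: "\<And>v c. (v, c) \<in> G \<Longrightarrow> norm c \<le> C * nrm X v"
  obtains f where "f \<in> carr (dual X)" and "\<And>v c. (v, c) \<in> G \<Longrightarrow> f v = c"
    and "\<And>x. x \<in> carr X \<Longrightarrow> norm (f x) \<le> C * nrm X x"
proof -
  let ?G = "(\<lambda>(v, c). (v, re_part c)) ` G"
  have "real_relation X C ?G"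
    unfolding real_relation_def
  proof (intro conjI ballI allI; clarify)
    fix v c assume vc: "(v, c) \<in> G"
    have "re_part c \<le> C * nrm X v" using re_part(4)[of c] bound[OF vc] by linarith
    then show "v \<in> carr X \<and> re_part c \<le> C * nrm X v" using vc G(1) by blast
    show "(smul X (of_real r) v, r * re_part c) \<in> ?G" for r
      using imageI[OF Gsmul[OF vc, of "of_real r"], of "\<lambda>(v, c). (v, re_part c)"]
      by (simp add: re_part)
    fix w d assume wd: "(w, d) \<in> G"
    show "(add X v w, re_part c + re_part d) \<in> ?G"
      using imageI[OF Gadd[OF vc wd], of "\<lambda>(v, c). (v, re_part c)"] by (simp add: re_part)
  qed
  then obtain u :: "'a \<Rightarrow> real" where
    u: "\<forall>x\<in>carr X. u x \<le> C * nrm X x" "\<forall>x\<in>carr X. \<forall>y\<in>carr X. u (add X x y) = u x + u y"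
    "\<forall>r. \<forall>x\<in>carr X. u (smul X (of_real r) x) = r * u x" "\<forall>(v, c)\<in>?G. u v = c"
    using real_hahn_banach[of C ?G] G C by blast
  obtain f where f: "\<And>x y. x \<in> carr X \<Longrightarrow> y \<in> carr X \<Longrightarrow> f (add X x y) = f x + f y"
    "\<And>c x. x \<in> carr X \<Longrightarrow> f (smul X c x) = c * f x"
    "\<And>x. x \<in> carr X \<Longrightarrow> re_part (f x) = u x"
    using complexify[of u] u(2,3) by blast
  have fb: "norm (f x) \<le> C * nrm X x" if x: "x \<in> carr X" for x
  proof (cases "f x = 0")
    case True then show ?thesis using C nrm_nonneg[OF x] by simp
  next
    case False
    \<comment> \<open>The unimodular factor that turns \<open>f x\<close> into its absolute value,
      where the bound on the real part \<open>u\<close> applies.\<close>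
    define c where "c = of_real (norm (f x)) / f x"
    have nc: "norm c = 1" using False by (simp add: c_def norm_divide)
    have "f (smul X c x) = of_real (norm (f x))" using f(2)[OF x] False by (simp add: c_def)
    then have "norm (f x) = u (smul X c x)" using f(3)[of "smul X c x"] x by (simp add: re_part)
    also have "\<dots> \<le> C * nrm X (smul X c x)" using u(1) x by simp
    finally show ?thesis using x nc by (simp add: nrm_smul)
  qed
  show thesis
  proof (rule that[of "restrict f (carr X)"])
    show "restrict f (carr X) \<in> carr (dual X)"
      using f(1,2) fb by (auto simp: dual_def intro!: exI[of _ C])
    show "restrict f (carr X) v = c" if vc: "(v, c) \<in> G" for v c
    proof -
      have v: "v \<in> carr X" using G vc by blast
      \<comment> \<open>\<open>G\<close> is closed under all scalars, so agreement of real parts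
        holds for every multiple and gives \<open>f v = c\<close> by
        \<open>re_part_eqI\<close>.\<close>
      have "re_part (k * f v) = re_part (k * c)" for k
      proof -
        have "(smul X k v, re_part (k * c)) \<in> ?G"
          using imageI[OF Gsmul[OF vc], of "\<lambda>(v, c). (v, re_part c)"] by simp
        from bspec[OF u(4) this] have "u (smul X k v) = re_part (k * c)" by simp
        then show ?thesis using f(2,3) v by (metis smul_closed)
      qed
      then show ?thesis using re_part_eqI v by (metis restrict_apply')
    qed
  qed (use fb in auto)
qed

section \<open>Duals and conjugate operators\<close>

context seminormed
begin

definition minus :: "'a \<Rightarrow> 'a \<Rightarrow> 'a" where
  "minus x y = add X x (smul X (- 1) y)"

lemma minus_closed [simp]: "\<lbrakk>x \<in> carr X; y \<in> carr X\<rbrakk> \<Longrightarrow> minus x y \<in> carr X"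
  by (simp add: minus_def)

lemma smul_minus: "\<lbrakk>x \<in> carr X; y \<in> carr X\<rbrakk> \<Longrightarrow> smul X c (minus x y) = minus (smul X c x) (smul X c y)"
  by (simp add: minus_def smul_add_right smul_smul)

lemma nrm_zero: "x \<in> carr X \<Longrightarrow> nrm X (smul X 0 x) = 0"
  by (simp add: nrm_smul)

lemma dual_add: "\<lbrakk>f \<in> carr (dual X); x \<in> carr X; y \<in> carr X\<rbrakk> \<Longrightarrow> f (add X x y) = f x + f y"
  by (simp add: dual_def)

lemma dual_smul: "\<lbrakk>f \<in> carr (dual X); x \<in> carr X\<rbrakk> \<Longrightarrow> f (smul X c x) = c * f x"
  by (simp add: dual_def)

lemma dual_minus: "\<lbrakk>f \<in> carr (dual X); x \<in> carr X; y \<in> carr X\<rbrakk> \<Longrightarrow> f (minus x y) = f x - f y"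
  by (simp add: minus_def dual_add dual_smul)

lemma dual_ext:
  "\<lbrakk>f \<in> carr (dual X); g \<in> carr (dual X); \<And>x. x \<in> carr X \<Longrightarrow> f x = g x\<rbrakk> \<Longrightarrow> f = g"
  unfolding dual_def by (auto intro: extensionalityI)

text \<open>Points of positive seminorm are scaled into the unit ball. At points of seminorm zero no
  scaling is possible, and the constant from the definition of the dual shows that
  \<open>f x\<close> is zero.\<close>

lemma dual_bound: assumes f: "f \<in> carr (dual X)" and x: "x \<in> carr X"
  shows "norm (f x) \<le> nrm (dual X) f * nrm X x"
proof -
  have "\<exists>C. \<forall>x\<in>carr X. norm (f x) \<le> C * nrm X x" using f by (simp add: dual_def)
  then obtain C where C: "\<And>x. x \<in> carr X \<Longrightarrow> norm (f x) \<le> C * nrm X x" by blast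
  have bdd: "bdd_above ((\<lambda>x. norm (f x)) ` {x \<in> carr X. nrm X x \<le> 1})"
  proof (rule bdd_aboveI2)
    fix x assume "x \<in> {x \<in> carr X. nrm X x \<le> 1}"
    then have x: "x \<in> carr X" "nrm X x \<le> 1" by auto
    have "norm (f x) \<le> \<bar>C\<bar> * nrm X x"
      using C[OF x(1)] nrm_nonneg[OF x(1)] by (meson abs_ge_self mult_right_mono order_trans)
    also have "\<dots> \<le> \<bar>C\<bar> * 1" using x by (intro mult_left_mono) auto
    finally show "norm (f x) \<le> \<bar>C\<bar>" by simp
  qed
  show ?thesis
  proof (cases "nrm X x = 0")
    case True then show ?thesis using C[OF x] by simp
  next
    case False
    then have pos: "nrm X x > 0" using nrm_nonneg[OF x] by simp
    let ?y = "smul X (of_real (1 / nrm X x)) x"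
    have "nrm X ?y = 1" using x pos by (simp add: nrm_smul norm_divide)
    then have "norm (f ?y) \<le> nrm (dual X) f"
      using cSUP_upper[OF _ bdd, of ?y] x by (simp add: dual_def)
    moreover have "norm (f ?y) = norm (f x) / nrm X x"
      using f x pos by (simp add: dual_smul norm_mult norm_divide)
    ultimately have "norm (f x) / nrm X x \<le> nrm (dual X) f" by simp
    then show ?thesis using pos by (simp only: pos_divide_le_eq)
  qed
qed

lemma dual_nrm_ge: "\<lbrakk>f \<in> carr (dual X); x \<in> carr X; nrm (dual X) f \<le> C\<rbrakk> \<Longrightarrow> norm (f x) \<le> C * nrm X x"
  using dual_bound mult_right_mono nrm_nonneg order_trans by metis

lemma dual_nrm_le:
  assumes "C \<ge> 0" "\<And>x. x \<in> carr X \<Longrightarrow> norm (f x) \<le> C * nrm X x"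
  shows "nrm (dual X) f \<le> C"
proof -
  obtain x where x: "x \<in> carr X" using carr_nonempty by blast
  have "{x \<in> carr X. nrm X x \<le> 1} \<noteq> {}"
    using nrm_zero[OF x] smul_closed[OF x, of 0]
    by (metis (mono_tags, lifting) empty_iff mem_Collect_eq zero_le_one)
  then have "(SUP x\<in>{x \<in> carr X. nrm X x \<le> 1}. norm (f x)) \<le> C"
  proof (rule cSUP_least)
    fix x assume x: "x \<in> {x \<in> carr X. nrm X x \<le> 1}"
    then have "norm (f x) \<le> C * nrm X x" using assms by blast
    also have "\<dots> \<le> C * 1" using x assms(1) by (intro mult_left_mono) auto
    finally show "norm (f x) \<le> C" by simp
  qed
  then show ?thesis by (simp add: dual_def)
qed

lemma dual_nrm_nonneg: assumes "f \<in> carr (dual X)" shows "nrm (dual X) f \<ge> 0"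
proof -
  obtain x where x: "x \<in> carr X" using carr_nonempty by blast
  show ?thesis
  proof (rule ccontr)
    assume neg: "\<not> ?thesis"
    have "norm (f y) \<le> 0" if "y \<in> carr X" for y
    proof -
      have "nrm (dual X) f * nrm X y \<le> 0" using neg nrm_nonneg[OF that] by (simp add: mult_nonpos_nonneg)
      then show ?thesis using dual_bound[OF assms that] by linarith
    qed
    then have z: "f y = 0" if "y \<in> carr X" for y using that by simp
    have "{x \<in> carr X. nrm X x \<le> 1} \<noteq> {}"
    using nrm_zero[OF x] smul_closed[OF x, of 0]
    by (metis (mono_tags, lifting) empty_iff mem_Collect_eq zero_le_one)
    then have "(SUP x\<in>{x \<in> carr X. nrm X x \<le> 1}. norm (f x)) = (SUP x\<in>{x \<in> carr X. nrm X x \<le> 1}. 0)"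
      using z by (intro SUP_cong) auto
    then have "nrm (dual X) f = 0" using \<open>{x \<in> carr X. nrm X x \<le> 1} \<noteq> {}\<close> by (simp add: dual_def)
    then show False using neg by simp
  qed
qed

lemma dualI:
  assumes "\<And>x y. x \<in> carr X \<Longrightarrow> y \<in> carr X \<Longrightarrow> f (add X x y) = f x + f y"
    and "\<And>c x. x \<in> carr X \<Longrightarrow> f (smul X c x) = c * f x"
    and "\<And>x. x \<in> carr X \<Longrightarrow> norm (f x) \<le> C * nrm X x"
  shows "restrict f (carr X) \<in> carr (dual X)"
  using assms by (auto simp: dual_def intro!: exI[of _ C])

lemma dual_add_apply: "x \<in> carr X \<Longrightarrow> add (dual X) f g x = f x + g x"
  and dual_smul_apply: "x \<in> carr X \<Longrightarrow> smul (dual X) c f x = c * f x"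
  by (simp_all add: dual_def)

text \<open>This lets the locale be interpreted for iterated duals, up to the third dual in the
  cotauberian part.\<close>

lemma seminormed_dual: "seminormed (dual X)"
proof
  note ap = dual_add_apply dual_smul_apply
  show ac: "add (dual X) f g \<in> carr (dual X)" if "f \<in> carr (dual X)" "g \<in> carr (dual X)" for f g
  proof -
    have "restrict (\<lambda>x. f x + g x) (carr X) \<in> carr (dual X)"
    proof (rule dualI[where C = "nrm (dual X) f + nrm (dual X) g"])
      show "norm (f x + g x) \<le> (nrm (dual X) f + nrm (dual X) g) * nrm X x" if "x \<in> carr X" for x
        using norm_triangle_ineq[of "f x" "g x"] dual_bound[OF \<open>f \<in> carr (dual X)\<close> that]
          dual_bound[OF \<open>g \<in> carr (dual X)\<close> that] by (simp add: algebra_simps)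
    qed (use that in \<open>auto simp: dual_add dual_smul algebra_simps\<close>)
    then show ?thesis by (simp add: dual_def)
  qed
  show sc: "smul (dual X) c f \<in> carr (dual X)" if f: "f \<in> carr (dual X)" for c f
  proof -
    have "restrict (\<lambda>x. c * f x) (carr X) \<in> carr (dual X)"
    proof (rule dualI[where C = "norm c * nrm (dual X) f"])
      show "norm (c * f x) \<le> (norm c * nrm (dual X) f) * nrm X x" if "x \<in> carr X" for x
        using dual_bound[OF f that] by (simp add: norm_mult mult.assoc mult_left_mono)
    qed (use f in \<open>auto simp: dual_add dual_smul algebra_simps\<close>)
    then show ?thesis by (simp add: dual_def)
  qed
  have "restrict (\<lambda>x. 0) (carr X) \<in> carr (dual X)"
    by (rule dualI[where C = 0]) auto
  then show "carr (dual X) \<noteq> {}" by blast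
  fix f g h :: "'a \<Rightarrow> 'k" and c d
  assume f: "f \<in> carr (dual X)"
  show "smul (dual X) 1 f = f"
    by (rule dual_ext) (simp_all add: ap f sc)
  show "smul (dual X) c (smul (dual X) d f) = smul (dual X) (c * d) f"
    by (rule dual_ext) (simp_all add: ap f sc mult.assoc)
  show "smul (dual X) (c + d) f = add (dual X) (smul (dual X) c f) (smul (dual X) d f)"
    by (rule dual_ext) (simp_all add: ap f sc ac algebra_simps)
  have le: "nrm (dual X) (smul (dual X) c f) \<le> norm c * nrm (dual X) f"
    if f: "f \<in> carr (dual X)" for c f
    using dual_nrm_nonneg[OF f] dual_bound[OF f]
    by (intro dual_nrm_le) (auto simp: ap norm_mult mult.assoc intro!: mult_left_mono)
  show "nrm (dual X) (smul (dual X) c f) = norm c * nrm (dual X) f"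
  proof (cases "c = 0")
    case True
    then show ?thesis using le[OF f, of c] dual_nrm_nonneg[OF sc[OF f, of c]] by simp
  next
    case False
    \<comment> \<open>The lower estimate for the norm of \<open>c f\<close> is the upper estimate
      \<open>le\<close> applied to \<open>inverse c\<close>.\<close>
    have "smul (dual X) (inverse c) (smul (dual X) c f) = f"
      by (rule dual_ext) (simp_all add: ap f sc False)
    then have "nrm (dual X) f \<le> norm (inverse c) * nrm (dual X) (smul (dual X) c f)"
      using le[OF sc[OF f], of "inverse c" c] by simp
    then have "norm c * nrm (dual X) f
        \<le> norm c * (norm (inverse c) * nrm (dual X) (smul (dual X) c f))"
      by (intro mult_left_mono) auto
    also have "\<dots> = nrm (dual X) (smul (dual X) c f)"
      using False by (simp add: norm_inverse)
    finally have "norm c * nrm (dual X) f \<le> nrm (dual X) (smul (dual X) c f)" .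
    then show ?thesis using le[OF f] by (intro antisym)
  qed
  assume g: "g \<in> carr (dual X)"
  show "add (dual X) f g = add (dual X) g f"
    by (rule dual_ext) (simp_all add: ap f g ac)
  show "add (dual X) f (smul (dual X) 0 g) = f"
    by (rule dual_ext) (simp_all add: ap f g ac sc)
  show "smul (dual X) c (add (dual X) f g) = add (dual X) (smul (dual X) c f) (smul (dual X) c g)"
    by (rule dual_ext) (simp_all add: ap f g ac sc algebra_simps)
  show "nrm (dual X) (add (dual X) f g) \<le> nrm (dual X) f + nrm (dual X) g"
  proof (rule dual_nrm_le)
    show "norm (add (dual X) f g x) \<le> (nrm (dual X) f + nrm (dual X) g) * nrm X x" if "x \<in> carr X" for x
      using that norm_triangle_ineq[of "f x" "g x"] dual_bound[OF f that]
          dual_bound[OF g that] by (simp add: ap algebra_simps)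
  qed (use dual_nrm_nonneg f g in auto)
  assume h: "h \<in> carr (dual X)"
  show "add (dual X) (add (dual X) f g) h = add (dual X) f (add (dual X) g h)"
    by (rule dual_ext) (simp_all add: ap f g h ac)
qed

lemmas dual_add_closed [simp] = seminormed.add_closed[OF seminormed_dual]
  and dual_smul_closed [simp] = seminormed.smul_closed[OF seminormed_dual]

end

section \<open>The canonical embedding, bounded operators and their conjugates\<close>

definition canon :: "('k::real_or_complex, 'a) nspace \<Rightarrow> 'a \<Rightarrow> ('a \<Rightarrow> 'k) \<Rightarrow> 'k" where
  "canon X x = (\<lambda>f\<in>carr (dual X). f x)"

lemma canonical_image_canon: "canonical_image X = canon X ` carr X"
  by (simp add: canonical_image_def canon_def)

lemma canon_apply [simp]: "f \<in> carr (dual X) \<Longrightarrow> canon X x f = f x"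
  by (simp add: canon_def)

lemma (in seminormed) canon_in_bidual [simp]:
  assumes x: "x \<in> carr X" shows "canon X x \<in> carr (bidual X)"
proof -
  interpret dual: seminormed "dual X" by (rule seminormed_dual)
  show ?thesis
    unfolding canon_def
  proof (rule dual.dualI)
  show "norm (f x) \<le> nrm X x * nrm (dual X) f" if "f \<in> carr (dual X)" for f
    using dual_bound[OF that x] by (simp add: mult.commute)
  qed (use x in \<open>auto simp: dual_add_apply dual_smul_apply\<close>)
qed

text \<open>The bound \<open>C\<close> is an explicit argument so that the conjugate is again an
  \<open>operator\<close> with the same \<open>C\<close>, and conjugation can be repeated.\<close>

definition bounded_op ::
  "('k::real_or_complex, 'a) nspace \<Rightarrow> ('k, 'b) nspace \<Rightarrow> ('a \<Rightarrow> 'b) \<Rightarrow> real \<Rightarrow> bool" where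
  "bounded_op X Y S C \<longleftrightarrow> C \<ge> 0 \<and> (\<forall>x\<in>carr X. S x \<in> carr Y) \<and>
     (\<forall>x\<in>carr X. \<forall>y\<in>carr X. S (add X x y) = add Y (S x) (S y)) \<and>
     (\<forall>c. \<forall>x\<in>carr X. S (smul X c x) = smul Y c (S x)) \<and>
     (\<forall>x\<in>carr X. nrm Y (S x) \<le> C * nrm X x)"

locale operator = X: seminormed X + Y: seminormed Y
  for X :: "('k::real_or_complex, 'a) nspace" and Y :: "('k, 'b) nspace" +
  fixes S :: "'a \<Rightarrow> 'b" and C :: real
  assumes op: "bounded_op X Y S C"
begin

lemma C_nonneg: "C \<ge> 0"
  and S_carr [simp]: "x \<in> carr X \<Longrightarrow> S x \<in> carr Y"
  and S_add: "x \<in> carr X \<Longrightarrow> y \<in> carr X \<Longrightarrow> S (add X x y) = add Y (S x) (S y)"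
  and S_smul: "x \<in> carr X \<Longrightarrow> S (smul X c x) = smul Y c (S x)"
  and S_bound: "x \<in> carr X \<Longrightarrow> nrm Y (S x) \<le> C * nrm X x"
  using op by (auto simp: bounded_op_def)

abbreviation S' where "S' \<equiv> conj_op X Y S"

lemma conj_apply [simp]: "g \<in> carr (dual Y) \<Longrightarrow> x \<in> carr X \<Longrightarrow> S' g x = g (S x)"
  by (simp add: conj_op_def)

lemma conj_bound:
  assumes g: "g \<in> carr (dual Y)" and x: "x \<in> carr X"
  shows "norm (g (S x)) \<le> (nrm (dual Y) g * C) * nrm X x"
proof -
  have "norm (g (S x)) \<le> nrm (dual Y) g * nrm Y (S x)" using Y.dual_bound[OF g] x by simp
  also have "\<dots> \<le> nrm (dual Y) g * (C * nrm X x)"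
    using S_bound[OF x] Y.dual_nrm_nonneg[OF g] by (intro mult_left_mono)
  finally show ?thesis by (simp add: mult_ac)
qed

lemma conj_carr [simp]: assumes g: "g \<in> carr (dual Y)" shows "S' g \<in> carr (dual X)"
proof -
  have "restrict (\<lambda>x. g (S x)) (carr X) \<in> carr (dual X)"
    using g conj_bound[OF g]
    by (intro X.dualI) (auto simp: S_add S_smul Y.dual_add Y.dual_smul)
  then show ?thesis using g by (simp add: conj_op_def)
qed

lemma conj_operator: "operator (dual Y) (dual X) S' C"
  unfolding operator_def operator_axioms_def
proof (intro conjI X.seminormed_dual Y.seminormed_dual)
  show "bounded_op (dual Y) (dual X) S' C"
    unfolding bounded_op_def
  proof (intro conjI ballI allI)
    fix g c assume g: "g \<in> carr (dual Y)"
    show "S' (smul (dual Y) c g) = smul (dual X) c (S' g)"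
      by (rule X.dual_ext) (use g in \<open>simp_all add: X.dual_smul_apply Y.dual_smul_apply\<close>)
    show "nrm (dual X) (S' g) \<le> C * nrm (dual Y) g"
      using g conj_bound[OF g] C_nonneg Y.dual_nrm_nonneg[OF g]
      by (intro X.dual_nrm_le) (auto simp: mult.commute)
    fix h assume h: "h \<in> carr (dual Y)"
    show "S' (add (dual Y) g h) = add (dual X) (S' g) (S' h)"
      by (rule X.dual_ext) (use g h in \<open>simp_all add: X.dual_add_apply Y.dual_add_apply\<close>)
  qed (auto simp: C_nonneg)
qed

text \<open>The equation \<open>z (S' g) = g y\<close> for all \<open>g\<close> says that the second
  conjugate of \<open>S\<close> maps \<open>z\<close> to the canonical image of \<open>y\<close>. In
  this form only the first conjugate has to be handled.\<close>

lemma not_tauberian_iff: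
  "\<not> tauberian X Y S \<longleftrightarrow> (\<exists>z\<in>carr (bidual X) - canonical_image X. \<exists>y\<in>carr Y.
     \<forall>g\<in>carr (dual Y). z (S' g) = g y)"
proof -
  interpret D: operator "dual Y" "dual X" S' C by (rule conj_operator)
  have "conj_op (dual Y) (dual X) S' z \<in> canonical_image Y
      \<longleftrightarrow> (\<exists>y\<in>carr Y. \<forall>g\<in>carr (dual Y). z (S' g) = g y)"
    if z: "z \<in> carr (bidual X)" for z
  proof -
    have "conj_op (dual Y) (dual X) S' z = canon Y y \<longleftrightarrow> (\<forall>g\<in>carr (dual Y). z (S' g) = g y)"
      if y: "y \<in> carr Y" for y
      using D.X.dual_ext[OF D.conj_carr[OF z] Y.canon_in_bidual[OF y]] z
      by (metis D.conj_apply canon_apply)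
    then show ?thesis by (auto simp: canonical_image_canon)
  qed
  then show ?thesis using D.conj_carr unfolding tauberian_def by blast
qed

end

text \<open>Needed for its conjugate, which restricts functionals on the bidual to \<open>X\<close>
  and thereby projects the third dual onto \<open>dual X\<close>.\<close>

lemma (in seminormed) canon_operator: "operator X (bidual X) (canon X) 1"
proof -
  interpret D: seminormed "dual X" by (rule seminormed_dual)
  show ?thesis
    unfolding operator_def operator_axioms_def bounded_op_def
  proof (intro conjI ballI allI seminormed_axioms D.seminormed_dual)
    fix x c assume x: "x \<in> carr X"
    show "canon X (smul X c x) = smul (bidual X) c (canon X x)"
      by (rule D.dual_ext) (use x in \<open>auto simp: D.dual_smul_apply dual_smul\<close>)
    show "nrm (bidual X) (canon X x) \<le> 1 * nrm X x"
      using x dual_bound[OF _ x] nrm_nonneg[OF x]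
      by (intro D.dual_nrm_le) (auto simp: mult.commute)
    show "canon X (add X x y) = add (bidual X) (canon X x) (canon X y)" if "y \<in> carr X" for y
      by (rule D.dual_ext) (use x that in \<open>auto simp: D.dual_add_apply dual_add\<close>)
  qed simp_all
qed

lemma (in seminormed) not_reflexive_iff:
  "\<not> reflexive X \<longleftrightarrow> (\<exists>z. z \<in> carr (bidual X) - canonical_image X)"
  unfolding reflexive_def using canon_in_bidual by (auto simp: canonical_image_canon)

context banach_space_over
begin

lemma subspace_iff: "module.subspace scl A \<longleftrightarrow>
    0 \<in> A \<and> (\<forall>x\<in>A. \<forall>y\<in>A. x + y \<in> A) \<and> (\<forall>c. \<forall>x\<in>A. scl c x \<in> A)"
  unfolding subspace_def by blast

lemma seminormed_sub_space:
  assumes "module.subspace scl A" shows "seminormed (sub_space scl A)"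
  using assms unfolding subspace_iff
  by unfold_locales (auto simp: sub_space_def scale_right_distrib scale_left_distrib norm_scl norm_triangle_ineq)

end

section \<open>Quotients\<close>

locale closed_sub = banach_space_over scl
  for scl :: "'k::real_or_complex \<Rightarrow> 'z::banach \<Rightarrow> 'z" +
  fixes B :: "'z set"
  assumes closed_subspace: "closed_subspace scl B"
begin

abbreviation Q where "Q \<equiv> quot_map B"
abbreviation ZB where "ZB \<equiv> quot_space scl B"

lemma closed: "closed B" and subspace: "module.subspace scl B"
  using closed_subspace by (auto simp: closed_subspace_def)

lemma zero: "0 \<in> B" and sum: "x \<in> B \<Longrightarrow> y \<in> B \<Longrightarrow> x + y \<in> B" and scl: "x \<in> B \<Longrightarrow> scl c x \<in> B"
  and uminus: "x \<in> B \<Longrightarrow> - x \<in> B" and diff: "x \<in> B \<Longrightarrow> y \<in> B \<Longrightarrow> x - y \<in> B"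
  using subspace subspace_neg subspace_diff by (auto simp: subspace_iff)

lemma Q_carr [simp]: "Q x \<in> carr ZB"
  by (simp add: quot_space_def)

lemma carr_quot: "carr ZB = range Q"
  by (simp add: quot_space_def)

lemma Q_mem: "y \<in> Q x \<longleftrightarrow> y - x \<in> B"
  unfolding quot_map_def by (auto intro!: exI[of _ "y - x"])

lemma Q_eq_iff: "Q x = Q y \<longleftrightarrow> x - y \<in> B"
proof
  assume "Q x = Q y" then show "x - y \<in> B" using Q_mem[of x x] Q_mem[of x y] zero by simp
next
  assume a: "x - y \<in> B"
  have "v - x \<in> B \<longleftrightarrow> v - y \<in> B" for v
    using sum[OF a, of "v - x"] diff[OF _ a, of "v - y"] by (auto simp: algebra_simps)
  then show "Q x = Q y" using Q_mem by blast
qed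

lemma Q_add: "add ZB (Q x) (Q y) = Q (x + y)"
proof -
  have "\<exists>c d. v = c + d \<and> c - x \<in> B \<and> d - y \<in> B" if "v - (x + y) \<in> B" for v
    using that zero by (intro exI[of _ x] exI[of _ "v - x"]) (simp add: algebra_simps)
  moreover have "c + d - (x + y) \<in> B" if "c - x \<in> B" "d - y \<in> B" for c d
    using sum[OF that] by (simp add: algebra_simps)
  ultimately show ?thesis by (auto simp: quot_space_def Q_mem)
qed

lemma Q_smul: "smul ZB k (Q x) = Q (scl k x)"
proof -
  have "scl k c + b - scl k x \<in> B" if "c - x \<in> B" "b \<in> B" for c b
    using sum[OF scl[OF that(1), of k] that(2)] by (simp add: scale_right_diff_distrib algebra_simps)
  moreover have "\<exists>c b. v = scl k c + b \<and> c - x \<in> B \<and> b \<in> B" if "v - scl k x \<in> B" for v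
    using that zero by (intro exI[of _ x] exI[of _ "v - scl k x"]) simp
  ultimately show ?thesis by (auto simp: quot_space_def Q_mem)
qed

lemma Q_nrm_le: "v - x \<in> B \<Longrightarrow> nrm ZB (Q x) \<le> norm v"
  unfolding quot_space_def by (auto intro!: cINF_lower bdd_belowI[of _ 0] simp: Q_mem)

lemma Q_nrm: "nrm ZB (Q x) \<le> norm x"
  using Q_nrm_le[of x x] zero by simp

lemma Q_nrm_less: assumes "nrm ZB (Q x) < r" obtains v where "v - x \<in> B" "norm v < r"
proof -
  have "Q x \<noteq> {}" using Q_mem[of x x] zero by auto
  moreover have "(INF c\<in>Q x. norm c) < r" using assms by (simp add: quot_space_def)
  ultimately obtain v where "v \<in> Q x" "norm v < r"
    by (subst (asm) cINF_less_iff) (auto intro!: bdd_belowI[of _ 0])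
  then show thesis using that by (simp add: Q_mem)
qed

lemma Q_nrm_ge: assumes "\<And>v. v - x \<in> B \<Longrightarrow> r \<le> norm v" shows "r \<le> nrm ZB (Q x)"
  using assms Q_nrm_less by (metis not_less)

sublocale quot: seminormed ZB
proof
  fix x y w c d
  assume "x \<in> carr ZB" then obtain x' where x: "x = Q x'" by (auto simp: carr_quot)
  show "smul ZB c x \<in> carr ZB" by (simp add: x Q_smul)
  show "smul ZB 1 x = x" by (simp add: x Q_smul)
  show "smul ZB c (smul ZB d x) = smul ZB (c * d) x" by (simp add: x Q_smul)
  show "smul ZB (c + d) x = add ZB (smul ZB c x) (smul ZB d x)"
    by (simp add: x Q_smul Q_add scale_left_distrib)
  have le: "nrm ZB (smul ZB c (Q x')) \<le> norm c * nrm ZB (Q x')" for c x'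
  proof (cases "c = 0")
    case True
    then show ?thesis using Q_nrm[of 0] by (simp add: Q_smul)
  next
    case False
    have "nrm ZB (smul ZB c (Q x')) / norm c \<le> nrm ZB (Q x')"
    proof (rule Q_nrm_ge)
      fix v assume "v - x' \<in> B"
      then have "nrm ZB (Q (scl c x')) \<le> norm (scl c v)"
        using scl[of "v - x'" c] by (intro Q_nrm_le) (simp add: scale_right_diff_distrib)
      then show "nrm ZB (smul ZB c (Q x')) / norm c \<le> norm v"
        using False by (simp add: Q_smul norm_scl field_simps)
    qed
    then show ?thesis using False by (simp add: field_simps)
  qed
  show "nrm ZB (smul ZB c x) = norm c * nrm ZB x"
  proof (cases "c = 0")
    case True
    have "0 \<le> nrm ZB (Q 0)" by (rule Q_nrm_ge) simp
    then show ?thesis using True le[of c x'] by (simp add: x Q_smul)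
  next
    case False
    have "nrm ZB x \<le> norm (inverse c) * nrm ZB (smul ZB c x)"
      using le[of "inverse c" "scl c x'"] False by (simp add: x Q_smul)
    then have "norm c * nrm ZB x \<le> norm c * (norm (inverse c) * nrm ZB (smul ZB c x))"
      by (intro mult_left_mono) auto
    also have "\<dots> = nrm ZB (smul ZB c x)" using False by (simp add: norm_inverse)
    finally show ?thesis using le[of c x'] by (simp add: x)
  qed
  assume "y \<in> carr ZB" then obtain y' where y: "y = Q y'" by (auto simp: carr_quot)
  show "add ZB x y \<in> carr ZB" "add ZB x y = add ZB y x" "add ZB x (smul ZB 0 y) = x"
    by (simp_all add: x y Q_add Q_smul add.commute)
  show "smul ZB c (add ZB x y) = add ZB (smul ZB c x) (smul ZB c y)"
    by (simp add: x y Q_add Q_smul scale_right_distrib)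
  show "nrm ZB (add ZB x y) \<le> nrm ZB x + nrm ZB y"
  proof (rule field_le_epsilon)
    fix e :: real assume "e > 0"
    obtain v where v: "v - x' \<in> B" "norm v < nrm ZB x + e / 2"
      using Q_nrm_less[of x' "nrm ZB x + e / 2"] \<open>e > 0\<close> by (auto simp: x)
    obtain w where w: "w - y' \<in> B" "norm w < nrm ZB y + e / 2"
      using Q_nrm_less[of y' "nrm ZB y + e / 2"] \<open>e > 0\<close> by (auto simp: y)
    have "nrm ZB (Q (x' + y')) \<le> norm (v + w)"
      using sum[OF v(1) w(1)] by (intro Q_nrm_le) (simp add: algebra_simps)
    then show "nrm ZB (add ZB x y) \<le> nrm ZB x + nrm ZB y + e"
      using v w norm_triangle_ineq[of v w] by (simp add: x y Q_add)
  qed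
  assume "w \<in> carr ZB" then obtain w' where w: "w = Q w'" by (auto simp: carr_quot)
  show "add ZB (add ZB x y) w = add ZB x (add ZB y w)"
    by (simp add: x y w Q_add add.assoc)
qed (auto simp: carr_quot)

sublocale sub: seminormed "sub_space scl B"
  by (rule seminormed_sub_space[OF subspace])

end

section \<open>Weighted sums of two spaces\<close>

context seminormed
begin

text \<open>In \<open>helly\<close> the weights are \<open>1 / D\<close> and
  \<open>1 / \<epsilon>\<close>: a pair has seminorm at least 1 as soon as its first entry has
  seminorm at least \<open>D\<close> or its second at least \<open>\<epsilon>\<close>.\<close>

definition prod_space ::
  "('k, 'b) nspace \<Rightarrow> real \<Rightarrow> real \<Rightarrow> ('k, 'a \<times> 'b) nspace" where
  "prod_space Y a b = \<lparr>carr = carr X \<times> carr Y,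
     add = (\<lambda>p q. (add X (fst p) (fst q), add Y (snd p) (snd q))),
     smul = (\<lambda>c p. (smul X c (fst p), smul Y c (snd p))),
     nrm = (\<lambda>p. a * nrm X (fst p) + b * nrm Y (snd p))\<rparr>"

lemma seminormed_prod_space:
  assumes "seminormed Y" "a \<ge> 0" "b \<ge> 0"
  shows "seminormed (prod_space Y a b)"
proof -
  interpret Y: seminormed Y by fact
  show ?thesis
  proof
    show "carr (prod_space Y a b) \<noteq> {}"
      using carr_nonempty Y.carr_nonempty by (auto simp: prod_space_def)
    show "nrm (prod_space Y a b) (add (prod_space Y a b) p q)
        \<le> nrm (prod_space Y a b) p + nrm (prod_space Y a b) q"
      if "p \<in> carr (prod_space Y a b)" "q \<in> carr (prod_space Y a b)" for p q
    proof -
      have "a * nrm X (add X (fst p) (fst q)) \<le> a * (nrm X (fst p) + nrm X (fst q))"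
        "b * nrm Y (add Y (snd p) (snd q)) \<le> b * (nrm Y (snd p) + nrm Y (snd q))"
        using that assms by (auto simp: prod_space_def intro!: mult_left_mono nrm_add Y.nrm_add)
      then show ?thesis by (simp add: prod_space_def algebra_simps)
    qed
  qed (auto simp: prod_space_def add_assoc Y.add_assoc add_zero Y.add_zero smul_one Y.smul_one
      smul_smul Y.smul_smul smul_add_left Y.smul_add_left smul_add_right Y.smul_add_right
      nrm_smul Y.nrm_smul algebra_simps intro: add_commute Y.add_commute)
qed

end

section \<open>Helly's theorem\<close>

context seminormed
begin

text \<open>A functional that vanishes on the common kernel of finitely many others is a combination
  of them; the subspace \<open>\<Omega>\<close> replaces explicit coefficients. In the induction, if
  \<open>\<phi>\<close> is nonzero at some \<open>e\<close> in the kernel of the others, subtracting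
  a multiple of \<open>\<phi>\<close> from \<open>\<psi>\<close> leaves a functional that vanishes
  on the kernel of \<open>\<Phi>\<close> alone.\<close>

lemma kernel_span:
  assumes "finite \<Phi>" and \<Omega>: "\<Phi> \<subseteq> \<Omega>" "\<Omega> \<noteq> {}" "\<Omega> \<subseteq> carr (dual X)"
    and add: "\<And>f g. f \<in> \<Omega> \<Longrightarrow> g \<in> \<Omega> \<Longrightarrow> add (dual X) f g \<in> \<Omega>"
    and smul: "\<And>c f. f \<in> \<Omega> \<Longrightarrow> smul (dual X) c f \<in> \<Omega>"
    and "\<psi> \<in> carr (dual X)"
    and "\<And>x. x \<in> carr X \<Longrightarrow> (\<And>\<phi>. \<phi> \<in> \<Phi> \<Longrightarrow> \<phi> x = 0) \<Longrightarrow> \<psi> x = 0"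
  shows "\<psi> \<in> \<Omega>"
  using assms(1,2,7,8)
proof (induction \<Phi> arbitrary: \<psi> rule: finite_induct)
  case empty
  obtain \<omega> where \<omega>: "\<omega> \<in> \<Omega>" using \<Omega>(2) by blast
  have "\<psi> = smul (dual X) 0 \<omega>"
    by (rule dual_ext) (use empty \<omega> \<Omega>(3) in \<open>auto simp: dual_smul_apply\<close>)
  then show ?case using smul[OF \<omega>] by simp
next
  case (insert \<phi> \<Phi>)
  have \<phi>: "\<phi> \<in> carr (dual X)" and \<Phi>: "\<Phi> \<subseteq> carr (dual X)" using insert.prems(1) \<Omega>(3) by auto
  show ?case
  proof (cases "\<forall>x\<in>carr X. (\<forall>\<phi>'\<in>\<Phi>. \<phi>' x = 0) \<longrightarrow> \<phi> x = 0")
    case True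
    show ?thesis
    proof (rule insert.IH)
      fix x assume "x \<in> carr X" "\<And>\<phi>'. \<phi>' \<in> \<Phi> \<Longrightarrow> \<phi>' x = 0"
      then show "\<psi> x = 0" using True by (intro insert.prems(3)) auto
    qed (use insert.prems in auto)
  next
    case False
    then obtain e where e: "e \<in> carr X" "\<And>\<phi>'. \<phi>' \<in> \<Phi> \<Longrightarrow> \<phi>' e = 0" "\<phi> e \<noteq> 0" by blast
    define k where "k = \<psi> e / \<phi> e"
    define \<psi>' where "\<psi>' = add (dual X) \<psi> (smul (dual X) (- k) \<phi>)"
    have \<psi>': "\<psi>' \<in> carr (dual X)" using insert.prems(2) \<phi> by (simp add: \<psi>'_def)
    have "\<psi>' \<in> \<Omega>"
    proof (rule insert.IH)
      show "\<psi>' x = 0" if x: "x \<in> carr X" and 0: "\<And>\<phi>'. \<phi>' \<in> \<Phi> \<Longrightarrow> \<phi>' x = 0" for x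
      proof -
        \<comment> \<open>\<open>x\<close> is moved along \<open>e\<close> into the kernel of
          \<open>\<phi>\<close> without changing its values under \<open>\<Phi>\<close>.\<close>
        let ?y = "minus x (smul X (\<phi> x / \<phi> e) e)"
        have "\<psi> ?y = 0"
        proof (rule insert.prems(3))
          fix \<phi>' assume \<phi>': "\<phi>' \<in> insert \<phi> \<Phi>"
          then have "\<phi>' \<in> carr (dual X)" using \<phi> \<Phi> by blast
          then have "\<phi>' ?y = \<phi>' x - \<phi> x / \<phi> e * \<phi>' e" using x e(1) by (simp add: dual_minus dual_smul)
          then show "\<phi>' ?y = 0" using \<phi>' e(2)[of \<phi>'] e(3) 0[of \<phi>'] by auto
        qed (use x e in simp)
        then have "\<psi> x = \<phi> x / \<phi> e * \<psi> e" using x e insert.prems(2) by (simp add: dual_minus dual_smul)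
        then show ?thesis using x by (simp add: \<psi>'_def dual_add_apply dual_smul_apply k_def)
      qed
    qed (use \<psi>' insert.prems in auto)
    moreover have "\<psi> = add (dual X) \<psi>' (smul (dual X) k \<phi>)"
      by (rule dual_ext) (use insert.prems \<phi> \<psi>' in \<open>auto simp: \<psi>'_def dual_add_apply dual_smul_apply\<close>)
    ultimately show ?thesis using add smul insert.prems(1) by simp
  qed
qed

text \<open>This is \<open>kernel_span\<close> for the subspace of those functionals on which
  \<open>z\<close> acts as evaluation at \<open>x\<close>.\<close>

lemma eq_at_subspace:
  assumes "finite \<Phi>" "\<Phi> \<subseteq> carr (dual X)" and x: "x \<in> carr X" and z: "z \<in> carr (bidual X)"
    and eq: "\<And>\<phi>. \<phi> \<in> \<Phi> \<Longrightarrow> \<phi> x = z \<phi>" and \<psi>: "\<psi> \<in> carr (dual X)"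
    and ker: "\<And>x. x \<in> carr X \<Longrightarrow> (\<And>\<phi>. \<phi> \<in> \<Phi> \<Longrightarrow> \<phi> x = 0) \<Longrightarrow> \<psi> x = 0"
  shows "\<psi> x = z \<psi>"
proof -
  interpret D: seminormed "dual X" by (rule seminormed_dual)
  obtain f where f: "f \<in> carr (dual X)" using D.carr_nonempty by blast
  have "smul (dual X) 0 f \<in> {\<omega> \<in> carr (dual X). \<omega> x = z \<omega>}"
    using f x z by (simp add: D.dual_smul dual_smul_apply)
  then have ne: "{\<omega> \<in> carr (dual X). \<omega> x = z \<omega>} \<noteq> {}" by blast
  have "\<psi> \<in> {\<omega> \<in> carr (dual X). \<omega> x = z \<omega>}"
  proof (intro kernel_span[OF assms(1) _ ne _ _ _ \<psi> ker])
    show "\<Phi> \<subseteq> {\<omega> \<in> carr (dual X). \<omega> x = z \<omega>}" using assms(2) eq by blast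
  qed (use x z in \<open>auto simp: D.dual_add D.dual_smul dual_smul_apply dual_add_apply\<close>)
  then show ?thesis by simp
qed

text \<open>Pure linear algebra with no control of \<open>nrm X x\<close>; the norm estimate is the
  content of \<open>helly\<close>. A new equation either follows from the old ones or is met by
  adding a multiple of a vector in their common kernel.\<close>

lemma solve_finite:
  assumes "finite \<Phi>" "\<Phi> \<subseteq> carr (dual X)" and z: "z \<in> carr (bidual X)"
  shows "\<exists>x\<in>carr X. \<forall>\<phi>\<in>\<Phi>. \<phi> x = z \<phi>"
  using assms(1,2)
proof (induction \<Phi> rule: finite_induct)
  case empty
  then show ?case using carr_nonempty by blast
next
  case (insert \<phi> \<Phi>)
  then obtain x where x: "x \<in> carr X" "\<And>\<phi>. \<phi> \<in> \<Phi> \<Longrightarrow> \<phi> x = z \<phi>" by blast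
  have \<phi>: "\<phi> \<in> carr (dual X)" and \<Phi>: "\<Phi> \<subseteq> carr (dual X)" using insert.prems(1) by auto
  show ?case
  proof (cases "\<forall>x\<in>carr X. (\<forall>\<phi>'\<in>\<Phi>. \<phi>' x = 0) \<longrightarrow> \<phi> x = 0")
    case True
    then have "\<phi> x = z \<phi>" using eq_at_subspace[OF insert.hyps(1) \<Phi> x(1) z x(2) \<phi>] by blast
    then show ?thesis using x by blast
  next
    case False
    then obtain e where e: "e \<in> carr X" "\<And>\<phi>'. \<phi>' \<in> \<Phi> \<Longrightarrow> \<phi>' e = 0" "\<phi> e \<noteq> 0" by blast
    let ?y = "add X x (smul X ((z \<phi> - \<phi> x) / \<phi> e) e)"
    have "\<phi>' ?y = z \<phi>'" if "\<phi>' \<in> insert \<phi> \<Phi>" for \<phi>'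
    proof -
      have "\<phi>' \<in> carr (dual X)" using that \<phi> \<Phi> by blast
      then have "\<phi>' ?y = \<phi>' x + (z \<phi> - \<phi> x) / \<phi> e * \<phi>' e" using x e by (simp add: dual_add dual_smul)
      then show ?thesis using that x(2) e by auto
    qed
    then show ?thesis using x(1) e(1) by (meson add_closed smul_closed)
  qed
qed

end

text \<open>If no such \<open>x\<close> exists, the map that reads off \<open>t\<close> from
  \<open>(x, S x - t y0)\<close>, where \<open>\<phi> x = t * z \<phi>\<close> on
  \<open>\<Phi>\<close>, has norm at most 1 for the weighted norm. A Hahn-Banach extension splits as
  \<open>\<phi>0\<close> on \<open>X\<close> plus \<open>g\<close> on \<open>Y\<close>, with
  \<open>nrm (dual X) \<phi>0 \<le> 1 / D\<close>. It turns out that \<open>z \<phi>0 = 1\<close>,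
  contrary to \<open>nrm (bidual X) z < D\<close>.\<close>

lemma (in operator) helly:
  assumes z: "z \<in> carr (bidual X)" and D: "nrm (bidual X) z < D" and y0: "y0 \<in> carr Y"
    and zy: "\<And>g. g \<in> carr (dual Y) \<Longrightarrow> z (S' g) = g y0"
    and \<Phi>: "finite \<Phi>" "\<Phi> \<subseteq> carr (dual X)" and \<epsilon>: "\<epsilon> > 0"
  shows "\<exists>x\<in>carr X. nrm X x < D \<and> (\<forall>\<phi>\<in>\<Phi>. \<phi> x = z \<phi>) \<and> nrm Y (Y.minus (S x) y0) < \<epsilon>"
proof (rule ccontr)
  interpret X': seminormed "dual X" by (rule X.seminormed_dual)
  assume nth: "\<not> ?thesis"
  have neg: "nrm Y (Y.minus (S x) y0) \<ge> \<epsilon>"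
    if "x \<in> carr X" "nrm X x < D" "\<And>\<phi>. \<phi> \<in> \<Phi> \<Longrightarrow> \<phi> x = z \<phi>" for x
    using that nth by (metis not_less)
  have D0: "D > 0" using D X'.dual_nrm_nonneg[OF z] by linarith
  define P where "P = X.prod_space Y (1 / D) (1 / \<epsilon>)"
  interpret P: seminormed P
    unfolding P_def using D0 \<epsilon> by (intro X.seminormed_prod_space) (auto intro: Y.seminormed_axioms)
  have P: "carr P = carr X \<times> carr Y" "add P (x, y) (x', y') = (add X x x', add Y y y')"
    "smul P c (x, y) = (smul X c x, smul Y c y)" "nrm P (x, y) = nrm X x / D + nrm Y y / \<epsilon>"
    for x x' y y' c
    by (simp_all add: P_def X.prod_space_def)
  define G where "G = {((x, Y.minus (S x) (smul Y t y0)), t) | x t.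
    x \<in> carr X \<and> (\<forall>\<phi>\<in>\<Phi>. \<phi> x = t * z \<phi>)}"
  have GI: "((x, Y.minus (S x) (smul Y t y0)), t) \<in> G"
    if "x \<in> carr X" "\<And>\<phi>. \<phi> \<in> \<Phi> \<Longrightarrow> \<phi> x = t * z \<phi>" for x t
    using that by (auto simp: G_def)
  have Gsmul: "(smul P k v, k * c) \<in> G" if "(v, c) \<in> G" for v c k
  proof -
    obtain x where x: "v = (x, Y.minus (S x) (smul Y c y0))" "x \<in> carr X"
      "\<And>\<phi>. \<phi> \<in> \<Phi> \<Longrightarrow> \<phi> x = c * z \<phi>" using \<open>(v, c) \<in> G\<close> by (auto simp: G_def)
    have "smul P k v = (smul X k x, Y.minus (S (smul X k x)) (smul Y (k * c) y0))"
      using x(1,2) y0 by (simp add: P S_smul Y.smul_minus Y.smul_smul)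
    moreover have "((smul X k x, Y.minus (S (smul X k x)) (smul Y (k * c) y0)), k * c) \<in> G"
    proof (rule GI)
      show "\<phi> (smul X k x) = k * c * z \<phi>" if "\<phi> \<in> \<Phi>" for \<phi>
        using x(3)[OF that] X.dual_smul[of \<phi> x k] \<Phi>(2) that x(2) by (auto simp: mult.assoc)
    qed (use x(2) in simp)
    ultimately show ?thesis by simp
  qed
  obtain x0 where x0: "x0 \<in> carr X" "\<And>\<phi>. \<phi> \<in> \<Phi> \<Longrightarrow> \<phi> x0 = z \<phi>"
    using X.solve_finite[OF \<Phi> z] by blast
  have one: "((x0, Y.minus (S x0) (smul Y 1 y0)), 1) \<in> G" using x0 by (intro GI) auto
  have minus_add: "add Y (Y.minus a (smul Y c y0)) (Y.minus b (smul Y d y0))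
      = Y.minus (add Y a b) (smul Y (c + d) y0)" if "a \<in> carr Y" "b \<in> carr Y" for a b c d
    using that y0 by (simp add: Y.minus_def Y.smul_smul Y.smul_add_left Y.smul_add_right Y.add_ac)
  obtain \<Psi> where \<Psi>: "\<Psi> \<in> carr (dual P)" "\<And>v c. (v, c) \<in> G \<Longrightarrow> \<Psi> v = c"
    "\<And>p. p \<in> carr P \<Longrightarrow> norm (\<Psi> p) \<le> 1 * nrm P p"
  proof (rule P.hahn_banach[of G 1])
    show "G \<subseteq> carr P \<times> UNIV" using y0 by (auto simp: G_def P)
    show "G \<noteq> {}" using one by blast
    show "(add P v w, c + d) \<in> G" if vc: "(v, c) \<in> G" and wd: "(w, d) \<in> G" for v c w d
    proof -
      obtain x where x: "v = (x, Y.minus (S x) (smul Y c y0))" "x \<in> carr X"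
        "\<And>\<phi>. \<phi> \<in> \<Phi> \<Longrightarrow> \<phi> x = c * z \<phi>" using vc by (auto simp: G_def)
      obtain y where y: "w = (y, Y.minus (S y) (smul Y d y0))" "y \<in> carr X"
        "\<And>\<phi>. \<phi> \<in> \<Phi> \<Longrightarrow> \<phi> y = d * z \<phi>" using wd by (auto simp: G_def)
      have "add P v w = (add X x y, Y.minus (S (add X x y)) (smul Y (c + d) y0))"
        using x(1,2) y(1,2) by (simp add: P minus_add S_add)
      moreover have "((add X x y, Y.minus (S (add X x y)) (smul Y (c + d) y0)), c + d) \<in> G"
      proof (rule GI)
        show "\<phi> (add X x y) = (c + d) * z \<phi>" if "\<phi> \<in> \<Phi>" for \<phi>
          using x(3)[OF that] y(3)[OF that] X.dual_add[of \<phi> x y] \<Phi>(2) that x(2) y(2)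
          by (auto simp: distrib_right)
      qed (use x(2) y(2) in simp)
      ultimately show ?thesis by simp
    qed
    show "norm c \<le> 1 * nrm P v" if vc: "(v, c) \<in> G" for v c
    proof (cases "c = 0")
      case True
      have "v \<in> carr P" using vc y0 by (auto simp: G_def P)
      then show ?thesis using True P.nrm_nonneg by simp
    next
      case False
      \<comment> \<open>Scaling to \<open>t = 1\<close> gives a genuine solution \<open>x\<close> of
        the equations. By \<open>neg\<close> one of the two norm conditions fails for it, so one
        weighted summand is at least 1.\<close>
      from Gsmul[OF vc, of "inverse c"] False
      obtain x where x: "smul P (inverse c) v = (x, Y.minus (S x) (smul Y 1 y0))" "x \<in> carr X"
        "\<And>\<phi>. \<phi> \<in> \<Phi> \<Longrightarrow> \<phi> x = 1 * z \<phi>" by (auto simp: G_def)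
      have "1 \<le> nrm P (smul P (inverse c) v)"
      proof (cases "nrm X x < D")
        case True
        have "1 \<le> nrm Y (Y.minus (S x) y0) / \<epsilon>" using neg[of x] True x \<epsilon> by simp
        moreover have "nrm X x / D \<ge> 0" using X.nrm_nonneg[OF x(2)] D0 by simp
        ultimately show ?thesis using y0 by (simp add: x(1) P Y.smul_one)
      next
        case False
        have "Y.minus (S x) (smul Y 1 y0) \<in> carr Y" using x(2) y0 by simp
        then have "nrm Y (Y.minus (S x) (smul Y 1 y0)) / \<epsilon> \<ge> 0" using Y.nrm_nonneg \<epsilon> by simp
        moreover have "1 \<le> nrm X x / D" using False D0 by simp
        ultimately show ?thesis unfolding x(1) P by linarith
      qed
      moreover have "v \<in> carr P" using vc y0 by (auto simp: G_def P)
      ultimately have "1 \<le> nrm P v / norm c" by (simp add: P.nrm_smul norm_inverse divide_inverse mult.commute)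
      then show ?thesis using False by (simp add: field_simps)
    qed
  qed (use Gsmul in auto)
  \<comment> \<open>The zero vectors of \<open>X\<close> and \<open>Y\<close>, through which each
    factor is embedded in the product.\<close>
  define oX where "oX = smul X 0 x0"
  define oY where "oY = smul Y 0 y0"
  have o: "oX \<in> carr X" "oY \<in> carr Y" using x0 y0 by (auto simp: oX_def oY_def)
  have oo: "add X oX oX = oX" "add Y oY oY = oY" "smul X c oX = oX" "smul Y c oY = oY" for c
    using x0 y0 by (auto simp: oX_def oY_def X.add_zero Y.add_zero X.smul_smul Y.smul_smul)
  have n0: "nrm X oX = 0" "nrm Y oY = 0" using x0 y0 by (auto simp: oX_def oY_def X.nrm_zero Y.nrm_zero)
  define \<phi>0 where "\<phi>0 = restrict (\<lambda>x. \<Psi> (x, oY)) (carr X)"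
  define g where "g = restrict (\<lambda>y. \<Psi> (oX, y)) (carr Y)"
  have b1: "norm (\<Psi> (x, oY)) \<le> (1 / D) * nrm X x" if "x \<in> carr X" for x
    using \<Psi>(3)[of "(x, oY)"] that o by (simp add: P n0)
  have b2: "norm (\<Psi> (oX, y)) \<le> (1 / \<epsilon>) * nrm Y y" if "y \<in> carr Y" for y
    using \<Psi>(3)[of "(oX, y)"] that o by (simp add: P n0)
  have \<phi>0: "\<phi>0 \<in> carr (dual X)" unfolding \<phi>0_def
  proof (rule X.dualI[OF _ _ b1])
    show "\<Psi> (add X x y, oY) = \<Psi> (x, oY) + \<Psi> (y, oY)" if "x \<in> carr X" "y \<in> carr X" for x y
      using P.dual_add[OF \<Psi>(1), of "(x, oY)" "(y, oY)"] that o by (simp add: P oo)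
    show "\<Psi> (smul X c x, oY) = c * \<Psi> (x, oY)" if "x \<in> carr X" for c x
      using P.dual_smul[OF \<Psi>(1), of "(x, oY)" c] that o by (simp add: P oo)
  qed
  have g: "g \<in> carr (dual Y)" unfolding g_def
  proof (rule Y.dualI[OF _ _ b2])
    show "\<Psi> (oX, add Y x y) = \<Psi> (oX, x) + \<Psi> (oX, y)" if "x \<in> carr Y" "y \<in> carr Y" for x y
      using P.dual_add[OF \<Psi>(1), of "(oX, x)" "(oX, y)"] that o by (simp add: P oo)
    show "\<Psi> (oX, smul Y c x) = c * \<Psi> (oX, x)" if "x \<in> carr Y" for c x
      using P.dual_smul[OF \<Psi>(1), of "(oX, x)" c] that o by (simp add: P oo)
  qed
  have split: "\<Psi> (x, y) = \<phi>0 x + g y" if "x \<in> carr X" "y \<in> carr Y" for x y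
    using P.dual_add[OF \<Psi>(1), of "(x, oY)" "(oX, y)"] that o x0 y0
    by (simp add: P \<phi>0_def g_def oX_def oY_def X.add_zero Y.add_commute[of "smul Y 0 y0"] Y.add_zero)
  have nz: "nrm (dual X) \<phi>0 \<le> 1 / D"
    using b1 D0 by (intro X.dual_nrm_le) (auto simp: \<phi>0_def)
  define \<psi> where "\<psi> = add (dual X) \<phi>0 (S' g)"
  have \<psi>: "\<psi> \<in> carr (dual X)" using \<phi>0 g by (simp add: \<psi>_def)
  \<comment> \<open>On the common kernel of \<open>\<Phi>\<close> the graph \<open>G\<close> has
    \<open>t = 0\<close>, so \<open>\<psi> = \<phi>0 + S' g\<close> vanishes there. Comparing
    \<open>\<psi> x0 = 1 + g y0\<close> with \<open>z \<psi> = z \<phi>0 + g y0\<close> then yields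
    \<open>z \<phi>0 = 1\<close>.\<close>
  have "\<psi> x0 = z \<psi>"
  proof (rule X.eq_at_subspace[OF \<Phi> x0(1) z x0(2) \<psi>])
    fix x assume x: "x \<in> carr X" "\<And>\<phi>. \<phi> \<in> \<Phi> \<Longrightarrow> \<phi> x = 0"
    have "((x, Y.minus (S x) (smul Y 0 y0)), 0) \<in> G" using x by (intro GI) auto
    from \<Psi>(2)[OF this] have "\<phi>0 x + g (Y.minus (S x) (smul Y 0 y0)) = 0"
      using split x y0 by simp
    then show "\<psi> x = 0"
      using x g y0 by (simp add: \<psi>_def X.dual_add_apply Y.dual_minus Y.dual_smul)
  qed
  moreover have "z \<psi> = z \<phi>0 + g y0"
    using z \<phi>0 g zy[OF g] by (simp add: \<psi>_def X'.dual_add)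
  moreover have "\<phi>0 x0 + (g (S x0) - g y0) = 1"
    using \<Psi>(2)[OF one] split x0 y0 g by (simp add: Y.dual_minus Y.smul_one)
  ultimately have "z \<phi>0 = 1"
    using x0 g by (simp add: \<psi>_def X.dual_add_apply algebra_simps)
  then have "1 \<le> nrm (bidual X) z * nrm (dual X) \<phi>0"
    using X'.dual_bound[OF z \<phi>0] by simp
  also have "\<dots> \<le> nrm (bidual X) z * (1 / D)"
    using nz X'.dual_nrm_nonneg[OF z] by (intro mult_left_mono)
  also have "\<dots> < 1" using D D0 by simp
  finally show False by simp
qed

text \<open>Each \<open>z - canon X x\<close> has norm greater than \<open>d\<close>, expressed by
  test functionals; thus \<open>z\<close> has distance at least \<open>d\<close> from the canonical
  image.\<close>

definition (in seminormed) far :: "(('a \<Rightarrow> 'k) \<Rightarrow> 'k) \<Rightarrow> real \<Rightarrow> bool" where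
  "far z d \<longleftrightarrow> d > 0 \<and> (\<forall>x\<in>carr X. \<exists>\<phi>\<in>carr (dual X). norm (z \<phi> - \<phi> x) > d * nrm (dual X) \<phi>)"

text \<open>Otherwise \<open>z\<close> has norm at most \<open>d\<close> on the annihilator of
  \<open>A\<close>. Extend that restriction to \<open>z'\<close> with the same bound. Then
  \<open>z - z'\<close> vanishes on the annihilator of a finite set, hence is a point of
  \<open>X\<close> at distance at most \<open>d\<close> from \<open>z\<close>.\<close>

lemma (in seminormed) far_functional:
  assumes z: "z \<in> carr (bidual X)" and far: "far z d" and A: "finite A" "A \<subseteq> carr X"
  shows "\<exists>f\<in>carr (dual X). (\<forall>a\<in>A. f a = 0) \<and> z f = 1 \<and> nrm (dual X) f \<le> 1 / d"
proof (rule ccontr)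
  interpret D: seminormed "dual X" by (rule seminormed_dual)
  assume nth: "\<not> ?thesis"
  have neg: "nrm (dual X) f > 1 / d"
    if "f \<in> carr (dual X)" "\<And>a. a \<in> A \<Longrightarrow> f a = 0" "z f = 1" for f
  proof (rule ccontr)
    assume "\<not> 1 / d < nrm (dual X) f"
    then show False using nth that by (metis not_less)
  qed
  have d: "d > 0" using far by (simp add: far_def)
  define G where "G = {(f, z f) | f. f \<in> carr (dual X) \<and> (\<forall>a\<in>A. f a = 0)}"
  obtain f0 where f0: "f0 \<in> carr (dual X)" using D.carr_nonempty by blast
  have a: "a \<in> carr X" if "a \<in> A" for a using A that by blast
  have f00: "(smul (dual X) 0 f0, z (smul (dual X) 0 f0)) \<in> G"
    using f0 a by (auto simp: G_def dual_smul_apply)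
  obtain z' where z': "z' \<in> carr (bidual X)" "\<And>v c. (v, c) \<in> G \<Longrightarrow> z' v = c"
    "\<And>f. f \<in> carr (dual X) \<Longrightarrow> norm (z' f) \<le> d * nrm (dual X) f"
  proof (rule D.hahn_banach[of G d])
    show "G \<noteq> {}" using f00 by blast
    show "norm c \<le> d * nrm (dual X) v" if "(v, c) \<in> G" for v c
    proof (cases "c = 0")
      case True then show ?thesis using d D.nrm_nonneg[of v] that by (auto simp: G_def)
    next
      case False
      have v: "v \<in> carr (dual X)" "\<And>a. a \<in> A \<Longrightarrow> v a = 0" "c = z v" using that by (auto simp: G_def)
      have "1 / d < nrm (dual X) (smul (dual X) (inverse c) v)"
        by (rule neg) (use v a z False in \<open>auto simp: D.dual_smul dual_smul_apply\<close>)
      then have "1 / d < nrm (dual X) v / norm c"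
        using v by (simp add: D.nrm_smul norm_inverse divide_inverse mult.commute)
      then show ?thesis using d False by (simp add: field_simps)
    qed
  qed (use z a d in \<open>auto simp: G_def D.dual_add D.dual_smul dual_add_apply dual_smul_apply\<close>)
  interpret DD: seminormed "bidual X" by (rule D.seminormed_dual)
  define \<psi> where "\<psi> = DD.minus z z'"
  have \<psi>: "\<psi> \<in> carr (bidual X)" using z z' by (simp add: \<psi>_def)
  have \<psi>_apply: "\<psi> f = z f - z' f" if "f \<in> carr (dual X)" for f
    using that by (simp add: \<psi>_def DD.minus_def D.dual_add_apply D.dual_smul_apply)
  \<comment> \<open>\<open>kernel_span\<close> is used one level up: the functionals are evaluations
    at the points of \<open>A\<close>, and \<open>\<Omega>\<close> is the canonical image.\<close>
  have "\<psi> \<in> canon X ` carr X"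
  proof (rule D.kernel_span[of "canon X ` A"])
    show "finite (canon X ` A)" using A by simp
    show "canon X ` A \<subseteq> canon X ` carr X" using A by blast
    show "canon X ` carr X \<noteq> {}" using carr_nonempty by blast
    show "add (bidual X) f g \<in> canon X ` carr X"
      if "f \<in> canon X ` carr X" "g \<in> canon X ` carr X" for f g
    proof -
      from that obtain x y where "x \<in> carr X" "y \<in> carr X" "f = canon X x" "g = canon X y" by blast
      moreover from this have "add (bidual X) f g = canon X (add X x y)"
        by (intro D.dual_ext) (auto simp: D.dual_add_apply dual_add)
      ultimately show ?thesis by simp
    qed
    show "smul (bidual X) c f \<in> canon X ` carr X" if "f \<in> canon X ` carr X" for c f
    proof -
      from that obtain x where "x \<in> carr X" "f = canon X x" by blast
      moreover from this have "smul (bidual X) c f = canon X (smul X c x)"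
        by (intro D.dual_ext) (auto simp: D.dual_smul_apply dual_smul)
      ultimately show ?thesis by simp
    qed
    show "\<psi> f = 0" if f: "f \<in> carr (dual X)" and 0: "\<And>\<phi>. \<phi> \<in> canon X ` A \<Longrightarrow> \<phi> f = 0" for f
    proof -
      have "f a = 0" if "a \<in> A" for a using 0[of "canon X a"] that f by auto
      then have "(f, z f) \<in> G" using f by (auto simp: G_def)
      from z'(2)[OF this] show ?thesis using \<psi>_apply f by simp
    qed
  qed (use \<psi> in auto)
  then obtain x where x: "x \<in> carr X" "\<psi> = canon X x" by blast
  obtain \<phi> where \<phi>: "\<phi> \<in> carr (dual X)" "norm (z \<phi> - \<phi> x) > d * nrm (dual X) \<phi>"
    using far x by (auto simp: far_def)
  have "z \<phi> - \<phi> x = z' \<phi>" using \<psi>_apply[OF \<phi>(1)] x(2) \<phi>(1) by simp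
  then show False using z'(3)[OF \<phi>(1)] \<phi>(2) by simp
qed

section \<open>Non-reflexivity and completeness\<close>

text \<open>Hahn-Banach extends the limit along \<open>j\<close> to a functional on
  \<open>dual X\<close>, which by reflexivity is evaluation at a point \<open>w\<close>; so every
  \<open>\<phi> i w\<close> is \<open>a\<close>. An extension \<open>\<Psi>\<close> of the limit
  along \<open>i\<close> has \<open>\<Psi> w = a\<close>, but also \<open>\<Psi> (y j) = b\<close>
  for all \<open>j\<close> and hence \<open>\<Psi> w = b\<close>. The bound \<open>yb\<close> on the
  \<open>y j\<close> is stated through functionals because in the cotauberian part these points are
  known only through the bidual.\<close>

lemma (in seminormed) double_limit_not_reflexive:
  assumes y: "\<And>j. y j \<in> carr X" and \<phi>: "\<And>i. \<phi> i \<in> carr (dual X)"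
    and yb: "\<And>j f. f \<in> carr (dual X) \<Longrightarrow> norm (f (y j)) \<le> C * nrm (dual X) f"
    and \<phi>b: "\<And>i. nrm (dual X) (\<phi> i) \<le> D" and CD: "C \<ge> 0" "D \<ge> 0"
    and a: "\<And>i. (\<lambda>j. \<phi> i (y j)) \<longlonglongrightarrow> a" and b: "\<And>j. (\<lambda>i. \<phi> i (y j)) \<longlonglongrightarrow> b"
    and ab: "a \<noteq> b"
  shows "\<not> reflexive X"
proof
  interpret D: seminormed "dual X" by (rule seminormed_dual)
  assume refl: "reflexive X"
  define G where "G = {(f, l) | f l. f \<in> carr (dual X) \<and> (\<lambda>j. f (y j)) \<longlonglongrightarrow> l}"
  obtain \<Lambda> where \<Lambda>: "\<Lambda> \<in> carr (bidual X)" "\<And>f l. (f, l) \<in> G \<Longrightarrow> \<Lambda> f = l"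
  proof (rule D.hahn_banach[of G C])
    show "G \<noteq> {}" using \<phi> a by (auto simp: G_def)
    show "norm c \<le> C * nrm (dual X) v" if "(v, c) \<in> G" for v c
      using that yb[of v] by (auto simp: G_def intro!: LIMSEQ_le_const2[OF tendsto_norm])
  qed (use CD y in \<open>auto simp: G_def dual_add_apply dual_smul_apply intro!: tendsto_add tendsto_mult_left\<close>)
  obtain w where w: "w \<in> carr X" "\<Lambda> = canon X w"
    using refl \<Lambda>(1) by (auto simp: reflexive_def canonical_image_canon)
  have \<phi>w: "\<phi> i w = a" for i
    using \<Lambda>(2)[of "\<phi> i" a] \<phi> a by (simp add: w G_def)
  define H where "H = {(x, l) | x l. x \<in> carr X \<and> (\<lambda>i. \<phi> i x) \<longlonglongrightarrow> l}"
  obtain \<Psi> where \<Psi>: "\<Psi> \<in> carr (dual X)" "\<And>x l. (x, l) \<in> H \<Longrightarrow> \<Psi> x = l"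
  proof (rule hahn_banach[of H D])
    show "H \<noteq> {}" using y b by (auto simp: H_def)
    show "norm c \<le> D * nrm X v" if "(v, c) \<in> H" for v c
    proof -
      have v: "v \<in> carr X" "(\<lambda>i. \<phi> i v) \<longlonglongrightarrow> c" using that by (auto simp: H_def)
      have "norm (\<phi> i v) \<le> D * nrm X v" for i
        using dual_bound[OF \<phi> v(1)] mult_right_mono[OF \<phi>b nrm_nonneg[OF v(1)]] by (rule order_trans)
      then show ?thesis by (intro LIMSEQ_le_const2[OF tendsto_norm[OF v(2)]]) auto
    qed
  qed (use CD \<phi> in \<open>auto simp: H_def dual_add dual_smul intro!: tendsto_add tendsto_mult_left\<close>)
  have "\<Psi> w = a" using \<phi>w w by (intro \<Psi>(2)) (simp add: H_def)
  moreover have "\<Psi> (y j) = b" for j using y b by (intro \<Psi>(2)) (simp add: H_def)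
  then have "\<Lambda> \<Psi> = b" using \<Psi>(1) by (intro \<Lambda>(2)) (simp add: G_def)
  ultimately show False using ab \<Psi>(1) by (simp add: w)
qed

text \<open>Completeness for sequences with geometric increments. In a quotient such increments can
  be lifted one by one to summable vectors.\<close>

definition (in seminormed) complete_nspace :: bool where
  "complete_nspace \<longleftrightarrow> (\<forall>s. (\<forall>n. s n \<in> carr X) \<longrightarrow> (\<forall>n. nrm X (minus (s (Suc n)) (s n)) \<le> (1 / 2) ^ n)
     \<longrightarrow> (\<exists>x\<in>carr X. (\<lambda>n. nrm X (minus (s n) x)) \<longlonglongrightarrow> 0))"

lemma (in seminormed) norming:
  assumes x: "x \<in> carr X"
  obtains f where "f \<in> carr (dual X)" "f x = of_real (nrm X x)" "nrm (dual X) f \<le> 1"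
proof -
  define G where "G = {(smul X c x, c * of_real (nrm X x)) | c. True}"
  have one: "(x, of_real (nrm X x)) \<in> G"
    unfolding G_def using smul_one[OF x] by (metis (mono_tags, lifting) mem_Collect_eq mult_1)
  obtain f where f: "f \<in> carr (dual X)" "\<And>v c. (v, c) \<in> G \<Longrightarrow> f v = c"
    "\<And>x. x \<in> carr X \<Longrightarrow> norm (f x) \<le> 1 * nrm X x"
  proof (rule hahn_banach[of G 1])
    show "(add X v w, c + d) \<in> G" if "(v, c) \<in> G" "(w, d) \<in> G" for v c w d
      using that x by (auto simp: G_def simp flip: smul_add_left distrib_right)
    show "(smul X k v, k * c) \<in> G" if "(v, c) \<in> G" for v c k
      using that x by (auto simp: G_def smul_smul simp flip: mult.assoc)
    show "norm c \<le> 1 * nrm X v" if "(v, c) \<in> G" for v c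
      using that x nrm_nonneg[OF x] by (auto simp: G_def nrm_smul norm_mult)
  qed (use x one in \<open>auto simp: G_def\<close>)
  show thesis
    using f(2)[OF one] f(3) by (intro that[OF f(1)] dual_nrm_le) auto
qed

text \<open>At distance zero, points \<open>s n\<close> of \<open>X\<close> approximating
  \<open>z\<close> form a rapidly Cauchy sequence, and \<open>z\<close> is evaluation at its
  limit.\<close>

lemma (in seminormed) complete_far:
  assumes complete_nspace and z: "z \<in> carr (bidual X)" "z \<notin> canonical_image X"
  obtains d where "far z d"
proof (rule ccontr)
  interpret D: seminormed "dual X" by (rule seminormed_dual)
  assume "\<not> thesis"
  \<comment> \<open>The factor 1/4 leaves room: two consecutive errors add up to 3/8 of
    \<open>(1 / 2) ^ n\<close>.\<close>
  then have "\<not> far z ((1 / 2) ^ n / 4)" for n using that by blast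
  then have "\<exists>x\<in>carr X. \<forall>\<phi>\<in>carr (dual X). norm (z \<phi> - \<phi> x) \<le> (1 / 2) ^ n / 4 * nrm (dual X) \<phi>" for n :: nat
    by (auto simp: far_def not_less)
  then obtain s where s: "\<And>n::nat. s n \<in> carr X"
    "\<And>n \<phi>. \<phi> \<in> carr (dual X) \<Longrightarrow> norm (z \<phi> - \<phi> (s n)) \<le> (1 / 2) ^ n / 4 * nrm (dual X) \<phi>"
    by metis
  have "nrm X (minus (s (Suc n)) (s n)) \<le> (1 / 2) ^ n" for n
  proof -
    let ?x = "minus (s (Suc n)) (s n)"
    obtain f where f: "f \<in> carr (dual X)" "f ?x = of_real (nrm X ?x)" "nrm (dual X) f \<le> 1"
      using norming[of ?x] s(1) by auto
    have "norm (f ?x) = norm ((z f - f (s n)) - (z f - f (s (Suc n))))"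
      using f s(1) by (simp add: dual_minus)
    also have "\<dots> \<le> (1 / 2) ^ n / 4 * nrm (dual X) f + (1 / 2) ^ Suc n / 4 * nrm (dual X) f"
      by (rule order_trans[OF norm_triangle_ineq4 add_mono[OF s(2)[OF f(1)] s(2)[OF f(1)]]])
    also have "\<dots> \<le> (1 / 2) ^ n / 4 * 1 + (1 / 2) ^ Suc n / 4 * 1"
      using f(3) by (intro add_mono mult_left_mono) auto
    also have "\<dots> \<le> (1 / 2) ^ n" by simp
    finally show ?thesis using f(2) nrm_nonneg[of ?x] s(1) by simp
  qed
  then obtain x where x: "x \<in> carr X" "(\<lambda>n. nrm X (minus (s n) x)) \<longlonglongrightarrow> 0"
    using assms(1) s(1) unfolding complete_nspace_def by blast
  have "z = canon X x"
  proof (rule D.dual_ext)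
    fix \<phi> assume \<phi>: "\<phi> \<in> carr (dual X)"
    have "norm (z \<phi> - \<phi> x) \<le> (1 / 2) ^ n / 4 * nrm (dual X) \<phi> + nrm (dual X) \<phi> * nrm X (minus (s n) x)" for n
    proof -
      have "norm (z \<phi> - \<phi> x) = norm ((z \<phi> - \<phi> (s n)) + \<phi> (minus (s n) x))"
        using \<phi> s(1) x(1) by (simp add: dual_minus)
      then show ?thesis
        using norm_triangle_ineq[of "z \<phi> - \<phi> (s n)" "\<phi> (minus (s n) x)"] s(2)[OF \<phi>, of n]
          dual_bound[OF \<phi>, of "minus (s n) x"] s(1) x(1) by fastforce
    qed
    moreover have "(\<lambda>n. (1 / 2) ^ n / 4 * nrm (dual X) \<phi> + nrm (dual X) \<phi> * nrm X (minus (s n) x))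
        \<longlonglongrightarrow> 0 / 4 * nrm (dual X) \<phi> + nrm (dual X) \<phi> * 0"
      by (intro tendsto_intros x(2) LIMSEQ_realpow_zero) auto
    ultimately have "norm (z \<phi> - \<phi> x) \<le> 0" by (intro LIMSEQ_le_const) auto
    then show "z \<phi> = canon X x \<phi>" using \<phi> by simp
  qed (use z x in auto)
  then show False using z(2) x(1) by (simp add: canonical_image_canon)
qed

text \<open>The candidate nearest point is \<open>w\<close>, the restriction of \<open>z\<close> to
  \<open>X\<close>. If \<open>x\<close> were within \<open>d\<close> of \<open>z\<close>, testing on
  canonical images would put \<open>x\<close> within \<open>d\<close> of \<open>w\<close>. Then
  \<open>z F\<close> and \<open>F w\<close> would differ by at most
  \<open>2 * d * nrm (bidual X) F\<close>, too little for a suitable \<open>F\<close>.\<close>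

lemma (in seminormed) dual_far:
  assumes z: "z \<in> carr (bidual (dual X))" "z \<notin> canonical_image (dual X)"
  obtains d where "seminormed.far (dual X) z d"
proof -
  interpret D: seminormed "dual X" by (rule seminormed_dual)
  interpret DD: seminormed "bidual X" by (rule D.seminormed_dual)
  interpret can: operator X "bidual X" "canon X" 1 by (rule canon_operator)
  define w where "w = can.S' z"
  have w: "w \<in> carr (dual X)" unfolding w_def using z(1) by (rule can.conj_carr)
  have cn: "nrm (bidual X) (canon X x) \<le> nrm X x" if "x \<in> carr X" for x
    using can.S_bound[OF that] by simp
  have "z \<noteq> canon (dual X) w" using z(2) w by (auto simp: canonical_image_canon)
  then obtain F where F: "F \<in> carr (bidual X)" "z F \<noteq> F w"
    using DD.dual_ext[OF z(1) D.canon_in_bidual[OF w]] canon_apply by metis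
  have nF: "nrm (bidual X) F \<ge> 0" using D.dual_nrm_nonneg[OF F(1)] .
  \<comment> \<open>Chosen so that \<open>d * (2 * nrm (bidual X) F + 1)\<close> is half of the gap;
    the summand 1 keeps the denominator positive.\<close>
  define d where "d = norm (z F - F w) / (2 * nrm (bidual X) F + 1) / 2"
  have d: "d > 0" using F nF by (simp add: d_def)
  have "D.far z d"
    unfolding D.far_def
  proof (intro conjI ballI d, rule ccontr)
    fix x assume x: "x \<in> carr (dual X)"
    assume "\<not> (\<exists>\<phi>\<in>carr (bidual X). d * nrm (bidual X) \<phi> < norm (z \<phi> - \<phi> x))"
    then have le: "norm (z \<phi> - \<phi> x) \<le> d * nrm (bidual X) \<phi>" if "\<phi> \<in> carr (bidual X)" for \<phi>
      using that by (auto simp: not_less)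
    have "nrm (dual X) (D.minus x w) \<le> d"
    proof (rule dual_nrm_le)
      fix y assume y: "y \<in> carr X"
      have "D.minus x w y = x y - w y"
        using y by (simp add: D.minus_def dual_add_apply dual_smul_apply)
      also have "\<dots> = - (z (canon X y) - canon X y x)" using y x z(1) by (simp add: w_def)
      finally have "norm (D.minus x w y) = norm (z (canon X y) - canon X y x)"
        by (simp add: norm_minus_commute)
      also have "\<dots> \<le> d * nrm X y"
        using le[of "canon X y"] y d cn[OF y] by (meson canon_in_bidual less_imp_le mult_left_mono order_trans)
      finally show "norm (D.minus x w y) \<le> d * nrm X y" .
    qed (use d in simp)
    then have "norm (F (D.minus x w)) \<le> nrm (bidual X) F * d"
      using D.dual_bound[OF F(1), of "D.minus x w"] x w nF
      by (meson D.minus_closed mult_left_mono order_trans)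
    moreover have "norm (z F - F w) \<le> norm (z F - F x) + norm (F x - F w)"
      using norm_triangle_ineq[of "z F - F x" "F x - F w"] by simp
    moreover have "F (D.minus x w) = F x - F w" using F x w by (simp add: D.dual_minus)
    ultimately have "norm (z F - F w) \<le> d * (2 * nrm (bidual X) F)"
      using le[OF F(1)] by (simp add: algebra_simps)
    also have "\<dots> < norm (z F - F w)"
    proof -
      have "d * (2 * nrm (bidual X) F) \<le> d * (2 * nrm (bidual X) F + 1)" using d by simp
      also have "\<dots> = norm (z F - F w) / 2"
      proof -
        have "2 * nrm (bidual X) F + 1 \<noteq> 0" using nF by linarith
        then show ?thesis unfolding d_def by (simp only: times_divide_eq_left nonzero_mult_div_cancel_right divide_divide_eq_left) (simp add: field_simps)
      qed
      also have "\<dots> < norm (z F - F w)" using F(2) by simp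
      finally show ?thesis .
    qed
    finally show False by simp
  qed
  then show thesis using that by blast
qed

section \<open>Completeness of closed subspaces and quotients\<close>

lemma convergent_geometric_increments:
  fixes s :: "nat \<Rightarrow> 'z::banach"
  assumes "\<And>n. norm (s (Suc n) - s n) \<le> c * (1 / 2) ^ n"
  shows "convergent s"
proof -
  have "summable (\<lambda>n. s (Suc n) - s n)"
  proof (rule summable_comparison_test')
    show "summable (\<lambda>n. c * (1 / 2) ^ n)" by (intro summable_mult summable_geometric) auto
  qed (rule assms)
  then have "convergent (\<lambda>m. \<Sum>n<m. s (Suc n) - s n)" by (simp add: summable_iff_convergent)
  then have "convergent (\<lambda>m. (s m - s 0) + s 0)"
    by (intro convergent_add convergent_const) (simp add: sum_lessThan_telescope)
  then show ?thesis by simp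
qed

lemma sub_space_simps [simp]:
  "carr (sub_space scl A) = A" "add (sub_space scl A) = (+)" "smul (sub_space scl A) = scl"
  "nrm (sub_space scl A) = norm"
  by (simp_all add: sub_space_def)

context closed_sub
begin

lemma complete_sub: "sub.complete_nspace"
  unfolding sub.complete_nspace_def
proof (intro allI impI)
  fix s
  have m: "sub.minus x y = x - y" for x y
    by (simp add: sub.minus_def)
  assume s: "\<forall>n. s n \<in> carr (sub_space scl B)"
    and "\<forall>n. nrm (sub_space scl B) (sub.minus (s (Suc n)) (s n)) \<le> (1 / 2) ^ n"
  then have "convergent s"
    by (intro convergent_geometric_increments[of s 1]) (simp add: m)
  then obtain x where x: "s \<longlonglongrightarrow> x" by (auto simp: convergent_def)
  have "x \<in> B" using closed s x by (auto intro: closed_sequentially)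
  moreover have "(\<lambda>n. norm (s n - x)) \<longlonglongrightarrow> 0" using x by (simp add: LIM_zero tendsto_norm_zero)
  ultimately show "\<exists>x\<in>carr (sub_space scl B).
      (\<lambda>n. nrm (sub_space scl B) (sub.minus (s n) x)) \<longlonglongrightarrow> 0"
    unfolding m by auto
qed

lemma Q_minus: "quot.minus (Q x) (Q y) = Q (x - y)"
  by (simp add: quot.minus_def Q_smul Q_add)

lemma complete_quot: "quot.complete_nspace"
  unfolding quot.complete_nspace_def
proof (intro allI impI)
  fix S
  assume S: "\<forall>n. S n \<in> carr ZB" and d: "\<forall>n. nrm ZB (quot.minus (S (Suc n)) (S n)) \<le> (1 / 2) ^ n"
  have "\<exists>y. S n = Q y" for n using S[rule_format, of n] by (simp add: carr_quot image_iff)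
  then obtain x where x: "\<And>n. S n = Q (x n)" by metis
  \<comment> \<open>The quotient norm is an infimum that need not be attained; the factor 2 gives
    the strict inequality needed to pick a representative.\<close>
  have "\<exists>v. v - (x (Suc n) - x n) \<in> B \<and> norm v \<le> 2 * (1 / 2) ^ n" for n
  proof -
    have "nrm ZB (Q (x (Suc n) - x n)) < 2 * (1 / 2) ^ n"
    proof -
      have "nrm ZB (Q (x (Suc n) - x n)) \<le> (1 / 2) ^ n" using d x by (simp add: Q_minus)
      also have "\<dots> < 2 * (1 / 2) ^ n" by simp
      finally show ?thesis .
    qed
    then obtain v where "v - (x (Suc n) - x n) \<in> B" "norm v < 2 * (1 / 2) ^ n"
      by (rule Q_nrm_less)
    then show ?thesis by (intro exI[of _ v]) simp
  qed
  then obtain \<delta> where \<delta>: "\<And>n. \<delta> n - (x (Suc n) - x n) \<in> B" "\<And>n. norm (\<delta> n) \<le> 2 * (1 / 2) ^ n"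
    by metis
  define s where "s n = x 0 + (\<Sum>k<n. \<delta> k)" for n
  have Qs: "Q (s n) = S n" for n
  proof (induction n)
    case 0 then show ?case by (simp add: s_def x)
  next
    case (Suc n)
    have "s (Suc n) - x (Suc n) = (s n - x n) + (\<delta> n - (x (Suc n) - x n))" by (simp add: s_def)
    also have "\<dots> \<in> B" by (rule sum[OF _ \<delta>(1)]) (use Suc in \<open>simp add: x Q_eq_iff\<close>)
    finally show ?case by (simp add: x Q_eq_iff)
  qed
  have "convergent s"
    using \<delta>(2) by (intro convergent_geometric_increments[of s 2]) (simp add: s_def)
  then obtain y where y: "s \<longlonglongrightarrow> y" by (auto simp: convergent_def)
  have "(\<lambda>n. nrm ZB (quot.minus (S n) (Q y))) \<longlonglongrightarrow> 0"
  proof (rule tendsto_sandwich[OF _ _ tendsto_const])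
    show "(\<lambda>n. norm (s n - y)) \<longlonglongrightarrow> 0" using y by (simp add: LIM_zero tendsto_norm_zero)
    show "\<forall>\<^sub>F n in sequentially. nrm ZB (quot.minus (S n) (Q y)) \<le> norm (s n - y)"
      by (simp add: Q_minus Q_nrm flip: Qs)
    show "\<forall>\<^sub>F n in sequentially. 0 \<le> nrm ZB (quot.minus (S n) (Q y))"
      using quot.nrm_nonneg by (simp add: Q_minus flip: Qs)
  qed
  then show "\<exists>x\<in>carr ZB. (\<lambda>n. nrm ZB (quot.minus (S n) x)) \<longlonglongrightarrow> 0" by auto
qed

end

section \<open>Compact operators\<close>

text \<open>This is \<open>helly\<close> for the zero operator, where the condition in the range
  space is void.\<close>

lemma (in seminormed) goldstine:
  assumes z: "z \<in> carr (bidual X)" and D: "nrm (bidual X) z < D"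
    and \<Phi>: "finite \<Phi>" "\<Phi> \<subseteq> carr (dual X)"
  shows "\<exists>x\<in>carr X. nrm X x < D \<and> (\<forall>\<phi>\<in>\<Phi>. \<phi> x = z \<phi>)"
proof -
  interpret D: seminormed "dual X" by (rule seminormed_dual)
  obtain x0 where x0: "x0 \<in> carr X" using carr_nonempty by blast
  interpret S: operator X X "\<lambda>x. smul X 0 x" 0
    by (intro operator.intro operator_axioms.intro seminormed_axioms)
      (auto simp: bounded_op_def smul_smul add_zero nrm_smul intro: smul_zero_eq)
  have "z (S.S' g) = g (smul X 0 x0)" if g: "g \<in> carr (dual X)" for g
  proof -
    have "S.S' g = smul (dual X) 0 g"
      by (rule dual_ext) (use g in \<open>auto simp: dual_smul_apply dual_smul\<close>)
    then show ?thesis using g z x0 by (simp add: D.dual_smul dual_smul)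
  qed
  from S.helly[OF z D _ this \<Phi>, of 1] x0 show ?thesis by auto
qed

text \<open>Makes the coefficient sets of finite partial sums compact in
  \<open>compact_operator_nuclear\<close>.\<close>

lemma compact_cball_scalar: "compact (cball (0::'k::real_or_complex) r)"
proof (cases rule: real_or_complex_cases[where 'k='k])
  case real
  have "cball (0::'k) r \<subseteq> of_real ` {-r..r}"
  proof
    fix z :: 'k assume z: "z \<in> cball 0 r"
    obtain a where "z = of_real a" using real by blast
    then show "z \<in> of_real ` {-r..r}" using z by (auto simp: abs_le_iff)
  qed
  moreover have "compact (of_real ` {-r..r} :: 'k set)"
    by (intro compact_continuous_image continuous_intros) auto
  ultimately show ?thesis by (metis closed_cball compact_Int_closed inf.absorb_iff2)
next
  case (complex i)
  let ?I = "(\<lambda>(a, b). of_real a + of_real b * i) ` ({-r..r} \<times> {-r..r})"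
  have "cball (0::'k) r \<subseteq> ?I"
  proof
    fix z :: 'k assume z: "z \<in> cball 0 r"
    obtain a b where ab: "z = of_real a + of_real b * i" using complex by blast
    have "sqrt (a\<^sup>2 + b\<^sup>2) \<le> r" using z complex(3) by (simp add: ab)
    then have "\<bar>a\<bar> \<le> r" "\<bar>b\<bar> \<le> r"
      using real_sqrt_ge_abs1[of a b] real_sqrt_ge_abs2[of b a] by linarith+
    then show "z \<in> ?I" by (auto simp: ab abs_le_iff)
  qed
  moreover have "compact ?I"
    by (intro compact_continuous_image) (auto simp: case_prod_unfold intro!: continuous_intros compact_Times)
  ultimately show ?thesis by (metis closed_cball compact_Int_closed inf.absorb_iff2)
qed

context banach_space_over
begin

abbreviation Z where "Z \<equiv> sub_space scl UNIV"

sublocale Z: seminormed Z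
  by (rule seminormed_sub_space) (simp add: subspace_UNIV)

lemma bounded_linear_scl_left: "bounded_linear (\<lambda>a. scl a w)"
proof (rule bounded_linear_intro)
  show "scl (r *\<^sub>R a) w = r *\<^sub>R scl a w" for r a
    by (metis scl_of_real scale_scale scaleR_conv_of_real)
qed (auto simp: scale_left_distrib norm_scl)

lemma bounded_linear_scl_right: "bounded_linear (\<lambda>w. scl a w)"
proof (rule bounded_linear_intro)
  show "scl a (r *\<^sub>R w) = r *\<^sub>R scl a w" for r w
    by (metis scl_of_real scale_scale mult.commute)
  show "norm (scl a w) \<le> norm w * norm a" for w by (simp add: norm_scl)
qed (rule scale_right_distrib)

lemma bounded_linear_functional:
  assumes h: "h \<in> carr (dual Z)" shows "bounded_linear h"
proof (rule bounded_linear_intro)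
  show "h (x + y) = h x + h y" for x y using Z.dual_add[OF h, of x y] by simp
  show "h (r *\<^sub>R x) = r *\<^sub>R h x" for r x
    using Z.dual_smul[OF h, of x "of_real r"] by (simp add: scl_of_real scaleR_conv_of_real)
  show "norm (h x) \<le> norm x * nrm (dual Z) h" for x
    using Z.dual_bound[OF h, of x] by (simp add: mult.commute)
qed

lemma compact_operator_bounded:
  assumes "compact_operator scl K"
  shows "\<exists>b\<ge>0. \<forall>x. norm (K x) \<le> b * norm x"
proof -
  interpret K: Vector_Spaces.linear scl scl K using assms by (simp add: compact_operator_def)
  have "bounded (K ` cball 0 1)"
    using assms unfolding compact_operator_def
    by (meson bounded_subset closure_subset compact_imp_bounded)
  then obtain b where b: "\<And>x. x \<in> cball 0 1 \<Longrightarrow> norm (K x) \<le> b"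
    unfolding bounded_iff by blast
  have "norm (K x) \<le> b * norm x" for x
  proof (cases "x = 0")
    case True then show ?thesis by (simp add: K.zero)
  next
    case False
    have "norm (K (scl (of_real (1 / norm x)) x)) \<le> b"
      using False by (intro b) (simp add: norm_scl norm_divide)
    then show ?thesis using False by (simp add: K.scale norm_scl norm_divide field_simps)
  qed
  moreover have "b \<ge> 0" using b[of 0] norm_ge_zero[of "K 0"] by simp
  ultimately show ?thesis by blast
qed

text \<open>
  The left-hand side is the second conjugate of \<open>K J\<^sub>E\<close> at \<open>\<xi>\<close>, evaluated at \<open>h\<close>. Goldstine's theorem
  gives \<open>k\<close> for finitely many \<open>h\<close>, and compactness for all \<open>h\<close> at once.
\<close>

lemma compact_operator_bidual:
  assumes K: "compact_operator scl K" and E: "module.subspace scl E"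
    and \<xi>: "\<xi> \<in> carr (bidual (sub_space scl E))"
  shows "\<exists>k. \<forall>h\<in>carr (dual Z). \<xi> (\<lambda>x\<in>E. h (K x)) = h k"
proof -
  interpret E: seminormed "sub_space scl E" using E by (rule seminormed_sub_space)
  interpret K: Vector_Spaces.linear scl scl K using K by (simp add: compact_operator_def)
  have carrE: "carr (sub_space scl E) = E" "nrm (sub_space scl E) = norm"
    by simp_all
  obtain b where b: "b \<ge> 0" "\<And>x. norm (K x) \<le> b * norm x"
    using compact_operator_bounded[OF K] by blast
  define D where "D = nrm (bidual (sub_space scl E)) \<xi> + 1"
  interpret E': seminormed "dual (sub_space scl E)" by (rule E.seminormed_dual)
  have D: "D > 0" using E'.dual_nrm_nonneg[OF \<xi>] by (simp add: D_def)
  define r where "r h = (\<lambda>x\<in>E. h (K x))" for h :: "'z \<Rightarrow> 'k"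
  have r: "r h \<in> carr (dual (sub_space scl E))" if h: "h \<in> carr (dual Z)" for h
  proof -
    have "norm (h (K x)) \<le> (nrm (dual Z) h * b) * norm x" for x
    proof -
      have "norm (h (K x)) \<le> nrm (dual Z) h * norm (K x)" using Z.dual_bound[OF h, of "K x"] by simp
      also have "\<dots> \<le> nrm (dual Z) h * (b * norm x)"
        using b Z.dual_nrm_nonneg[OF h] by (intro mult_left_mono)
      finally show ?thesis by (simp add: mult_ac)
    qed
    then have "restrict (\<lambda>x. h (K x)) (carr (sub_space scl E)) \<in> carr (dual (sub_space scl E))"
      using Z.dual_add[OF h] Z.dual_smul[OF h]
      by (intro E.dualI) (auto simp: K.add K.scale)
    then show ?thesis by (simp add: r_def carrE)
  qed
  \<comment> \<open>\<open>T\<close> contains \<open>K x\<close> for every \<open>x\<close> of norm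
    less than \<open>D\<close>, that is, for all vectors that \<open>goldstine\<close> can
    supply.\<close>
  define T where "T = (\<lambda>x. D *\<^sub>R x) ` closure (K ` cball 0 1)"
  have T: "compact T"
    unfolding T_def using K by (intro compact_continuous_image continuous_intros)
      (auto simp: compact_operator_def)
  define F where "F = (\<lambda>h. {k. h k = \<xi> (r h)}) ` carr (dual Z)"
  have "T \<inter> \<Inter>F \<noteq> {}"
  proof (rule compact_imp_fip[OF T])
    fix A assume "A \<in> F"
    then obtain h where h: "h \<in> carr (dual Z)" "A = {k. h k = \<xi> (r h)}" by (auto simp: F_def)
    have "continuous_on UNIV h" using bounded_linear_functional[OF h(1)] by (rule linear_continuous_on)
    then show "closed A" unfolding h(2) by (intro closed_Collect_eq continuous_intros)
  next
    fix F' assume "finite F'" "F' \<subseteq> F"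
    then obtain \<Phi> where \<Phi>: "\<Phi> \<subseteq> carr (dual Z)" "finite \<Phi>" "F' = (\<lambda>h. {k. h k = \<xi> (r h)}) ` \<Phi>"
      unfolding F_def by (meson finite_subset_image)
    obtain x where x: "x \<in> E" "norm x < D" "\<And>h. h \<in> \<Phi> \<Longrightarrow> r h x = \<xi> (r h)"
    proof -
      have "r ` \<Phi> \<subseteq> carr (dual (sub_space scl E))" using \<Phi>(1) r by blast
      then show thesis
        using E.goldstine[OF \<xi>, of D "r ` \<Phi>"] \<Phi>(2) that by (auto simp: D_def carrE)
    qed
    have "scl (of_real (1 / D)) x \<in> cball 0 1"
      using x(2) D by (simp add: norm_scl norm_divide)
    then have "K (scl (of_real (1 / D)) x) \<in> closure (K ` cball 0 1)"
      by (intro subsetD[OF closure_subset] imageI)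
    then have "D *\<^sub>R K (scl (of_real (1 / D)) x) \<in> T" unfolding T_def by (rule imageI)
    moreover have "D *\<^sub>R K (scl (of_real (1 / D)) x) = K x"
      using D by (simp add: K.scale flip: scl_of_real)
    moreover have "h (K x) = \<xi> (r h)" if "h \<in> \<Phi>" for h
      using x(3)[OF that] x(1) by (simp add: r_def)
    ultimately show "T \<inter> \<Inter>F' \<noteq> {}" using \<Phi>(3) by auto
  qed
  then show ?thesis by (auto simp: F_def r_def)
qed

text \<open>On the unit ball the partial sums stay in a compact set and the remainders are bounded
  uniformly by the tail of a convergent series, so the image is totally bounded.\<close>

lemma compact_operator_nuclear:
  assumes h: "\<And>n. h n \<in> carr (dual Z)" and hc: "\<And>n x. norm (h n x) \<le> c n * norm x"
    and c: "\<And>n. c n \<ge> 0" and sm: "summable (\<lambda>n. c n * norm (w n))"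
  shows "compact_operator scl (\<lambda>x. \<Sum>n. scl (h n x) (w n))"
    and "summable (\<lambda>n. scl (h n x) (w n))"
proof -
  define K where "K x = (\<Sum>n. scl (h n x) (w n))" for x
  have le: "norm (scl (h n x) (w n)) \<le> norm x * (c n * norm (w n))" for n x
    using mult_right_mono[OF hc norm_ge_zero, of n x "w n"] by (simp add: norm_scl mult_ac)
  have summ: "summable (\<lambda>n. scl (h n x) (w n))" for x
    by (rule summable_comparison_test'[OF summable_mult[OF sm]]) (rule le)
  then show "summable (\<lambda>n. scl (h n x) (w n))" .
  have add: "K (x + y) = K x + K y" for x y
    using Z.dual_add[OF h] by (simp add: K_def suminf_add[OF summ summ] scale_left_distrib)
  have scale: "K (scl a x) = scl a (K x)" for a x
    using Z.dual_smul[OF h] bounded_linear.suminf[OF bounded_linear_scl_right summ, of a x]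
    by (simp add: K_def)
  have lin: "Vector_Spaces.linear scl scl K"
    by unfold_locales (auto simp: add scale)
  \<comment> \<open>The coefficients range over all scalars within the bounds \<open>c n\<close>, so
    \<open>A m\<close> is built up from compact sets by sums and contains the partial sums of the
    whole unit ball.\<close>
  define A where "A m = {(\<Sum>n<m. scl (a n) (w n)) | a. \<forall>n. norm (a n) \<le> c n}" for m
  have A: "compact (A m)" for m
  proof (induction m)
    case 0
    have "A 0 = {0}" using c by (auto simp: A_def intro!: exI[of _ "\<lambda>_. 0"])
    then show ?case by simp
  next
    case (Suc m)
    let ?B = "(\<lambda>a. scl a (w m)) ` cball 0 (c m)"
    have "compact ?B"
      by (intro compact_continuous_image compact_cball_scalar linear_continuous_on bounded_linear_scl_left)
    then have "compact {x + y | x y. x \<in> A m \<and> y \<in> ?B}" by (intro compact_sums Suc)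
    moreover have "A (Suc m) = {x + y | x y. x \<in> A m \<and> y \<in> ?B}"
    proof (intro equalityI subsetI)
      fix v assume "v \<in> A (Suc m)"
      then show "v \<in> {x + y | x y. x \<in> A m \<and> y \<in> ?B}" by (fastforce simp: A_def)
    next
      fix v assume "v \<in> {x + y | x y. x \<in> A m \<and> y \<in> ?B}"
      then obtain a b where ab: "\<forall>n. norm (a n) \<le> c n" "norm b \<le> c m"
        "v = (\<Sum>n<m. scl (a n) (w n)) + scl b (w m)" by (auto simp: A_def)
      have "(\<Sum>n<m. scl ((a(m := b)) n) (w n)) = (\<Sum>n<m. scl (a n) (w n))" by (intro sum.cong) auto
      then have "v = (\<Sum>n<Suc m. scl ((a(m := b)) n) (w n))" using ab(3) by simp
      moreover have "\<forall>n. norm ((a(m := b)) n) \<le> c n" using ab by auto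
      ultimately show "v \<in> A (Suc m)" unfolding A_def by blast
    qed
    ultimately show ?case by simp
  qed
  have "compact (closure (K ` cball 0 1))"
    unfolding compact_eq_totally_bounded
  proof (intro conjI allI impI)
    show "complete (closure (K ` cball 0 1))" by (simp add: complete_eq_closed)
    fix e :: real assume e: "e > 0"
    obtain m where m: "(\<Sum>n. c (n + m) * norm (w (n + m))) < e / 3"
    proof -
      have "(\<lambda>m. \<Sum>n. c (n + m) * norm (w (n + m))) \<longlonglongrightarrow> 0"
        by (rule suminf_exist_split2[OF sm])
      then have "\<forall>\<^sub>F m in sequentially. (\<Sum>n. c (n + m) * norm (w (n + m))) < e / 3"
        using e by (intro order_tendstoD(2)) auto
      then show thesis using that by (auto simp: eventually_sequentially)
    qed
    obtain k where k: "finite k" "A m \<subseteq> (\<Union>x\<in>k. ball x (e / 3))"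
      using A[of m] e unfolding compact_eq_totally_bounded by (meson divide_pos_pos zero_less_numeral)
    \<comment> \<open>One third of \<open>e\<close> is spent on covering \<open>A m\<close> and one
      on the tail. Closed balls survive the passage to the closure, and the last third makes them
      open balls of radius \<open>e\<close>.\<close>
    have "K ` cball 0 1 \<subseteq> (\<Union>x\<in>k. cball x (2 * e / 3))"
    proof
      fix v assume "v \<in> K ` cball 0 1"
      then obtain x where x: "norm x \<le> 1" "v = K x" by auto
      have "c n * norm x \<le> c n" for n using x(1) c[of n] by (simp add: mult_left_le)
      then have "norm (h n x) \<le> c n" for n using hc order_trans by blast
      then have "(\<Sum>n<m. scl (h n x) (w n)) \<in> A m" by (auto simp: A_def)
      then obtain y where y: "y \<in> k" "dist y (\<Sum>n<m. scl (h n x) (w n)) < e / 3" using k(2) by auto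
      have sm': "summable (\<lambda>n. c (n + m) * norm (w (n + m)))" using sm by (rule summable_ignore_initial_segment)
      have "K x - (\<Sum>n<m. scl (h n x) (w n)) = (\<Sum>n. scl (h (n + m) x) (w (n + m)))"
        using suminf_minus_initial_segment[OF summ[of x], of m] by (simp add: K_def)
      moreover have "norm (\<Sum>n. scl (h (n + m) x) (w (n + m))) \<le> (\<Sum>n. c (n + m) * norm (w (n + m)))"
      proof (rule norm_suminf_le[OF _ sm'])
        fix n
        have "c (n + m) * norm (w (n + m)) \<ge> 0" using c by simp
        then have "norm x * (c (n + m) * norm (w (n + m))) \<le> 1 * (c (n + m) * norm (w (n + m)))"
          using x(1) by (intro mult_right_mono)
        then show "norm (scl (h (n + m) x) (w (n + m))) \<le> c (n + m) * norm (w (n + m))"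
          using le[of "n + m" x] by simp
      qed
      ultimately have "dist (\<Sum>n<m. scl (h n x) (w n)) (K x) < e / 3"
        using m by (simp add: dist_norm norm_minus_commute)
      then have "dist y v \<le> 2 * e / 3" using y(2) dist_triangle[of y v "\<Sum>n<m. scl (h n x) (w n)"]
        by (simp add: x(2))
      then show "v \<in> (\<Union>x\<in>k. cball x (2 * e / 3))" using y(1) by auto
    qed
    then have "closure (K ` cball 0 1) \<subseteq> (\<Union>x\<in>k. cball x (2 * e / 3))"
      by (rule closure_minimal) (use k(1) in auto)
    also have "\<dots> \<subseteq> (\<Union>x\<in>k. ball x e)" using e by (intro UN_mono) auto
    finally show "\<exists>k. finite k \<and> closure (K ` cball 0 1) \<subseteq> (\<Union>x\<in>k. ball x e)" using k(1) by blast
  qed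
  then show "compact_operator scl (\<lambda>x. \<Sum>n. scl (h n x) (w n))"
    using lin by (simp add: compact_operator_def K_def[abs_def])
qed

end

section \<open>Functionals on subspaces and the operators attached to a pair\<close>

context banach_space_over
begin

lemma compact_operator_continuous:
  assumes "compact_operator scl K" shows "continuous_on UNIV K"
proof -
  interpret K: Vector_Spaces.linear scl scl K using assms by (simp add: compact_operator_def)
  obtain b where b: "\<And>x. norm (K x) \<le> b * norm x"
    using compact_operator_bounded[OF assms] by blast
  have "bounded_linear K"
  proof (rule bounded_linear_intro)
    show "K (r *\<^sub>R x) = r *\<^sub>R K x" for r x by (metis K.scale scl_of_real)
    show "norm (K x) \<le> norm x * b" for x using b[of x] by (simp add: mult.commute)
  qed (rule K.add)
  then show ?thesis by (rule linear_continuous_on)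
qed

lemma extend_functional:
  assumes A: "module.subspace scl A" and f: "f \<in> carr (dual (sub_space scl A))"
    and c: "nrm (dual (sub_space scl A)) f \<le> c"
  shows "\<exists>h\<in>carr (dual Z). (\<forall>x\<in>A. h x = f x) \<and> (\<forall>x. norm (h x) \<le> c * norm x)"
proof -
  interpret A: seminormed "sub_space scl A" using A by (rule seminormed_sub_space)
  have c0: "c \<ge> 0" using c A.dual_nrm_nonneg[OF f] by linarith
  define G where "G = {(x, f x) | x. x \<in> A}"
  obtain h where h: "h \<in> carr (dual Z)" "\<And>v c. (v, c) \<in> G \<Longrightarrow> h v = c"
    "\<And>x. x \<in> carr Z \<Longrightarrow> norm (h x) \<le> c * nrm Z x"
  proof (rule Z.hahn_banach[of G c])
    show "G \<noteq> {}" using A.carr_nonempty by (auto simp: G_def)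
    show "norm k \<le> c * nrm Z v" if "(v, k) \<in> G" for v k
      using that A.dual_nrm_ge[OF f _ c, of v] by (auto simp: G_def)
    show "(add Z v w, k + l) \<in> G" if "(v, k) \<in> G" "(w, l) \<in> G" for v k w l
      using that A.dual_add[OF f, of v w] A.add_closed[of v w] by (auto simp: G_def)
    show "(smul Z a v, a * k) \<in> G" if "(v, k) \<in> G" for v k a
      using that A.dual_smul[OF f, of v a] A.smul_closed[of v a] by (auto simp: G_def)
  qed (use c0 in auto)
  show ?thesis
  proof (intro bexI[OF _ h(1)] conjI ballI allI)
    show "h x = f x" if "x \<in> A" for x using h(2)[of x "f x"] that by (auto simp: G_def)
    show "norm (h x) \<le> c * norm x" for x using h(3)[of x] by simp
  qed
qed

lemma restrict_functional:
  assumes A: "module.subspace scl A" and B: "module.subspace scl B" "A \<subseteq> B"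
    and f: "f \<in> carr (dual (sub_space scl B))"
  shows "restrict f A \<in> carr (dual (sub_space scl A))"
    and "nrm (dual (sub_space scl A)) (restrict f A) \<le> nrm (dual (sub_space scl B)) f"
proof -
  interpret A: seminormed "sub_space scl A" using A by (rule seminormed_sub_space)
  interpret B: seminormed "sub_space scl B" using B(1) by (rule seminormed_sub_space)
  have fb: "norm (f x) \<le> nrm (dual (sub_space scl B)) f * norm x" if "x \<in> A" for x
    using B.dual_bound[OF f, of x] that B(2) by auto
  have "restrict f (carr (sub_space scl A)) \<in> carr (dual (sub_space scl A))"
  proof (rule A.dualI)
    show "f (add (sub_space scl A) x y) = f x + f y"
      if "x \<in> carr (sub_space scl A)" "y \<in> carr (sub_space scl A)" for x y
      using B.dual_add[OF f, of x y] that B(2) by auto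
    show "f (smul (sub_space scl A) c x) = c * f x" if "x \<in> carr (sub_space scl A)" for c x
      using B.dual_smul[OF f, of x c] that B(2) by auto
  qed (use fb in auto)
  then show "restrict f A \<in> carr (dual (sub_space scl A))" by simp
  show "nrm (dual (sub_space scl A)) (restrict f A) \<le> nrm (dual (sub_space scl B)) f"
    using fb B.dual_nrm_nonneg[OF f] by (intro A.dual_nrm_le) auto
qed

lemma quot_map_operator:
  assumes "closed_subspace scl A" "closed_subspace scl B"
  shows "operator (sub_space scl A) (quot_space scl B) (quot_map B) 1"
proof -
  interpret A: closed_sub scl A by unfold_locales (rule assms)
  interpret B: closed_sub scl B by unfold_locales (rule assms)
  show ?thesis
    by unfold_locales (auto simp: bounded_op_def B.Q_add B.Q_smul B.Q_nrm)
qed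

lemma inclusion_operator:
  assumes "module.subspace scl A" "module.subspace scl B" "A \<subseteq> B"
  shows "operator (sub_space scl A) (sub_space scl B) (\<lambda>x. x) 1"
  unfolding operator_def operator_axioms_def bounded_op_def
  using assms seminormed_sub_space by auto

lemma UNIV_closed_subspace: "closed_subspace scl UNIV"
  by (simp add: closed_subspace_def subspace_UNIV)

text \<open>Since a ball around \<open>x\<close> misses \<open>E\<close>, the coset of
  \<open>x\<close> in \<open>Z/E\<close> has positive norm. A norming functional of that coset is
  pulled back along the quotient map.\<close>

lemma separate_point:
  assumes E: "closed_subspace scl E" and x: "x \<notin> E"
  obtains f where "f \<in> carr (dual Z)" "\<And>e. e \<in> E \<Longrightarrow> f e = 0" "f x \<noteq> 0"
proof -
  interpret E: closed_sub scl E by unfold_locales (rule E)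
  interpret Q: operator Z "quot_space scl E" "quot_map E" 1
    by (rule quot_map_operator[OF UNIV_closed_subspace E])
  obtain \<delta> where \<delta>: "\<delta> > 0" "ball x \<delta> \<subseteq> - E"
    using E.closed x by (metis ComplI open_Compl open_contains_ball)
  have "\<delta> \<le> nrm (quot_space scl E) (quot_map E x)"
  proof (rule E.Q_nrm_ge)
    fix v assume "v - x \<in> E"
    then have "x - v \<in> E" using E.uminus by fastforce
    then have "x - v \<notin> ball x \<delta>" using \<delta>(2) by blast
    then show "\<delta> \<le> norm v" by (simp add: dist_norm)
  qed
  then have pos: "nrm (quot_space scl E) (quot_map E x) \<noteq> 0" using \<delta>(1) by linarith
  obtain g where g: "g \<in> carr (dual (quot_space scl E))"
    "g (quot_map E x) = of_real (nrm (quot_space scl E) (quot_map E x))"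
    using E.quot.norming[OF E.Q_carr] by blast
  show thesis
  proof (rule that[OF Q.conj_carr[OF g(1)]])
    show "Q.S' g e = 0" if "e \<in> E" for e
    proof -
      have "quot_map E e = smul (quot_space scl E) 0 (quot_map E e)"
        using that E.zero by (simp add: E.Q_smul E.Q_eq_iff)
      then show ?thesis using g(1) E.quot.dual_smul[OF g(1), of "quot_map E e" 0] by simp
    qed
    show "Q.S' g x \<noteq> 0" using g pos by simp
  qed
qed

lemma closed_subspace_kernel:
  assumes M: "closed_subspace scl M" and N: "closed_subspace scl N" and K: "compact_operator scl K"
  shows "closed_subspace scl {x \<in> M. x - K x \<in> N}"
proof -
  interpret M: closed_sub scl M by unfold_locales (rule M)
  interpret N: closed_sub scl N by unfold_locales (rule N)
  interpret K: Vector_Spaces.linear scl scl K using K by (simp add: compact_operator_def)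
  have "x + y - K (x + y) \<in> N" if "x - K x \<in> N" "y - K y \<in> N" for x y
    using N.sum[OF that] by (simp add: K.add algebra_simps)
  moreover have "scl c x - K (scl c x) \<in> N" if "x - K x \<in> N" for c x
    using N.scl[OF that, of c] by (simp add: K.scale scale_right_diff_distrib)
  ultimately have "module.subspace scl {x \<in> M. x - K x \<in> N}"
    using M.zero M.sum M.scl N.zero by (auto simp: subspace_iff K.zero)
  moreover have "closed ((\<lambda>x. x - K x) -` N)"
    using compact_operator_continuous[OF K] N.closed
    by (intro closed_vimage continuous_intros) auto
  then have "closed (M \<inter> (\<lambda>x. x - K x) -` N)" using M.closed by blast
  then have "closed {x \<in> M. x - K x \<in> N}" by (simp add: Int_def vimage_def)
  ultimately show ?thesis by (simp add: closed_subspace_def)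
qed

section \<open>Tauberian pairs\<close>

text \<open>A non-canonical \<open>\<xi>\<close> on \<open>E\<close> is pushed forward to
  \<open>z\<close> on \<open>M\<close>. On \<open>E\<close> the map \<open>quot_map N\<close> agrees
  with \<open>quot_map N o K\<close>, so the second conjugate sends \<open>z\<close> to the coset of
  the point \<open>k\<close> that represents the action of \<open>K\<close> on
  \<open>\<xi>\<close>.\<close>

lemma tauberian_if:
  assumes M: "closed_subspace scl M" and N: "closed_subspace scl N"
    and K: "compact_operator scl K" and E: "closed_subspace scl E"
    and nr: "\<not> reflexive (sub_space scl E)" and EM: "E \<subseteq> M" and KE: "(\<lambda>x. x - K x) ` E \<subseteq> N"
  shows "\<not> tauberian_pair scl M N"
proof -
  interpret M: closed_sub scl M by unfold_locales (rule M)
  interpret N: closed_sub scl N by unfold_locales (rule N)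
  interpret E: closed_sub scl E by unfold_locales (rule E)
  interpret S: operator "sub_space scl M" "quot_space scl N" "quot_map N" 1
    by (rule quot_map_operator[OF M N])
  interpret Q: operator Z "quot_space scl N" "quot_map N" 1
    by (rule quot_map_operator[OF UNIV_closed_subspace N])
  interpret J: operator "sub_space scl E" "sub_space scl M" "\<lambda>x. x" 1
    using E.subspace M.subspace EM by (rule inclusion_operator)
  interpret J': operator "dual (sub_space scl M)" "dual (sub_space scl E)" J.S' 1
    by (rule J.conj_operator)
  obtain \<xi> where \<xi>: "\<xi> \<in> carr (bidual (sub_space scl E))" "\<xi> \<notin> canonical_image (sub_space scl E)"
    using nr E.sub.not_reflexive_iff by blast
  have J_apply: "J.S' g = restrict g E" if "g \<in> carr (dual (sub_space scl M))" for g
    using that by (simp add: conj_op_def restrict_def)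
  obtain k where k: "\<And>h. h \<in> carr (dual Z) \<Longrightarrow> \<xi> (\<lambda>x\<in>E. h (K x)) = h k"
    using compact_operator_bidual[OF K E.subspace \<xi>(1)] by blast
  define z where "z = J'.S' \<xi>"
  have z: "z \<in> carr (bidual (sub_space scl M))" unfolding z_def using \<xi>(1) by (rule J'.conj_carr)
  have z_apply: "z g = \<xi> (restrict g E)" if "g \<in> carr (dual (sub_space scl M))" for g
    using that \<xi>(1) J_apply by (simp add: z_def)
  have zk: "z (S.S' g) = g (quot_map N k)" if g: "g \<in> carr (dual (quot_space scl N))" for g
  proof -
    have "quot_map N x = quot_map N (K x)" if "x \<in> E" for x
      using KE that by (auto simp: N.Q_eq_iff)
    then have "restrict (S.S' g) E = (\<lambda>x\<in>E. Q.S' g (K x))"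
      using EM g by (intro restrict_ext) auto
    then show ?thesis using z_apply[OF S.conj_carr[OF g]] k[OF Q.conj_carr[OF g]] g by simp
  qed
  \<comment> \<open>If \<open>z\<close> were evaluation at some \<open>x\<close> in
    \<open>M\<close>, functionals vanishing on \<open>E\<close> would vanish at \<open>x\<close>, so
    \<open>x\<close> would lie in \<open>E\<close>. Extending functionals from \<open>E\<close> to
    the whole space then makes \<open>\<xi>\<close> evaluation at \<open>x\<close>.\<close>
  have "z \<notin> canonical_image (sub_space scl M)"
  proof
    assume "z \<in> canonical_image (sub_space scl M)"
    then obtain x where x: "x \<in> M" "z = canon (sub_space scl M) x" by (auto simp: canonical_image_canon)
    have fx: "f x = \<xi> (restrict f E)" if f: "f \<in> carr (dual Z)" for f
    proof -
      have "restrict f M \<in> carr (dual (sub_space scl M))"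
        using restrict_functional(1)[OF M.subspace _ _ f] by (simp add: subspace_UNIV)
      moreover have "restrict (restrict f M) E = restrict f E"
        using EM by (auto simp: restrict_def fun_eq_iff)
      ultimately show ?thesis using z_apply[of "restrict f M"] x by simp
    qed
    have "x \<in> E"
    proof (rule ccontr)
      assume "x \<notin> E"
      then obtain f where f: "f \<in> carr (dual Z)" "\<And>e. e \<in> E \<Longrightarrow> f e = 0" "f x \<noteq> 0"
        using separate_point[OF E] by blast
      have fE: "restrict f E \<in> carr (dual (sub_space scl E))"
        using restrict_functional(1)[OF E.subspace _ _ f(1)] by (simp add: subspace_UNIV)
      have "restrict f E = smul (dual (sub_space scl E)) 0 (restrict f E)"
        using f(2) fE by (intro E.sub.dual_ext) (auto simp: E.sub.dual_smul_apply)
      then have "\<xi> (restrict f E) = 0 * \<xi> (restrict f E)"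
        using J'.Y.dual_smul[OF \<xi>(1) fE, of 0] by metis
      then show False using fx[OF f(1)] f(3) by simp
    qed
    moreover have "\<xi> = canon (sub_space scl E) x"
    proof (rule J'.Y.dual_ext[OF \<xi>(1)])
      show "canon (sub_space scl E) x \<in> carr (bidual (sub_space scl E))"
        using \<open>x \<in> E\<close> by (intro E.sub.canon_in_bidual) simp
      fix g assume g: "g \<in> carr (dual (sub_space scl E))"
      obtain h where h: "h \<in> carr (dual Z)" "\<forall>x\<in>E. h x = g x"
        using extend_functional[OF E.subspace g order_refl] by (elim bexE conjE)
      have "g \<in> extensional E" using g by (simp add: dual_def)
      then have "restrict h E = g"
        by (intro extensionalityI[of _ E]) (simp_all add: h(2)[rule_format])
      then show "\<xi> g = canon (sub_space scl E) x g"
        using fx[OF h(1)] bspec[OF h(2) \<open>x \<in> E\<close>] g by simp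
    qed
    ultimately show False using \<xi>(2) by (simp add: canonical_image_canon)
  qed
  then have "z \<in> carr (bidual (sub_space scl M)) - canonical_image (sub_space scl M)" using z by simp
  then show ?thesis unfolding tauberian_pair_def S.not_tauberian_iff
    by (intro bexI[of _ z] bexI[of _ "quot_map N k"] ballI zk) auto
qed

lemma tauberian_only_if:
  assumes M: "closed_subspace scl M" and N: "closed_subspace scl N"
    and nt: "\<not> tauberian_pair scl M N"
  shows "\<exists>K E. compact_operator scl K \<and> closed_subspace scl E \<and>
    \<not> reflexive (sub_space scl E) \<and> E \<subseteq> M \<and> (\<lambda>x. x - K x) ` E \<subseteq> N"
proof -
  interpret M: closed_sub scl M by unfold_locales (rule M)
  interpret N: closed_sub scl N by unfold_locales (rule N)
  interpret S: operator "sub_space scl M" "quot_space scl N" "quot_map N" 1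
    by (rule quot_map_operator[OF M N])
  let ?X = "sub_space scl M" and ?Y = "quot_space scl N" and ?Q = "quot_map N"
  obtain z y where z': "z \<in> carr (bidual ?X) - canonical_image ?X" and y: "y \<in> carr ?Y"
    and zy': "\<forall>g\<in>carr (dual ?Y). z (S.S' g) = g y"
    using nt unfolding tauberian_pair_def S.not_tauberian_iff by (elim bexE)
  have z: "z \<in> carr (bidual ?X)" "z \<notin> canonical_image ?X" using z' by auto
  note zy = bspec[OF zy']
  obtain y0 where y0: "y = ?Q y0" using y by (auto simp: N.carr_quot)
  obtain d where d: "M.sub.far z d" using M.sub.complete_far[OF M.complete_sub z] .
  have d0: "d > 0" using d by (simp add: M.sub.far_def)
  interpret X': seminormed "dual ?X" by (rule M.sub.seminormed_dual)
  define C where "C = nrm (bidual ?X) z + 1"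
  have C: "C > 0" using X'.dual_nrm_nonneg[OF z(1)] by (simp add: C_def)
  \<comment> \<open>At stage \<open>n\<close> first \<open>f\<close> is chosen with
    \<open>z f = 1\<close> and zeros at all earlier points. Then \<open>helly\<close> gives
    \<open>x\<close> at which the new and all earlier functionals take their
    \<open>z\<close>-values, namely 1.\<close>
  define P where "P t n r \<longleftrightarrow> (case r of (x, f) \<Rightarrow> x \<in> M \<and> norm x < C \<and> f \<in> carr (dual ?X) \<and>
      nrm (dual ?X) f \<le> 1 / d \<and> z f = 1 \<and> (\<forall>m<n. f (fst (t m)) = 0) \<and> (\<forall>m<n. snd (t m) x = 1) \<and>
      f x = 1 \<and> nrm ?Y (?Q (x - y0)) < (1 / 2) ^ n)"
    for t :: "nat \<Rightarrow> 'z \<times> ('z \<Rightarrow> 'k)" and n r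
  have "\<exists>t. \<forall>n. P t n (t n)"
  proof (rule dependent_wellorder_choice)
    show "P f n r = P g n r" if "\<And>m. m < n \<Longrightarrow> f m = g m" for r f g n
      using that by (simp add: P_def)
  next
    fix n t assume IH: "\<And>m. m < n \<Longrightarrow> P t m (t m)"
    have t: "fst (t m) \<in> M" "snd (t m) \<in> carr (dual ?X)" "z (snd (t m)) = 1" if "m < n" for m
      using IH[OF that] by (auto simp: P_def split: prod.splits)
    obtain f where f: "f \<in> carr (dual ?X)" "\<forall>a\<in>(\<lambda>m. fst (t m)) ` {..<n}. f a = 0"
      "z f = 1" "nrm (dual ?X) f \<le> 1 / d"
      using M.sub.far_functional[OF z(1) d, of "(\<lambda>m. fst (t m)) ` {..<n}"] t(1) by auto
    obtain x where x: "x \<in> M" "norm x < C" "\<forall>\<phi>\<in>insert f ((\<lambda>m. snd (t m)) ` {..<n}). \<phi> x = z \<phi>"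
      "nrm ?Y (N.quot.minus (?Q x) (?Q y0)) < (1 / 2) ^ n"
      using S.helly[OF z(1) _ y zy, of C "insert f ((\<lambda>m. snd (t m)) ` {..<n})" "(1 / 2) ^ n"] t(2) f(1)
      by (auto simp: C_def y0)
    have "P t n (x, f)"
      using x f t(3) by (auto simp: P_def N.Q_minus)
    then show "\<exists>r. P t n r" ..
  qed
  then obtain t where t: "\<And>n. P t n (t n)" by blast
  define x where "x n = fst (t n)" for n
  define f where "f n = snd (t n)" for n
  have x: "x n \<in> M" "norm (x n) < C" "nrm ?Y (?Q (x n - y0)) < (1 / 2) ^ n"
    and f: "f n \<in> carr (dual ?X)" "nrm (dual ?X) (f n) \<le> 1 / d" for n
    using t[of n] by (auto simp: P_def x_def f_def split: prod.splits)
  have fx: "f i (x j) = (if i \<le> j then 1 else 0)" for i j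
    using t[of i] t[of j] by (auto simp: P_def x_def f_def split: prod.splits simp: not_le le_less)
  \<comment> \<open>Consecutive points are both close to \<open>y0\<close> modulo \<open>N\<close>,
    so their difference is close to \<open>N\<close>; \<open>(1 / 2) ^ Suc n + (1 / 2) ^ n\<close>
    is below the stated bound.\<close>
  have "\<exists>v. v - (x (Suc n) - x n) \<in> N \<and> norm v < 2 * (1 / 2) ^ n" for n
  proof -
    have "nrm ?Y (?Q (x (Suc n) - x n)) \<le> nrm ?Y (?Q (x (Suc n) - y0)) + nrm ?Y (?Q (y0 - x n))"
      using N.quot.nrm_add[of "?Q (x (Suc n) - y0)" "?Q (y0 - x n)"] by (simp add: N.Q_add)
    also have "?Q (y0 - x n) = smul ?Y (- 1) (?Q (x n - y0))"
      by (simp add: N.Q_smul)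
    also have "nrm ?Y \<dots> = nrm ?Y (?Q (x n - y0))" by (subst N.quot.nrm_smul) auto
    also have "nrm ?Y (?Q (x (Suc n) - y0)) + \<dots> < (1 / 2) ^ Suc n + (1 / 2) ^ n"
      using x(3) by (rule add_strict_mono) (rule x(3))
    also have "\<dots> \<le> 2 * (1 / 2) ^ n" by simp
    finally obtain v where "v - (x (Suc n) - x n) \<in> N" "norm v < 2 * (1 / 2) ^ n"
      by (rule N.Q_nrm_less)
    then show ?thesis by blast
  qed
  then obtain w where w: "\<And>n. w n - (x (Suc n) - x n) \<in> N" "\<And>n. norm (w n) < 2 * (1 / 2) ^ n"
    by metis
  have "\<exists>h. h \<in> carr (dual Z) \<and> (\<forall>x\<in>M. h x = f (Suc n) x) \<and> (\<forall>x. norm (h x) \<le> 1 / d * norm x)" for n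
    using extend_functional[OF M.subspace f(1) f(2)] by (simp add: Bex_def)
  then obtain h where h: "\<And>n. h n \<in> carr (dual Z)" "\<And>n x. x \<in> M \<Longrightarrow> h n x = f (Suc n) x"
    "\<And>n x. norm (h n x) \<le> 1 / d * norm x" by metis
  have "summable (\<lambda>n. 1 / d * norm (w n))"
  proof (rule summable_mult, rule summable_comparison_test')
    show "summable (\<lambda>n. 2 * (1 / 2 :: real) ^ n)" by (intro summable_mult summable_geometric) auto
    show "norm (norm (w n)) \<le> 2 * (1 / 2) ^ n" for n using w(2)[of n] by simp
  qed
  note nuc = compact_operator_nuclear[of h "\<lambda>_. 1 / d", OF h(1,3) _ this]
  define K where "K x = (\<Sum>n. scl (h n x) (w n))" for x
  have K: "compact_operator scl K" unfolding K_def[abs_def] using d0 by (intro nuc) auto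
  have Ku: "K (x (Suc m) - x m) = w m" for m
  proof -
    \<comment> \<open>The shift to \<open>f (Suc n)\<close> matters: its values jump from 0 to 1
      exactly between \<open>x n\<close> and \<open>x (Suc n)\<close>, so it is biorthogonal to the
      differences.\<close>
    have "h n (x (Suc m) - x m) = (if n = m then 1 else 0)" for n
      using h(2)[of "x (Suc m) - x m" n] M.diff[OF x(1) x(1), of "Suc m" m]
        M.sub.dual_minus[OF f(1), of "x (Suc m)" "x m" "Suc n"] x(1)
      by (simp add: fx M.sub.minus_def)
    then have "K (x (Suc m) - x m) = (\<Sum>n. if n = m then w m else 0)"
      unfolding K_def by (intro arg_cong[where f = suminf] ext) auto
    then show ?thesis using sums_unique[OF sums_single[of m "\<lambda>_. w m"]] by simp
  qed
  define E where "E = {x \<in> M. x - K x \<in> N}"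
  have E: "closed_subspace scl E" unfolding E_def by (rule closed_subspace_kernel[OF M N K])
  interpret E: closed_sub scl E by unfold_locales (rule E)
  \<comment> \<open>Since \<open>K\<close> sends each difference to its \<open>w\<close>, the
    difference minus its image lies in \<open>N\<close>. The differences are therefore in
    \<open>E\<close>, and they telescope.\<close>
  have yE: "x j - x 0 \<in> E" for j
  proof (induction j)
    case 0 then show ?case using E.zero by simp
  next
    case (Suc j)
    have u: "x (Suc j) - x j \<in> E"
      using w(1)[of j] N.uminus[OF w(1)[of j]] M.diff[OF x(1) x(1)] by (simp add: E_def Ku)
    show ?case using E.sum[OF Suc u] by simp
  qed
  have EM: "E \<subseteq> M" by (auto simp: E_def)
  \<comment> \<open>Subtracting \<open>x 0\<close> does not disturb the triangular pattern, because
    every \<open>f (Suc i)\<close> vanishes at \<open>x 0\<close>. The two iterated limits are 1 and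
    0.\<close>
  have "\<not> reflexive (sub_space scl E)"
  proof (rule E.sub.double_limit_not_reflexive)
    show "x j - x 0 \<in> carr (sub_space scl E)" for j using yE by simp
    show "restrict (f (Suc i)) E \<in> carr (dual (sub_space scl E))" for i
      by (rule restrict_functional(1)[OF E.subspace M.subspace EM f(1)])
    show "nrm (dual (sub_space scl E)) (restrict (f (Suc i)) E) \<le> 1 / d" for i
      by (rule order_trans[OF restrict_functional(2)[OF E.subspace M.subspace EM f(1)] f(2)])
    show "norm (g (x j - x 0)) \<le> (2 * C) * nrm (dual (sub_space scl E)) g"
      if g: "g \<in> carr (dual (sub_space scl E))" for j g
    proof -
      have "norm (g (x j - x 0)) \<le> nrm (dual (sub_space scl E)) g * norm (x j - x 0)"
        using E.sub.dual_bound[OF g, of "x j - x 0"] yE by simp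
      also have "\<dots> \<le> nrm (dual (sub_space scl E)) g * (2 * C)"
        using norm_triangle_ineq4[of "x j" "x 0"] x(2)[of j] x(2)[of 0] E.sub.dual_nrm_nonneg[OF g]
        by (intro mult_left_mono) auto
      finally show ?thesis by (simp add: mult.commute)
    qed
    have v: "restrict (f (Suc i)) E (x j - x 0) = (if Suc i \<le> j then 1 else 0)" for i j
      using yE[of j] M.sub.dual_minus[OF f(1), of "x j" "x 0" "Suc i"] x(1)
      by (simp add: fx M.sub.minus_def)
    show "(\<lambda>j. restrict (f (Suc i)) E (x j - x 0)) \<longlonglongrightarrow> 1" for i
      unfolding v by (rule tendsto_eventually, rule eventually_sequentiallyI[of "Suc i"]) auto
    show "(\<lambda>i. restrict (f (Suc i)) E (x j - x 0)) \<longlonglongrightarrow> 0" for j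
      unfolding v by (rule tendsto_eventually, rule eventually_sequentiallyI[of j]) auto
  qed (use C d0 in auto)
  then show ?thesis using K E EM by (intro exI[of _ K] exI[of _ E]) (auto simp: E_def)
qed

end

section \<open>Cotauberian pairs\<close>

context operator
begin

text \<open>
  The third dual of \<open>Y\<close> splits into \<open>Y\<^sup>*\<close> and the annihilator of \<open>Y\<close>; \<open>z\<close> is moved into the latter.
\<close>

lemma not_cotauberian:
  assumes "\<not> cotauberian X Y S"
  shows "\<exists>z\<in>carr (bidual (dual Y)) - canonical_image (dual Y). (\<forall>q\<in>carr Y. z (canon Y q) = 0) \<and>
    (\<forall>g\<in>carr (bidual X). z (conj_op (dual Y) (dual X) S' g) = 0)"
proof -
  interpret D: operator "dual Y" "dual X" S' C by (rule conj_operator)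
  interpret DD: operator "bidual X" "bidual Y" D.S' C by (rule D.conj_operator)
  interpret DY: seminormed "bidual (dual Y)" by (rule DD.Y.seminormed_dual)
  obtain z y where z': "z \<in> carr (bidual (dual Y)) - canonical_image (dual Y)"
    and y: "y \<in> carr (dual X)" and zy': "\<forall>g\<in>carr (bidual X). z (D.S' g) = g y"
    using assms unfolding cotauberian_def D.not_tauberian_iff by (elim bexE)
  have z: "z \<in> carr (bidual (dual Y))" "z \<notin> canonical_image (dual Y)" using z' by auto
  note zy = bspec[OF zy']
  interpret can: operator Y "bidual Y" "canon Y" 1 by (rule Y.canon_operator)
  define w where "w = can.S' z"
  have w: "w \<in> carr (dual Y)" unfolding w_def using z(1) by (rule can.conj_carr)
  define z1 where "z1 = DY.minus z (canon (dual Y) w)"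
  have cw: "canon (dual Y) w \<in> carr (bidual (dual Y))" using w by (rule D.X.canon_in_bidual)
  have z1: "z1 \<in> carr (bidual (dual Y))" using z(1) cw by (simp add: z1_def)
  have z1_apply: "z1 \<Psi> = z \<Psi> - \<Psi> w" if "\<Psi> \<in> carr (bidual Y)" for \<Psi>
    using that by (simp add: z1_def DY.minus_def DD.Y.dual_add_apply DD.Y.dual_smul_apply)
  have 0: "z1 (canon Y q) = 0" if "q \<in> carr Y" for q
    using that z1_apply[of "canon Y q"] w z(1) by (simp add: w_def)
  have nz1: "z1 \<notin> canonical_image (dual Y)"
  proof
    assume "z1 \<in> canonical_image (dual Y)"
    then obtain v where v: "v \<in> carr (dual Y)" "z1 = canon (dual Y) v" by (auto simp: canonical_image_canon)
    have "z = canon (dual Y) (add (dual Y) v w)"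
    proof (rule DD.Y.dual_ext[OF z(1)])
      show "canon (dual Y) (add (dual Y) v w) \<in> carr (bidual (dual Y))"
        using v w by (intro D.X.canon_in_bidual) simp
      show "z \<Psi> = canon (dual Y) (add (dual Y) v w) \<Psi>" if "\<Psi> \<in> carr (bidual Y)" for \<Psi>
        using z1_apply[OF that] v w that by (simp add: D.X.dual_add)
    qed
    then show False using z(2) v(1) w by (auto simp: canonical_image_canon)
  qed
  have y1: "z1 (D.S' g) = g (D.Y.minus y (S' w))" if g: "g \<in> carr (bidual X)" for g
    using z1_apply[OF D.conj_carr[OF g]] zy[OF g] g w y by (simp add: D.Y.dual_minus)
  \<comment> \<open>By \<open>y1\<close> the conjugate of \<open>D.S'\<close> maps \<open>z1\<close>
    to the point \<open>y - S' w\<close> of \<open>dual X\<close>. It vanishes at each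
    \<open>x\<close>, since \<open>z1\<close> kills the canonical image of \<open>S x\<close>; hence
    this point is zero.\<close>
  have "D.Y.minus y (S' w) x = 0" if x: "x \<in> carr X" for x
  proof -
    have "D.S' (canon X x) = canon Y (S x)"
      using x by (intro D.X.dual_ext) auto
    then show ?thesis using y1[OF X.canon_in_bidual[OF x]] 0[of "S x"] x y w by simp
  qed
  then have m0: "D.Y.minus y (S' w) = smul (dual X) 0 (D.Y.minus y (S' w))"
    using y w by (intro X.dual_ext) (auto simp: X.dual_smul_apply)
  have "z1 (D.S' g) = 0" if g: "g \<in> carr (bidual X)" for g
    using y1[OF g] D.Y.dual_smul[OF g, of "D.Y.minus y (S' w)" 0] m0 y w by simp
  then show ?thesis using z1 nz1 0 by (intro bexI[of _ z1]) auto
qed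

end

context closed_sub
begin

text \<open>Every representative \<open>v\<close> of a coset gives the same value
  \<open>h v\<close>, so the bound by \<open>norm v\<close> passes to the infimum and the norm does
  not grow.\<close>

lemma factor_functional:
  assumes h: "h \<in> carr (dual Z)" "\<And>b. b \<in> B \<Longrightarrow> h b = 0"
  shows "\<exists>g. g \<in> carr (dual ZB) \<and> (\<forall>x. g (Q x) = h x) \<and> nrm (dual ZB) g \<le> nrm (dual Z) h"
proof -
  have hQ: "h x = h y" if "Q x = Q y" for x y
    using Z.dual_minus[OF h(1), of x y] h(2)[of "x - y"] that by (simp add: Z.minus_def Q_eq_iff)
  define g where "g = restrict (\<lambda>q. h (SOME x. q = Q x)) (carr ZB)"
  have gQ: "g (Q x) = h x" for x
  proof -
    have "Q x = Q (SOME y. Q x = Q y)" by (rule someI[of _ x]) simp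
    from hQ[OF this] show ?thesis by (simp add: g_def)
  qed
  have b: "norm (g q) \<le> nrm (dual Z) h * nrm ZB q" if q: "q \<in> carr ZB" for q
  proof -
    obtain x where x: "q = Q x" using q by (auto simp: carr_quot)
    show ?thesis
    proof (cases "nrm (dual Z) h = 0")
      case True
      then show ?thesis using Z.dual_bound[OF h(1), of x] by (simp add: x gQ)
    next
      case False
      then have pos: "nrm (dual Z) h > 0" using Z.dual_nrm_nonneg[OF h(1)] by simp
      have "norm (h x) / nrm (dual Z) h \<le> nrm ZB (Q x)"
      proof (rule Q_nrm_ge)
        fix v assume "v - x \<in> B"
        then have "h x = h v" using hQ[of v x] by (simp add: Q_eq_iff)
        then show "norm (h x) / nrm (dual Z) h \<le> norm v"
          using Z.dual_bound[OF h(1), of v] pos by (simp add: pos_divide_le_eq mult.commute)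
      qed
      then show ?thesis using pos by (simp add: x gQ pos_divide_le_eq mult.commute)
    qed
  qed
  have gr: "restrict g (carr ZB) \<in> carr (dual ZB)"
  proof (rule quot.dualI[OF _ _ b])
    fix p q c assume "p \<in> carr ZB"
    then obtain x where x: "p = Q x" by (auto simp: carr_quot)
    show "g (smul ZB c p) = c * g p"
      using Z.dual_smul[OF h(1), of x c] by (simp add: x Q_smul gQ)
    assume "q \<in> carr ZB"
    then obtain y where y: "q = Q y" by (auto simp: carr_quot)
    show "g (add ZB p q) = g p + g q"
      using Z.dual_add[OF h(1), of x y] by (simp add: x y Q_add gQ)
  qed
  have "restrict g (carr ZB) = g" by (simp add: g_def)
  then have g: "g \<in> carr (dual ZB)" using gr by metis
  have "nrm (dual ZB) g \<le> nrm (dual Z) h"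
    using b Z.dual_nrm_nonneg[OF h(1)] by (intro quot.dual_nrm_le) auto
  then show ?thesis using g gQ by blast
qed

end

text \<open>For \<open>M \<subseteq> F\<close> this is the canonical surjection of
  \<open>Z/M\<close> onto \<open>Z/F\<close>. Cosets are sets, so a representative is chosen;
  \<open>quot_proj_apply\<close> shows that the choice is immaterial.\<close>

definition quot_proj :: "'z::banach set \<Rightarrow> 'z set \<Rightarrow> 'z set \<Rightarrow> 'z set" where
  "quot_proj M F q = quot_map F (SOME x. q = quot_map M x)"

context banach_space_over
begin

lemma quot_proj_apply:
  assumes M: "closed_subspace scl M" and F: "closed_subspace scl F" and MF: "M \<subseteq> F"
  shows "quot_proj M F (quot_map M x) = quot_map F x"
proof -
  interpret M: closed_sub scl M by unfold_locales (rule M)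
  interpret F: closed_sub scl F by unfold_locales (rule F)
  have "quot_map M x = quot_map M (SOME y. quot_map M x = quot_map M y)" by (rule someI[of _ x]) simp
  then have "x - (SOME y. quot_map M x = quot_map M y) \<in> F" using MF by (auto simp: M.Q_eq_iff)
  then show ?thesis by (metis quot_proj_def F.Q_eq_iff)
qed

lemma quot_proj_operator:
  assumes M: "closed_subspace scl M" and F: "closed_subspace scl F" and MF: "M \<subseteq> F"
  shows "operator (quot_space scl M) (quot_space scl F) (quot_proj M F) 1"
proof -
  interpret M: closed_sub scl M by unfold_locales (rule M)
  interpret F: closed_sub scl F by unfold_locales (rule F)
  note [simp] = quot_proj_apply[OF assms]
  show ?thesis
  proof
    show "bounded_op (quot_space scl M) (quot_space scl F) (quot_proj M F) 1"
      unfolding bounded_op_def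
    proof (intro conjI ballI allI)
      fix p assume "p \<in> carr (quot_space scl M)"
      then obtain x where x: "p = quot_map M x" by (auto simp: M.carr_quot)
      show "quot_proj M F p \<in> carr (quot_space scl F)" by (simp add: x)
      show "quot_proj M F (smul (quot_space scl M) c p) = smul (quot_space scl F) c (quot_proj M F p)" for c
        by (simp add: x M.Q_smul F.Q_smul)
      have "nrm (quot_space scl F) (quot_map F x) \<le> nrm (quot_space scl M) (quot_map M x)"
        using MF by (intro M.Q_nrm_ge F.Q_nrm_le) auto
      then show "nrm (quot_space scl F) (quot_proj M F p) \<le> 1 * nrm (quot_space scl M) p"
        by (simp add: x)
      fix q assume "q \<in> carr (quot_space scl M)"
      then obtain y where y: "q = quot_map M y" by (auto simp: M.carr_quot)
      show "quot_proj M F (add (quot_space scl M) p q) = add (quot_space scl F) (quot_proj M F p) (quot_proj M F q)"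
        by (simp add: x y M.Q_add F.Q_add)
    qed simp
  qed
qed

text \<open>A functional \<open>\<xi>\<close> on the bidual of \<open>Z/F\<close> that vanishes on
  \<open>Z/F\<close> but not at \<open>\<eta>\<close> is pulled back to \<open>z\<close> along the
  second conjugate of the projection. Composed with that projection, the second conjugate of the
  pair's operator takes values in the canonical image of \<open>Z/F\<close>, by compactness of
  \<open>K\<close>. So the conjugate of \<open>T'.S'\<close> maps \<open>z\<close> to zero, a
  canonical element.\<close>

lemma cotauberian_if:
  assumes L: "closed_subspace scl L" and M: "closed_subspace scl M"
    and K: "compact_operator scl K" and F: "closed_subspace scl F" and MF: "M \<subseteq> F"
    and nr: "\<not> reflexive (quot_space scl F)" and LK: "L \<subseteq> (\<lambda>x. x - K x) -` F"
  shows "\<not> cotauberian_pair scl L M"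
proof -
  interpret L: closed_sub scl L by unfold_locales (rule L)
  interpret M: closed_sub scl M by unfold_locales (rule M)
  interpret F: closed_sub scl F by unfold_locales (rule F)
  let ?L = "sub_space scl L" and ?ZM = "quot_space scl M" and ?ZF = "quot_space scl F"
  let ?\<pi> = "quot_proj M F"
  interpret T: operator ?L ?ZM "quot_map M" 1 by (rule quot_map_operator[OF L M])
  interpret T': operator "dual ?ZM" "dual ?L" T.S' 1 by (rule T.conj_operator)
  interpret T'': operator "bidual ?L" "bidual ?ZM" T'.S' 1 by (rule T'.conj_operator)
  interpret Q: operator Z ?ZF "quot_map F" 1 by (rule quot_map_operator[OF UNIV_closed_subspace F])
  interpret P: operator ?ZM ?ZF ?\<pi> 1 by (rule quot_proj_operator[OF M F MF])
  interpret P': operator "dual ?ZF" "dual ?ZM" P.S' 1 by (rule P.conj_operator)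
  interpret P'': operator "bidual ?ZM" "bidual ?ZF" P'.S' 1 by (rule P'.conj_operator)
  note \<pi> = quot_proj_apply[OF M F MF]
  obtain \<eta> where \<eta>: "\<eta> \<in> carr (bidual ?ZF)" "\<eta> \<notin> canonical_image ?ZF"
    using nr F.quot.not_reflexive_iff by blast
  obtain d where d: "F.quot.far \<eta> d" using F.quot.complete_far[OF F.complete_quot \<eta>] .
  have d0: "d > 0" using d by (simp add: F.quot.far_def)
  \<comment> \<open>The graph of the functional that sends \<open>c \<eta> + q\<close>, with
    \<open>q\<close> in \<open>Z/F\<close>, to \<open>c\<close>. As \<open>\<eta>\<close> is at
    distance at least \<open>d\<close> from \<open>Z/F\<close>, it is bounded by
    \<open>1 / d\<close>.\<close>
  define G where "G = {(\<Psi>, c) | \<Psi> c. \<Psi> \<in> carr (bidual ?ZF) \<and>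
    (\<exists>q\<in>carr ?ZF. \<forall>\<phi>\<in>carr (dual ?ZF). \<Psi> \<phi> = c * \<eta> \<phi> + \<phi> q)}"
  have zeroF: "\<phi> (quot_map F 0) = 0" if "\<phi> \<in> carr (dual ?ZF)" for \<phi>
    using F.quot.dual_smul[OF that, of "quot_map F 0" 0] by (simp add: F.Q_smul)
  have Gcanon: "(canon ?ZF q, 0) \<in> G" if q: "q \<in> carr ?ZF" for q
    using q by (auto simp: G_def intro!: bexI[of _ q])
  have G\<eta>: "(\<eta>, 1) \<in> G"
    using \<eta>(1) zeroF by (auto simp: G_def intro!: bexI[of _ "quot_map F 0"])
  obtain \<xi> where \<xi>: "\<xi> \<in> carr (dual (bidual ?ZF))" "\<And>v c. (v, c) \<in> G \<Longrightarrow> \<xi> v = c"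
  proof (rule P''.Y.hahn_banach[of G "1 / d"])
    show "G \<noteq> {}" using G\<eta> by blast
    show "(add (bidual ?ZF) v w, k + l) \<in> G" if vk: "(v, k) \<in> G" and wl: "(w, l) \<in> G" for v k w l
    proof -
      obtain p where p: "p \<in> carr ?ZF" "v \<in> carr (bidual ?ZF)"
        "\<And>\<phi>. \<phi> \<in> carr (dual ?ZF) \<Longrightarrow> v \<phi> = k * \<eta> \<phi> + \<phi> p" using vk by (auto simp: G_def)
      obtain q where q: "q \<in> carr ?ZF" "w \<in> carr (bidual ?ZF)"
        "\<And>\<phi>. \<phi> \<in> carr (dual ?ZF) \<Longrightarrow> w \<phi> = l * \<eta> \<phi> + \<phi> q" using wl by (auto simp: G_def)
      have "add (bidual ?ZF) v w \<phi> = (k + l) * \<eta> \<phi> + \<phi> (add ?ZF p q)"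
        if \<phi>: "\<phi> \<in> carr (dual ?ZF)" for \<phi>
        using p(3)[OF \<phi>] q(3)[OF \<phi>] F.quot.dual_add[OF \<phi> p(1) q(1)]
        by (simp add: P'.X.dual_add_apply[OF \<phi>] distrib_right)
      moreover have "add ?ZF p q \<in> carr ?ZF" "add (bidual ?ZF) v w \<in> carr (bidual ?ZF)"
        using p q by simp_all
      ultimately show ?thesis unfolding G_def by blast
    qed
    show "(smul (bidual ?ZF) a v, a * k) \<in> G" if vk: "(v, k) \<in> G" for v k a
    proof -
      obtain p where p: "p \<in> carr ?ZF" "v \<in> carr (bidual ?ZF)"
        "\<And>\<phi>. \<phi> \<in> carr (dual ?ZF) \<Longrightarrow> v \<phi> = k * \<eta> \<phi> + \<phi> p" using vk by (auto simp: G_def)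
      have "smul (bidual ?ZF) a v \<phi> = (a * k) * \<eta> \<phi> + \<phi> (smul ?ZF a p)"
        if \<phi>: "\<phi> \<in> carr (dual ?ZF)" for \<phi>
        using p(3)[OF \<phi>] F.quot.dual_smul[OF \<phi> p(1), of a]
        by (simp add: P'.X.dual_smul_apply[OF \<phi>] distrib_left mult.assoc)
      moreover have "smul ?ZF a p \<in> carr ?ZF" "smul (bidual ?ZF) a v \<in> carr (bidual ?ZF)"
        using p by simp_all
      ultimately show ?thesis unfolding G_def by blast
    qed
    show "norm k \<le> 1 / d * nrm (bidual ?ZF) v" if vk: "(v, k) \<in> G" for v k
    proof (cases "k = 0")
      case True
      then show ?thesis using vk d0 P''.Y.nrm_nonneg[of v] by (auto simp: G_def)
    next
      case False
      obtain p where p: "p \<in> carr ?ZF" "v \<in> carr (bidual ?ZF)"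
        "\<And>\<phi>. \<phi> \<in> carr (dual ?ZF) \<Longrightarrow> v \<phi> = k * \<eta> \<phi> + \<phi> p" using vk by (auto simp: G_def)
      let ?x = "smul ?ZF (- inverse k) p"
      have "?x \<in> carr ?ZF" using p by simp
      then obtain \<phi> where \<phi>: "\<phi> \<in> carr (dual ?ZF)" "norm (\<eta> \<phi> - \<phi> ?x) > d * nrm (dual ?ZF) \<phi>"
        using d unfolding F.quot.far_def by blast
      have "\<eta> \<phi> - \<phi> ?x = inverse k * v \<phi>"
        using p(3)[OF \<phi>(1)] F.quot.dual_smul[OF \<phi>(1) p(1)] False by (simp add: field_simps)
      then have "d * nrm (dual ?ZF) \<phi> < norm (v \<phi>) / norm k"
        using \<phi>(2) by (simp add: norm_mult norm_inverse divide_inverse mult.commute)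
      then have "norm k * (d * nrm (dual ?ZF) \<phi>) < norm (v \<phi>)"
        using False by (simp add: pos_less_divide_eq mult.commute)
      also have "\<dots> \<le> nrm (bidual ?ZF) v * nrm (dual ?ZF) \<phi>"
        by (rule P'.X.dual_bound[OF p(2) \<phi>(1)])
      finally have lt: "(norm k * d) * nrm (dual ?ZF) \<phi> < nrm (bidual ?ZF) v * nrm (dual ?ZF) \<phi>"
        by (simp add: mult.assoc)
      then have "norm k * d < nrm (bidual ?ZF) v"
        using F.quot.dual_nrm_nonneg[OF \<phi>(1)] by (rule mult_right_less_imp_less)
      then show ?thesis using d0 by (simp add: field_simps)
    qed
  qed (use d0 in \<open>auto simp: G_def\<close>)
  define z where "z = P''.S' \<xi>"
  have z: "z \<in> carr (bidual (dual ?ZM))" unfolding z_def using \<xi>(1) by (rule P''.conj_carr)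
  have z_apply: "z \<Psi> = \<xi> (P'.S' \<Psi>)" if "\<Psi> \<in> carr (bidual ?ZM)" for \<Psi>
    using that \<xi>(1) by (simp add: z_def)
  have zcan: "z (canon ?ZM q) = 0" if q: "q \<in> carr ?ZM" for q
  proof -
    have "P'.S' (canon ?ZM q) = canon ?ZF (?\<pi> q)"
      using q by (intro P'.X.dual_ext) auto
    then show ?thesis using z_apply[of "canon ?ZM q"] q \<xi>(2)[OF Gcanon[of "?\<pi> q"]] by simp
  qed
  \<comment> \<open>The conjugate of the projection does not decrease norms (\<open>nge\<close>), so
    \<open>\<eta>\<close> can be transported to its range and extended. This gives a preimage of
    \<open>\<eta>\<close> under the second conjugate.\<close>
  obtain \<Psi> where \<Psi>: "\<Psi> \<in> carr (bidual ?ZM)" "P'.S' \<Psi> = \<eta>"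
  proof -
    have nge: "nrm (dual ?ZF) g \<le> nrm (dual ?ZM) (P.S' g)" if g: "g \<in> carr (dual ?ZF)" for g
    proof (rule F.quot.dual_nrm_le)
      show "0 \<le> nrm (dual ?ZM) (P.S' g)" using g by (intro M.quot.dual_nrm_nonneg) simp
      fix q assume "q \<in> carr ?ZF"
      then obtain x where x: "q = quot_map F x" by (auto simp: F.carr_quot)
      have le: "norm (g q) \<le> nrm (dual ?ZM) (P.S' g) * norm v" if "v - x \<in> F" for v
      proof -
        have "g q = P.S' g (quot_map M v)" using g that by (simp add: \<pi> x F.Q_eq_iff[of v x, THEN iffD2])
        then have "norm (g q) \<le> nrm (dual ?ZM) (P.S' g) * nrm ?ZM (quot_map M v)"
          using g M.quot.dual_bound[of "P.S' g" "quot_map M v"] by simp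
        also have "\<dots> \<le> nrm (dual ?ZM) (P.S' g) * norm v"
          using g by (intro mult_left_mono M.Q_nrm M.quot.dual_nrm_nonneg) simp
        finally show ?thesis .
      qed
      show "norm (g q) \<le> nrm (dual ?ZM) (P.S' g) * nrm ?ZF q"
      proof (cases "nrm (dual ?ZM) (P.S' g) = 0")
        case True
        then show ?thesis using le[of x] F.zero by simp
      next
        case False
        then have pos: "nrm (dual ?ZM) (P.S' g) > 0"
          using g M.quot.dual_nrm_nonneg[of "P.S' g"] by simp
        have "norm (g q) / nrm (dual ?ZM) (P.S' g) \<le> nrm ?ZF (quot_map F x)"
          using le pos by (intro F.Q_nrm_ge) (simp add: pos_divide_le_eq mult.commute)
        then show ?thesis using pos by (simp add: x pos_divide_le_eq mult.commute)
      qed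
    qed
    define H where "H = {(P.S' g, \<eta> g) | g. g \<in> carr (dual ?ZF)}"
    obtain \<Psi> where \<Psi>: "\<Psi> \<in> carr (bidual ?ZM)" "\<And>v c. (v, c) \<in> H \<Longrightarrow> \<Psi> v = c"
    proof (rule T'.X.hahn_banach[of H "nrm (bidual ?ZF) \<eta>"])
      show "H \<noteq> {}" using P'.X.carr_nonempty by (auto simp: H_def)
      show "0 \<le> nrm (bidual ?ZF) \<eta>" by (rule P'.X.dual_nrm_nonneg[OF \<eta>(1)])
      show "norm c \<le> nrm (bidual ?ZF) \<eta> * nrm (dual ?ZM) v" if vc: "(v, c) \<in> H" for v c
      proof -
        obtain g where g: "g \<in> carr (dual ?ZF)" "v = P.S' g" "c = \<eta> g" using vc by (auto simp: H_def)
        have "norm c \<le> nrm (bidual ?ZF) \<eta> * nrm (dual ?ZF) g"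
          using P'.X.dual_bound[OF \<eta>(1) g(1)] g(3) by simp
        also have "\<dots> \<le> nrm (bidual ?ZF) \<eta> * nrm (dual ?ZM) v"
          unfolding g(2) by (intro mult_left_mono nge g(1) P'.X.dual_nrm_nonneg[OF \<eta>(1)])
        finally show ?thesis .
      qed
      show "(add (dual ?ZM) v w, k + l) \<in> H" if vk: "(v, k) \<in> H" and wl: "(w, l) \<in> H" for v k w l
      proof -
        obtain g where g: "g \<in> carr (dual ?ZF)" "v = P.S' g" "k = \<eta> g" using vk by (auto simp: H_def)
        obtain h where h: "h \<in> carr (dual ?ZF)" "w = P.S' h" "l = \<eta> h" using wl by (auto simp: H_def)
        have "add (dual ?ZM) v w = P.S' (add (dual ?ZF) g h)" "k + l = \<eta> (add (dual ?ZF) g h)"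
          using g h P'.S_add[OF g(1) h(1)] P'.X.dual_add[OF \<eta>(1) g(1) h(1)] by simp_all
        moreover have "add (dual ?ZF) g h \<in> carr (dual ?ZF)" using g(1) h(1) by simp
        ultimately show ?thesis unfolding H_def by blast
      qed
      show "(smul (dual ?ZM) a v, a * k) \<in> H" if vk: "(v, k) \<in> H" for v k a
      proof -
        obtain g where g: "g \<in> carr (dual ?ZF)" "v = P.S' g" "k = \<eta> g" using vk by (auto simp: H_def)
        have "smul (dual ?ZM) a v = P.S' (smul (dual ?ZF) a g)" "a * k = \<eta> (smul (dual ?ZF) a g)"
          using g P'.S_smul[OF g(1), of a] P'.X.dual_smul[OF \<eta>(1) g(1), of a] by simp_all
        moreover have "smul (dual ?ZF) a g \<in> carr (dual ?ZF)" using g(1) by simp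
        ultimately show ?thesis unfolding H_def by blast
      qed
    qed (auto simp: H_def)
    have "P'.S' \<Psi> = \<eta>"
    proof (rule P'.X.dual_ext[OF _ \<eta>(1)])
      show "P'.S' \<Psi> \<in> carr (bidual ?ZF)" using \<Psi>(1) by simp
      fix g assume g: "g \<in> carr (dual ?ZF)"
      have "(P.S' g, \<eta> g) \<in> H" using g by (auto simp: H_def)
      from \<Psi>(2)[OF this] show "P'.S' \<Psi> g = \<eta> g" using g \<Psi>(1) by simp
    qed
    with \<Psi>(1) show thesis by (rule that)
  qed
  \<comment> \<open>\<open>z\<close> kills the canonical image of \<open>Z/M\<close>, so a
    \<open>w\<close> representing it would be zero; yet
    \<open>z \<Psi> = \<xi> \<eta> = 1\<close>.\<close>
  have "z \<notin> canonical_image (dual ?ZM)"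
  proof
    assume "z \<in> canonical_image (dual ?ZM)"
    then obtain w where w: "w \<in> carr (dual ?ZM)" "z = canon (dual ?ZM) w"
      by (auto simp: canonical_image_canon)
    have "w q = 0" if "q \<in> carr ?ZM" for q using zcan[OF that] w that by simp
    then have "w = smul (dual ?ZM) 0 w"
      using w(1) by (intro M.quot.dual_ext) (auto simp: M.quot.dual_smul_apply)
    then have "\<Psi> w = 0 * \<Psi> w" using T'.X.dual_smul[OF \<Psi>(1) w(1), of 0] by metis
    then have "z \<Psi> = 0" using w \<Psi>(1) by simp
    then show False using z_apply[OF \<Psi>(1)] \<Psi>(2) \<xi>(2)[OF G\<eta>] by simp
  qed
  then have zmem: "z \<in> carr (bidual (dual ?ZM)) - canonical_image (dual ?ZM)" using z by simp
  have zT: "z (T'.S' \<Phi>) = 0" if \<Phi>: "\<Phi> \<in> carr (bidual ?L)" for \<Phi>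
  proof -
    obtain k where k: "\<forall>h\<in>carr (dual Z). \<Phi> (\<lambda>x\<in>L. h (K x)) = h k"
      using compact_operator_bidual[OF K L.subspace \<Phi>] by (elim exE)
    have "P'.S' (T'.S' \<Phi>) = canon ?ZF (quot_map F k)"
    proof (rule P'.X.dual_ext)
      fix g assume g: "g \<in> carr (dual ?ZF)"
      have "quot_map F x = quot_map F (K x)" if "x \<in> L" for x
        using LK that by (auto simp: F.Q_eq_iff)
      \<comment> \<open>On \<open>L\<close> the cosets of \<open>x\<close> and \<open>K x\<close>
        modulo \<open>F\<close> coincide, so \<open>K\<close> can be inserted before applying
        \<open>k\<close>.\<close>
      then have "(\<lambda>x\<in>L. P.S' g (quot_map M x)) = (\<lambda>x\<in>L. Q.S' g (K x))"
        using g by (intro restrict_ext) (simp add: \<pi>)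
      then have "T.S' (P.S' g) = (\<lambda>x\<in>L. Q.S' g (K x))"
        using P.conj_carr[OF g] by (subst conj_op_def) simp
      then show "P'.S' (T'.S' \<Phi>) g = canon ?ZF (quot_map F k) g"
        using g \<Phi> bspec[OF k Q.conj_carr[OF g]] by simp
    qed (use \<Phi> in auto)
    then show ?thesis using z_apply[of "T'.S' \<Phi>"] \<Phi> \<xi>(2)[OF Gcanon[of "quot_map F k"]] by simp
  qed
  obtain u where u: "u \<in> carr (dual ?L)" using T'.Y.carr_nonempty by blast
  have "\<Phi> (smul (dual ?L) 0 u) = 0" if "\<Phi> \<in> carr (bidual ?L)" for \<Phi>
    using T'.Y.dual_smul[OF that u, of 0] by simp
  then have "\<not> tauberian (dual ?ZM) (dual ?L) T.S'"
    unfolding T'.not_tauberian_iff using zmem u zT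
    by (intro bexI[of _ z] bexI[of _ "smul (dual ?L) 0 u"]) auto
  then show ?thesis by (simp add: cotauberian_pair_def cotauberian_def)
qed

lemma cotauberian_only_if:
  assumes L: "closed_subspace scl L" and M: "closed_subspace scl M"
    and nc: "\<not> cotauberian_pair scl L M"
  shows "\<exists>K F. compact_operator scl K \<and> closed_subspace scl F \<and> M \<subseteq> F \<and>
    \<not> reflexive (quot_space scl F) \<and> L \<subseteq> (\<lambda>x. x - K x) -` F"
proof -
  interpret L: closed_sub scl L by unfold_locales (rule L)
  interpret M: closed_sub scl M by unfold_locales (rule M)
  let ?L = "sub_space scl L" and ?ZM = "quot_space scl M"
  interpret T: operator ?L ?ZM "quot_map M" 1 by (rule quot_map_operator[OF L M])
  interpret T': operator "dual ?ZM" "dual ?L" T.S' 1 by (rule T.conj_operator)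
  interpret T'': operator "bidual ?L" "bidual ?ZM" T'.S' 1 by (rule T'.conj_operator)
  interpret Q: operator Z ?ZM "quot_map M" 1 by (rule quot_map_operator[OF UNIV_closed_subspace M])
  obtain z where z': "z \<in> carr (bidual (dual ?ZM)) - canonical_image (dual ?ZM)"
    and zcan': "\<forall>q\<in>carr ?ZM. z (canon ?ZM q) = 0"
    and zT': "\<forall>g\<in>carr (bidual ?L). z (T'.S' g) = 0"
    using T.not_cotauberian[OF nc[unfolded cotauberian_pair_def]] by (elim bexE conjE)
  have z: "z \<in> carr (bidual (dual ?ZM))" "z \<notin> canonical_image (dual ?ZM)" using z' by auto
  note zcan = bspec[OF zcan'] and zT = bspec[OF zT']
  obtain d where d: "T'.X.far z d" using M.quot.dual_far[OF z] .
  have d0: "d > 0" using d by (simp add: T'.X.far_def)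
  obtain u0 where u0: "u0 \<in> carr (dual ?L)" using T'.Y.carr_nonempty by blast
  \<comment> \<open>The zero functional on \<open>L\<close>, which is the target point for
    \<open>helly\<close>.\<close>
  define o0 where "o0 = smul (dual ?L) 0 u0"
  have o0: "o0 \<in> carr (dual ?L)" using u0 by (simp add: o0_def)
  have zo: "z (T'.S' g) = g o0" if "g \<in> carr (bidual ?L)" for g
    using zT[OF that] T'.Y.dual_smul[OF that u0, of 0] by (simp add: o0_def)
  have mo: "T'.Y.minus v o0 = v" if "v \<in> carr (dual ?L)" for v
    using that u0 by (simp add: T'.Y.minus_def o0_def T'.Y.smul_smul T'.Y.add_zero)
  define C where "C = nrm (bidual (dual ?ZM)) z + 1"
  have C: "C > 0" using T''.Y.dual_nrm_nonneg[OF z(1)] by (simp add: C_def)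
  \<comment> \<open>The \<open>u\<close> and \<open>f\<close> form a triangular system as in the
    tauberian part, while the \<open>u\<close> and the vectors \<open>h\<close> are biorthogonal.
    The last clause makes the series for \<open>K\<close> converge.\<close>
  define P where "P t n r \<longleftrightarrow> (case r of (u, f, h) \<Rightarrow>
      u \<in> carr (dual ?ZM) \<and> nrm (dual ?ZM) u < C \<and>
      f \<in> carr (bidual ?ZM) \<and> nrm (bidual ?ZM) f \<le> 1 / d \<and> z f = 1 \<and>
      (\<forall>m<n. f (fst (t m)) = 0) \<and> (\<forall>m<n. fst (snd (t m)) u = 1) \<and> f u = 1 \<and>
      (\<forall>m<n. u (quot_map M (snd (snd (t m)))) = 0) \<and> (\<forall>m<n. fst (t m) (quot_map M h) = 0) \<and>
      u (quot_map M h) = 1 \<and> nrm (dual ?L) (T.S' u) * norm h \<le> (1 / 2) ^ n)"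
    for t :: "nat \<Rightarrow> ('z set \<Rightarrow> 'k) \<times> (('z set \<Rightarrow> 'k) \<Rightarrow> 'k) \<times> 'z" and n r
  have "\<exists>t. \<forall>n. P t n (t n)"
  proof (rule dependent_wellorder_choice)
    show "P f n r = P g n r" if "\<And>m. m < n \<Longrightarrow> f m = g m" for r f g n
      using that by (simp add: P_def)
  next
    fix n t assume IH: "\<And>m. m < n \<Longrightarrow> P t m (t m)"
    define U where "U m = fst (t m)" for m
    define F where "F m = fst (snd (t m))" for m
    define H where "H m = snd (snd (t m))" for m
    have U: "U m \<in> carr (dual ?ZM)" "nrm (dual ?ZM) (U m) < C" "F m \<in> carr (bidual ?ZM)" "z (F m) = 1"
      if "m < n" for m
      using IH[OF that] by (auto simp: P_def U_def F_def split: prod.splits)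
    have UH: "U i (quot_map M (H j)) = (if i = j then 1 else 0)" if "i < n" "j < n" for i j
      using IH[OF that(1)] IH[OF that(2)]
      by (cases i j rule: linorder_cases) (auto simp: P_def U_def H_def split: prod.splits)
    obtain f where f: "f \<in> carr (bidual ?ZM)" "\<forall>a\<in>U ` {..<n}. f a = 0"
      "z f = 1" "nrm (bidual ?ZM) f \<le> 1 / d"
      using T'.X.far_functional[OF z(1) d, of "U ` {..<n}"] U(1) by auto
    \<comment> \<open>A bound for the norm of the coming \<open>h\<close> that depends only on
      earlier choices, so \<open>u\<close> can be made small on \<open>L\<close> relative to
      it.\<close>
    define B where "B = 2 / d * (1 + (\<Sum>m<n. C * norm (H m)))"
    have "(\<Sum>m<n. C * norm (H m)) \<ge> 0" using C by (intro sum_nonneg) auto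
    then have B: "B > 0" using d0 by (simp add: B_def add_pos_nonneg)
    \<comment> \<open>The canonical images of the earlier vectors belong to \<open>\<Phi>\<close>;
      because \<open>z\<close> vanishes on them, the new \<open>u\<close> vanishes at these
      vectors.\<close>
    define \<Phi> where "\<Phi> = insert f (F ` {..<n} \<union> (\<lambda>m. canon ?ZM (quot_map M (H m))) ` {..<n})"
    have \<Phi>: "finite \<Phi>" "\<Phi> \<subseteq> carr (bidual ?ZM)" using f(1) U(3) by (auto simp: \<Phi>_def)
    obtain u where u: "u \<in> carr (dual ?ZM)" "nrm (dual ?ZM) u < C" "\<forall>\<phi>\<in>\<Phi>. \<phi> u = z \<phi>"
      "nrm (dual ?L) (T'.Y.minus (T.S' u) o0) < (1 / 2) ^ n / B"
      using T'.helly[OF z(1) _ o0 zo \<Phi>, of C "(1 / 2) ^ n / B"] B by (auto simp: C_def)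
    have fu: "f u = 1" and Fu: "F m u = 1" and uH: "u (quot_map M (H m)) = 0" if "m < n" for m
      using u(1,3) f(3) U(4)[OF that] zcan[of "quot_map M (H m)"] that
      by (auto simp: \<Phi>_def)
    \<comment> \<open>The preceding \<open>fu\<close> carries the premise \<open>m < n\<close>; this
      version also covers \<open>n = 0\<close>.\<close>
    have fu: "f u = 1" using u(3) f(3) by (simp add: \<Phi>_def)
    \<comment> \<open>From \<open>f u = 1\<close> and the bound \<open>1 / d\<close> on
      \<open>f\<close>, the norm of \<open>u\<close> is at least \<open>d\<close>, so some coset
      nearly attains it.\<close>
    have "\<exists>q\<in>carr ?ZM. norm (u q) > d / 2 * nrm ?ZM q"
    proof (rule ccontr)
      assume "\<not> ?thesis"
      then have "nrm (dual ?ZM) u \<le> d / 2"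
        using d0 by (intro M.quot.dual_nrm_le) (auto simp: not_less)
      then have "nrm (bidual ?ZM) f * nrm (dual ?ZM) u \<le> 1 / d * (d / 2)"
        using f(4) d0 T'.X.nrm_nonneg[OF u(1)] by (intro mult_mono) auto
      moreover have "1 \<le> nrm (bidual ?ZM) f * nrm (dual ?ZM) u"
        using T'.X.dual_bound[OF f(1) u(1)] fu by simp
      ultimately show False using d0 by simp
    qed
    then obtain q where q: "q \<in> carr ?ZM" "norm (u q) > d / 2 * nrm ?ZM q" by blast
    then obtain x where x: "q = quot_map M x" by (auto simp: M.carr_quot)
    have "nrm ?ZM (quot_map M x) < norm (u q) * 2 / d" using q(2) d0 by (simp add: x field_simps)
    then obtain g where g: "g - x \<in> M" "norm g < norm (u q) * 2 / d" by (rule M.Q_nrm_less)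
    have qg: "q = quot_map M g" using g(1) by (simp add: x M.Q_eq_iff[of g x, THEN iffD2])
    have upos: "norm (u q) > 0"
    proof -
      have "0 < norm (u q) * 2 / d" using norm_ge_zero[of g] g(2) by linarith
      then show ?thesis using d0 by (simp add: zero_less_divide_iff zero_less_mult_iff)
    qed
    define c where "c = inverse (u q)"
    \<comment> \<open>A Gram-Schmidt correction: subtracting \<open>s\<close> makes all earlier
      functionals vanish, and it leaves the value of \<open>u\<close> unchanged since
      \<open>u\<close> kills the earlier vectors. The factor \<open>c\<close> normalises that value
      to 1.\<close>
    define s where "s = (\<Sum>m<n. scl (U m q) (H m))"
    define h where "h = scl c (g - s)"
    have lin: "v (quot_map M h) = c * (v q - (\<Sum>m<n. U m q * v (quot_map M (H m))))"
      if v: "v \<in> carr (dual ?ZM)" for v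
    proof -
      let ?v = "Q.S' v"
      have v': "?v \<in> carr (dual Z)" using v by (rule Q.conj_carr)
      interpret bl: bounded_linear ?v by (rule bounded_linear_functional[OF v'])
      have sc: "?v (scl a y) = a * ?v y" for a y using Z.dual_smul[OF v', of y a] by simp
      have "?v h = c * (?v g - (\<Sum>m<n. U m q * ?v (H m)))"
        by (simp add: h_def s_def sc bl.diff bl.sum)
      then show ?thesis using v by (simp add: qg)
    qed
    have h1: "u (quot_map M h) = 1"
      using lin[OF u(1)] upos uH by (simp add: c_def)
    have h0: "U k (quot_map M h) = 0" if k: "k < n" for k
    proof -
      have "(\<Sum>m<n. U m q * U k (quot_map M (H m))) = (\<Sum>m<n. if m = k then U k q else 0)"
        using UH[OF k] by (intro sum.cong) auto
      then show ?thesis using lin[OF U(1)[OF k]] k by simp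
    qed
    have "norm s \<le> (\<Sum>m<n. C * norm g * norm (H m))"
      unfolding s_def
    proof (rule sum_norm_le)
      fix m assume "m \<in> {..<n}"
      then have m: "m < n" by simp
      have "norm (U m q) \<le> C * nrm ?ZM q"
        using M.quot.dual_nrm_ge[OF U(1)[OF m] q(1)] U(2)[OF m] by simp
      also have "\<dots> \<le> C * norm g" using M.Q_nrm[of g] C by (simp add: qg)
      finally show "norm (scl (U m q) (H m)) \<le> C * norm g * norm (H m)"
        by (simp add: norm_scl mult_right_mono)
    qed
    also have "\<dots> = norm g * (\<Sum>m<n. C * norm (H m))"
      by (simp add: sum_distrib_left mult_ac)
    finally have "norm (g - s) \<le> norm g * (1 + (\<Sum>m<n. C * norm (H m)))"
      using norm_triangle_ineq4[of g s] by (simp add: algebra_simps)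
    also have "\<dots> \<le> (norm (u q) * 2 / d) * (1 + (\<Sum>m<n. C * norm (H m)))"
      using g(2) \<open>(\<Sum>m<n. C * norm (H m)) \<ge> 0\<close> by (intro mult_right_mono) auto
    also have "\<dots> = norm (u q) * B" by (simp add: B_def)
    finally have hB: "norm h \<le> B"
      using upos by (simp add: h_def norm_scl c_def norm_inverse divide_inverse[symmetric]
          pos_divide_le_eq mult.commute[of "inverse _"] mult.commute[of B])
    have Tu: "nrm (dual ?L) (T.S' u) < (1 / 2) ^ n / B"
      using u(4) mo[OF T.conj_carr[OF u(1)]] by simp
    have "nrm (dual ?L) (T.S' u) * norm h \<le> (1 / 2) ^ n / B * B"
      using Tu hB B T'.Y.nrm_nonneg[OF T.conj_carr[OF u(1)]] by (intro mult_mono) auto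
    then have "nrm (dual ?L) (T.S' u) * norm h \<le> (1 / 2) ^ n" using B by simp
    then have "P t n (u, f, h)"
      using u(1,2) f fu Fu uH h0 h1 by (auto simp: P_def U_def F_def H_def)
    then show "\<exists>r. P t n r" ..
  qed
  then obtain t where t: "\<And>n. P t n (t n)" by blast
  define u where "u n = fst (t n)" for n
  define f where "f n = fst (snd (t n))" for n
  define h where "h n = snd (snd (t n))" for n
  have u: "u n \<in> carr (dual ?ZM)" "nrm (dual ?ZM) (u n) < C"
    and f: "f n \<in> carr (bidual ?ZM)" "nrm (bidual ?ZM) (f n) \<le> 1 / d"
    and small: "nrm (dual ?L) (T.S' (u n)) * norm (h n) \<le> (1 / 2) ^ n" for n
    using t[of n] by (auto simp: P_def u_def f_def h_def split: prod.splits)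
  have fu: "f i (u j) = (if i \<le> j then 1 else 0)" for i j
  proof -
    have *: "f n (u n) = 1" "\<And>m. m < n \<Longrightarrow> f n (u m) = 0" "\<And>m. m < n \<Longrightarrow> f m (u n) = 1" for n
      using t[of n] by (simp_all add: P_def u_def f_def split_beta)
    show ?thesis using *(1) *(2)[of j i] *(3)[of i j] by (cases i j rule: linorder_cases) simp_all
  qed
  have uh: "u i (quot_map M (h j)) = (if i = j then 1 else 0)" for i j
  proof -
    have *: "u n (quot_map M (h n)) = 1" "\<And>m. m < n \<Longrightarrow> u n (quot_map M (h m)) = 0"
      "\<And>m. m < n \<Longrightarrow> u m (quot_map M (h n)) = 0" for n
      using t[of n] by (simp_all add: P_def u_def h_def split_beta)
    show ?thesis using *(1) *(2)[of j i] *(3)[of i j] by (cases i j rule: linorder_cases) simp_all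
  qed
  define c where "c n = nrm (dual ?L) (T.S' (u n))" for n
  have c: "c n \<ge> 0" for n unfolding c_def by (intro T'.Y.nrm_nonneg T.conj_carr u)
  have "\<exists>w. w \<in> carr (dual Z) \<and> (\<forall>x\<in>L. w x = T.S' (u n) x) \<and> (\<forall>x. norm (w x) \<le> c n * norm x)" for n
    using extend_functional[OF L.subspace T.conj_carr[OF u(1)], of n "c n"] by (simp add: c_def Bex_def)
  then obtain w where w: "\<And>n. w n \<in> carr (dual Z)" "\<And>n x. x \<in> L \<Longrightarrow> w n x = T.S' (u n) x"
    "\<And>n x. norm (w n x) \<le> c n * norm x" by metis
  have summ: "summable (\<lambda>n. c n * norm (h n))"
  proof (rule summable_comparison_test')
    show "summable (\<lambda>n. (1 / 2 :: real) ^ n)" by (intro summable_geometric) auto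
    show "norm (c n * norm (h n)) \<le> (1 / 2) ^ n" for n
      using small[of n] c[of n] by (simp add: c_def)
  qed
  note nuc = compact_operator_nuclear[of w c, OF w(1,3) c summ]
  define K where "K x = (\<Sum>n. scl (w n x) (h n))" for x
  have K: "compact_operator scl K" unfolding K_def[abs_def] by (rule nuc)
  have uu: "Q.S' (u m) \<in> carr (dual Z)" for m by (intro Q.conj_carr u)
  \<comment> \<open>Biorthogonality leaves one term of the series. On \<open>L\<close>, where
    \<open>w m\<close> equals \<open>u m\<close>, it follows that \<open>u m\<close> vanishes at
    \<open>x - K x\<close>.\<close>
  have uK: "Q.S' (u m) (K x) = w m x" for m x
  proof -
    have "Q.S' (u m) (scl (w n x) (h n)) = (if n = m then w m x else 0)" for n
      using Z.dual_smul[OF uu, of "h n" m "w n x"] u(1) uh[of m n] by auto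
    then have "Q.S' (u m) (K x) = (\<Sum>n. if n = m then w m x else 0)"
      unfolding K_def using bounded_linear.suminf[OF bounded_linear_functional[OF uu] nuc(2)] by simp
    then show ?thesis using sums_unique[OF sums_single[of m "\<lambda>_. w m x"]] by simp
  qed
  define F where "F = {x. \<forall>m. Q.S' (u m) x = 0}"
  have sF: "module.subspace scl F"
    unfolding subspace_iff F_def
    using Z.dual_add[OF uu] Z.dual_smul[OF uu] Z.dual_smul[OF uu, of 0 _ 0] by auto
  have "closed (\<Inter>m. {x. Q.S' (u m) x = 0})"
    by (intro closed_INT ballI closed_Collect_eq continuous_intros
        linear_continuous_on bounded_linear_functional[OF uu])
  moreover have "F = (\<Inter>m. {x. Q.S' (u m) x = 0})" by (auto simp: F_def)
  ultimately have F: "closed_subspace scl F" using sF by (simp add: closed_subspace_def)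
  interpret F: closed_sub scl F by unfold_locales (rule F)
  let ?ZF = "quot_space scl F"
  have MF: "M \<subseteq> F"
  proof
    fix x assume "x \<in> M"
    then have "quot_map M x = smul ?ZM 0 (quot_map M x)" using M.zero by (simp add: M.Q_smul M.Q_eq_iff)
    then have "v (quot_map M x) = 0" if "v \<in> carr (dual ?ZM)" for v
      using M.quot.dual_smul[OF that M.Q_carr, of 0 x] by simp
    then show "x \<in> F" using u(1) by (simp add: F_def)
  qed
  have LF: "L \<subseteq> (\<lambda>x. x - K x) -` F"
  proof
    fix x assume x: "x \<in> L"
    have "Q.S' (u m) (x - K x) = 0" for m
    proof -
      have "Q.S' (u m) (x - K x) = Q.S' (u m) x - w m x"
        using Z.dual_minus[OF uu, of x "K x" m] by (simp add: Z.minus_def uK)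
      then show ?thesis using w(2)[OF x] u(1) x by simp
    qed
    then show "x \<in> (\<lambda>x. x - K x) -` F" by (simp add: F_def)
  qed
  interpret P: operator ?ZM ?ZF "quot_proj M F" 1 by (rule quot_proj_operator[OF M F MF])
  interpret P': operator "dual ?ZF" "dual ?ZM" P.S' 1 by (rule P.conj_operator)
  interpret P'': operator "bidual ?ZM" "bidual ?ZF" P'.S' 1 by (rule P'.conj_operator)
  note \<pi> = quot_proj_apply[OF M F MF]
  have "\<exists>v. v \<in> carr (dual ?ZF) \<and> (\<forall>x. v (quot_map F x) = Q.S' (u n) x) \<and>
      nrm (dual ?ZF) v \<le> nrm (dual Z) (Q.S' (u n))" for n
  proof -
    have "Q.S' (u n) b = 0" if "b \<in> F" for b using that by (simp add: F_def)
    then show ?thesis by (rule F.factor_functional[OF uu])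
  qed
  then obtain v where v: "\<And>n. v n \<in> carr (dual ?ZF)" "\<And>n x. v n (quot_map F x) = Q.S' (u n) x"
    "\<And>n. nrm (dual ?ZF) (v n) \<le> nrm (dual Z) (Q.S' (u n))" by metis
  have Pv: "P.S' (v n) = u n" for n
  proof (rule M.quot.dual_ext[OF P.conj_carr[OF v(1)] u(1)])
    fix q assume "q \<in> carr ?ZM"
    then obtain x where "q = quot_map M x" by (auto simp: M.carr_quot)
    then show "P.S' (v n) q = u n q" using v(1,2) u(1) by (simp add: \<pi>)
  qed
  have vC: "nrm (dual ?ZF) (v n) \<le> C" for n
  proof -
    have "nrm (dual Z) (Q.S' (u n)) \<le> C"
    proof (rule Z.dual_nrm_le)
      fix x assume "x \<in> carr Z"
      have "norm (u n (quot_map M x)) \<le> C * nrm ?ZM (quot_map M x)"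
        using u[of n] by (intro M.quot.dual_nrm_ge) auto
      also have "\<dots> \<le> C * norm x" using M.Q_nrm[of x] C by simp
      finally show "norm (Q.S' (u n) x) \<le> C * nrm Z x" using u(1) by simp
    qed (use C in simp)
    then show ?thesis using v(3) order_trans by blast
  qed
  have "\<not> reflexive ?ZF"
  proof
    assume refl: "reflexive ?ZF"
    \<comment> \<open>Under reflexivity the images of the \<open>f i\<close> in the bidual of
      \<open>Z/F\<close> become points \<open>y i\<close>. Points now come from the \<open>f\<close>
      and functionals from the \<open>u\<close>, so the two limits are exchanged compared with the
      tauberian part.\<close>
    have "\<exists>y\<in>carr ?ZF. P'.S' (f i) = canon ?ZF y" for i
      using refl P'.conj_carr[OF f(1), of i] by (auto simp: reflexive_def canonical_image_canon)
    then obtain y where y: "\<And>i. y i \<in> carr ?ZF" "\<And>i. P'.S' (f i) = canon ?ZF (y i)" by metis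
    have gy: "g (y i) = f i (P.S' g)" if g: "g \<in> carr (dual ?ZF)" for g i
    proof -
      have "g (y i) = canon ?ZF (y i) g" using g by simp
      also have "\<dots> = f i (P.S' g)" using g f(1) by (simp flip: y(2))
      finally show ?thesis .
    qed
    have vy: "v i (y j) = (if j \<le> i then 1 else 0)" for i j
      using gy[OF v(1)] by (simp add: Pv fu)
    have "\<not> reflexive ?ZF"
    proof (rule F.quot.double_limit_not_reflexive[OF y(1) v(1) _ vC])
      show "norm (g (y j)) \<le> (1 / d) * nrm (dual ?ZF) g" if g: "g \<in> carr (dual ?ZF)" for j g
      proof -
        have "norm (f j (P.S' g)) \<le> 1 / d * nrm (dual ?ZM) (P.S' g)"
          using f[of j] P.conj_carr[OF g] by (intro T'.X.dual_nrm_ge) auto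
        also have "\<dots> \<le> 1 / d * nrm (dual ?ZF) g"
          using P'.S_bound[OF g] d0 by (intro mult_left_mono) auto
        finally show ?thesis by (simp add: gy[OF g])
      qed
      show "(\<lambda>j. v i (y j)) \<longlonglongrightarrow> 0" for i
        unfolding vy by (rule tendsto_eventually, rule eventually_sequentiallyI[of "Suc i"]) auto
      show "(\<lambda>i. v i (y j)) \<longlonglongrightarrow> 1" for j
        unfolding vy by (rule tendsto_eventually, rule eventually_sequentiallyI[of j]) auto
    qed (use C d0 in auto)
    then show False using refl by simp
  qed
  then show ?thesis using K F MF LF by blast
qed

end

theorem theorem3p14:
  fixes scl :: "'k::real_or_complex \<Rightarrow> 'z::banach \<Rightarrow> 'z"
    and L M N :: "'z set"
  assumes "banach_space_over scl"
    and "closed_subspace scl L" and "closed_subspace scl M" and "closed_subspace scl N"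
  shows "(\<not> tauberian_pair scl M N \<longleftrightarrow>
           (\<exists>K E. compact_operator scl K \<and> closed_subspace scl E \<and>
              \<not> reflexive (sub_space scl E) \<and> E \<subseteq> M \<and> (\<lambda>x. x - K x) ` E \<subseteq> N))
       \<and> (\<not> cotauberian_pair scl L M \<longleftrightarrow>
           (\<exists>K F. compact_operator scl K \<and> closed_subspace scl F \<and> M \<subseteq> F \<and>
              \<not> reflexive (quot_space scl F) \<and> L \<subseteq> (\<lambda>x. x - K x) -` F))"
proof -
  interpret banach_space_over scl by fact
  show ?thesis
  proof (intro conjI iffI)
    show "\<not> tauberian_pair scl M N" if "\<exists>K E. compact_operator scl K \<and> closed_subspace scl E \<and>
      \<not> reflexive (sub_space scl E) \<and> E \<subseteq> M \<and> (\<lambda>x. x - K x) ` E \<subseteq> N"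
      using that by (elim exE conjE) (rule tauberian_if[OF assms(3,4)])
    show "\<not> cotauberian_pair scl L M" if "\<exists>K F. compact_operator scl K \<and> closed_subspace scl F \<and>
      M \<subseteq> F \<and> \<not> reflexive (quot_space scl F) \<and> L \<subseteq> (\<lambda>x. x - K x) -` F"
      using that by (elim exE conjE) (rule cotauberian_if[OF assms(2,3)])
  qed (rule tauberian_only_if[OF assms(3,4)] cotauberian_only_if[OF assms(2,3)], assumption)+
qed

end
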